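(* Let $f(\bm x)=g(\bm x)\,\mathbb{I}\{\phi(\bm x)\ge0\}$, with $\phi(\bm x)=S_A-K$, be one of the seven functions (E1)–(E7) listed in the context, and let $j\in\{1,\dots,d\}$ be a fixed index such that the $j$-th column of the generating matrix $\bm A=(a_{ik})$ satisfies $$a_{ij}\ge0\ \text{ for all } i=1,\dots,d\qquad(\text{or } a_{ij}\le0\ \text{ for all } i=1,\dots,d).\qquad(\mathrm{C}_j)$$ If $v,w$ are subsets of $\{1,\dots,d\}$ satisfying $j\in v$ and $j\notin w$, then: (i) $P_vf$ is a $\mathcal{C}^\infty$ function of $\bm x_{-v}\in\mathbb{R}^{d-|v|}$, and $f_w$ is a $\mathcal{C}^\infty$ function of $\bm x_w\in\mathbb{R}^{|w|}$; and (ii) for arbitrarily small $\epsilon>0$, $$\mathbb{E}\big[|\hat I(P_vf)-I(f)|\big]=O(n^{-1+\epsilon}),\qquad \mathbb{E}\big[|\hat I(f_w)-I(f_w)|\big]=O(n^{-1+\epsilon}).$$ If condition $(\mathrm{C}_j)$ is satisfied with all $j\in\{1,\dots,d\}$, the results above hold for all $v\ne\varnothing$ and all $w\ne\{1,\dots,d\}$.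
   Context: Setting. $\rho,\Phi$ are the density and cumulative distribution function of the standard normal distribution, $\bm x\sim N(\bm 0,\bm I_d)$, and $I(h)=\mathbb{E}[h(\bm x)]$. Parameters: initial price $S_0>0$, strike $K>0$, maturity $T>0$, volatility $\sigma>0$, interest rate $\mu\in\mathbb{R}$; $\Delta t=T/d$, $t_i=i\Delta t$. $\bm\Sigma$ is the $d\times d$ matrix with entries $\Sigma_{ik}=\Delta t\min(i,k)$, and the generating matrix $\bm A=(a_{ik})$ is a real $d\times d$ matrix with $\bm A\bm A^\top=\bm\Sigma$. Put $$S_i=S(t_i)=S_0\exp\Big[(\mu-\sigma^2/2)i\Delta t+\sigma\sum_{k=1}^da_{ik}x_k\Big],\qquad S_A=\frac1d\sum_{i=1}^dS_i .$$ The functions: (E1) $f=e^{-\mu T}(S_A-K)\,\mathbb{I}\{S_A\ge K\}$. (E2) $f=e^{-\mu T}\frac{S_A}{S_0}\,\mathbb{I}\{S_A\ge K\}$. (E3) $f=e^{-\mu T}\frac{S_A\left(\log(S_1/S_0)-(\mu+\sigma^2/2)\Delta t\right)}{S_0^2\sigma^2\Delta t}\,\mathbb{I}\{S_A\ge K\}$. (E4) $f=e^{-\mu T}\Big[\frac{T}{d^2}\sum_{i=1}^di\,S_i-T(S_A-K)\Big]\mathbb{I}\{S_A\ge K\}$. (E5) $f=e^{-\mu T}\Big[\frac1d\sum_{i=1}^dS_i\Big(\frac{\omega i}{2d}+\frac{\log(S_i/S_0)}{2T}\Big)-\mu(S_A-K)\Big]\mathbb{I}\{S_A\ge K\}$,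 with $\omega=\mu-\sigma^2/2$. (E6) $f=e^{-\mu T}\frac1d\sum_{i=1}^d\frac{S_i}{\sigma}\Big[\log\big(\tfrac{S_i}{S_0}\big)-\big(\mu+\tfrac12\sigma^2\big)t_i\Big]\mathbb{I}\{S_A\ge K\}$. (E7) $f=e^{-\mu T}\,\mathbb{I}\{S_A\ge K\}$. Projections and ANOVA terms. For $v\subseteq\{1,\dots,d\}$, $-v=\{1,\dots,d\}\setminus v$, $|v|$ is the cardinality, $\bm x_v$ denotes the components with indices in $v$, and $(P_vf)(\bm x_{-v})=\int_{\mathbb{R}^{|v|}}f(\bm x_v,\bm x_{-v})\prod_{i\in v}\rho(x_i)\,\mathrm{d}\bm x_v$. The ANOVA term is $f_w=\sum_{u\subseteq w}(-1)^{|w|-|u|}P_{-u}f$, a function of $\bm x_w$. Quadrature. For a function $h$ of $s$ real variables, $\hat I(h)=\frac1n\sum_{i=1}^nh(\Phi^{-1}(\bm u_i))$, with $\Phi^{-1}$ applied componentwise, where $\bm u_1,\dots,\bm u_n\in(0,1)^s$ are the first $n$ points of a scrambled $(t,s)$-sequence in a fixed base $\mathsf{b}\ge2$ (here $s=d-|v|$ for $P_vf$ and $s=|w|$ for $f_w$). $O(\cdot)$ is as $n\to\infty$ and $\mathbb{E}$ is over the scrambling. Convention: if $s=0$ then $h$ is a constant and $\hat I(h)=h$. A $(t,m,s)$-net in base $\mathsf b$ is a set of $\mathsf b^m$ points of $[0,1)^s$ such that every box $\prod_{k=1}^s[a_k\mathsf b^{-\ell_k},(a_k+1)\mathsf b^{-\ell_k})$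 (integers $\ell_k\ge0$, $0\le a_k<\mathsf b^{\ell_k}$) of volume $\mathsf b^{t-m}$ contains exactly $\mathsf b^t$ of them; a $(t,s)$-sequence is an infinite sequence $(\bm p_i)_{i\ge1}$ such that for all integers $k\ge0$, $m\ge t$ the points $\bm p_{k\mathsf b^m+1},\dots,\bm p_{(k+1)\mathsf b^m}$ form a $(t,m,s)$-net. Scrambling (Owen): independently for each coordinate, a value with base-$\mathsf b$ digits $0.a_1a_2a_3\dots$ is replaced by $0.\pi(a_1)\,\pi_{a_1}(a_2)\,\pi_{a_1a_2}(a_3)\dots$, where the permutations $\pi,\pi_{a_1},\pi_{a_1a_2},\dots$ of $\{0,\dots,\mathsf b-1\}$, indexed by the preceding digits, are mutually independent and uniformly distributed, and are the same for all points of the sequence. *)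

theory Defs
  imports "HOL-Probability.Probability" "HOL-Library.Landau_Symbols"
begin

text \<open>
  A point of R^J, for a finite set J of coordinates, is a function in PiE J (\<lambda>_. UNIV), i.e. a
  real function on J that is undefined outside J.  Matrices are functions of two indices, only
  used on {1..d}.
\<close>

definition generating_matrix :: "nat \<Rightarrow> real \<Rightarrow> (nat \<Rightarrow> nat \<Rightarrow> real) \<Rightarrow> bool" where
  "generating_matrix d T A \<longleftrightarrow>
     (\<forall>i\<in>{1..d}. \<forall>k\<in>{1..d}. (\<Sum>l=1..d. A i l * A k l) = T / real d * real (min i k))"

definition one_signed_column :: "nat \<Rightarrow> (nat \<Rightarrow> nat \<Rightarrow> real) \<Rightarrow> nat \<Rightarrow> bool" where
  "one_signed_column d A j \<longleftrightarrow> (\<forall>i\<in>{1..d}. 0 \<le> A i j) \<or> (\<forall>i\<in>{1..d}. A i j \<le> 0)"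

definition asset_price ::
  "real \<Rightarrow> real \<Rightarrow> real \<Rightarrow> real \<Rightarrow> nat \<Rightarrow> (nat \<Rightarrow> nat \<Rightarrow> real) \<Rightarrow> nat \<Rightarrow> (nat \<Rightarrow> real) \<Rightarrow> real" where
  "asset_price S0 T \<sigma> \<mu> d A i x =
     S0 * exp ((\<mu> - \<sigma>\<^sup>2 / 2) * real i * (T / real d) + \<sigma> * (\<Sum>k=1..d. A i k * x k))"

definition average_price ::
  "real \<Rightarrow> real \<Rightarrow> real \<Rightarrow> real \<Rightarrow> nat \<Rightarrow> (nat \<Rightarrow> nat \<Rightarrow> real) \<Rightarrow> (nat \<Rightarrow> real) \<Rightarrow> real" where
  "average_price S0 T \<sigma> \<mu> d A x = (1 / real d) * (\<Sum>i=1..d. asset_price S0 T \<sigma> \<mu> d A i x)"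

text \<open>
  The smooth factors g of the seven integrands f = g * 1{S_A >= K}, in order: the
  discounted arithmetic Asian call, its estimators of delta, gamma, rho, theta and vega, and the
  digital option.
\<close>

definition asian_factors ::
  "real \<Rightarrow> real \<Rightarrow> real \<Rightarrow> real \<Rightarrow> real \<Rightarrow> nat \<Rightarrow> (nat \<Rightarrow> nat \<Rightarrow> real) \<Rightarrow> ((nat \<Rightarrow> real) \<Rightarrow> real) set" where
  "asian_factors S0 K T \<sigma> \<mu> d A =
    (let S = asset_price S0 T \<sigma> \<mu> d A;
         SA = average_price S0 T \<sigma> \<mu> d A;
         dt = T / real d;
         \<omega> = \<mu> - \<sigma>\<^sup>2 / 2
     in {
       \<lambda>x. exp (- \<mu> * T) * (SA x - K),
       \<lambda>x. exp (- \<mu> * T) * (SA x / S0),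
       \<lambda>x. exp (- \<mu> * T) *
             (SA x * (ln (S 1 x / S0) - (\<mu> + \<sigma>\<^sup>2 / 2) * dt) / (S0\<^sup>2 * \<sigma>\<^sup>2 * dt)),
       \<lambda>x. exp (- \<mu> * T) *
             (T / (real d)\<^sup>2 * (\<Sum>i=1..d. real i * S i x) - T * (SA x - K)),
       \<lambda>x. exp (- \<mu> * T) *
             ((1 / real d) * (\<Sum>i=1..d. S i x *
                  (\<omega> * real i / (2 * real d) + ln (S i x / S0) / (2 * T))) - \<mu> * (SA x - K)),
       \<lambda>x. exp (- \<mu> * T) *
             ((1 / real d) * (\<Sum>i=1..d. S i x / \<sigma> *
                  (ln (S i x / S0) - (\<mu> + \<sigma>\<^sup>2 / 2) * (real i * dt)))),
       \<lambda>x. exp (- \<mu> * T) })"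

definition gauss_expectation :: "nat \<Rightarrow> ((nat \<Rightarrow> real) \<Rightarrow> real) \<Rightarrow> real" where
  "gauss_expectation d h = (LINT x|PiM {1..d} (\<lambda>_. std_normal_distribution). h x)"

text \<open>P_v f; the argument y has its coordinates in {1..d} - v.\<close>

definition projection ::
  "nat \<Rightarrow> nat set \<Rightarrow> ((nat \<Rightarrow> real) \<Rightarrow> real) \<Rightarrow> (nat \<Rightarrow> real) \<Rightarrow> real" where
  "projection d v f y =
     (LINT x|PiM v (\<lambda>_. lborel).
        f (merge v ({1..d} - v) (x, y)) * (\<Prod>i\<in>v. std_normal_density (x i)))"

definition anova_term ::
  "nat \<Rightarrow> nat set \<Rightarrow> ((nat \<Rightarrow> real) \<Rightarrow> real) \<Rightarrow> (nat \<Rightarrow> real) \<Rightarrow> real" where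
  "anova_term d w f y = (\<Sum>u\<in>Pow w. (-1) ^ (card w - card u) * projection d ({1..d} - u) f y)"

text \<open>
  Membership in C^k through iterated partial derivatives; h' is determined on PiE J (\<lambda>_. UNIV), the
  carrier of the product topology, and irrelevant elsewhere.
\<close>

primrec Ck_on_coords :: "nat \<Rightarrow> nat set \<Rightarrow> ((nat \<Rightarrow> real) \<Rightarrow> real) \<Rightarrow> bool" where
  "Ck_on_coords 0 J h \<longleftrightarrow> continuous_map (product_topology (\<lambda>_. euclideanreal) J) euclideanreal h"
| "Ck_on_coords (Suc k) J h \<longleftrightarrow>
     continuous_map (product_topology (\<lambda>_. euclideanreal) J) euclideanreal h \<and>
     (\<forall>i\<in>J. \<exists>h'. (\<forall>x\<in>PiE J (\<lambda>_. UNIV).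
                     ((\<lambda>s. h (x(i := s))) has_real_derivative h' x) (at (x i))) \<and>
                  Ck_on_coords k J h')"

definition smooth_on_coords :: "nat set \<Rightarrow> ((nat \<Rightarrow> real) \<Rightarrow> real) \<Rightarrow> bool" where
  "smooth_on_coords J h \<longleftrightarrow> (\<forall>k. Ck_on_coords k J h)"

text \<open>
  The points p i of a net are counted with multiplicity: they are indexed by i in I, and p i k is
  the coordinate k of p i.  The dimension s is the cardinality of the coordinate set J.
\<close>

definition tms_net ::
  "nat \<Rightarrow> nat \<Rightarrow> nat \<Rightarrow> nat set \<Rightarrow> nat set \<Rightarrow> (nat \<Rightarrow> nat \<Rightarrow> real) \<Rightarrow> bool" where
  "tms_net b t m J I p \<longleftrightarrow>
     finite I \<and> card I = b ^ m \<and>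
     (\<forall>i\<in>I. \<forall>k\<in>J. 0 \<le> p i k \<and> p i k < 1) \<and>
     (\<forall>l a. (\<forall>k\<in>J. a k < b ^ l k) \<and> (\<Prod>k\<in>J. 1 / real b ^ l k) = real b ^ t / real b ^ m \<longrightarrow>
        card {i\<in>I. \<forall>k\<in>J. real (a k) / real b ^ l k \<le> p i k \<and>
                           p i k < (real (a k) + 1) / real b ^ l k} = b ^ t)"

definition ts_sequence :: "nat \<Rightarrow> nat \<Rightarrow> nat set \<Rightarrow> (nat \<Rightarrow> nat \<Rightarrow> real) \<Rightarrow> bool" where
  "ts_sequence b t J p \<longleftrightarrow>
     (\<forall>k m. t \<le> m \<longrightarrow> tms_net b t m J {k * b ^ m + 1 .. (k + 1) * b ^ m} p)"

text \<open>The digit a_k (k >= 1) of x in [0,1), for the expansion not ending in b-1, b-1, ...\<close>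

definition digit :: "nat \<Rightarrow> real \<Rightarrow> nat \<Rightarrow> nat" where
  "digit b x k = nat \<lfloor>real b ^ k * x\<rfloor> mod b"

text \<open>The permutation tau [a_1, ..., a_k] acts on the digit a_(k+1).\<close>

definition scramble_value :: "nat \<Rightarrow> (nat list \<Rightarrow> nat \<Rightarrow> nat) \<Rightarrow> real \<Rightarrow> real" where
  "scramble_value b \<tau> x =
     (\<Sum>k. real (\<tau> (map (digit b x) [1..<Suc k]) (digit b x (Suc k))) / real b ^ Suc k)"

text \<open>
  The random permutation \<pi> k as is the one used in coordinate k after the digits as.
\<close>

definition owen_scrambling ::
  "'w measure \<Rightarrow> nat \<Rightarrow> nat set \<Rightarrow> (nat \<Rightarrow> nat list \<Rightarrow> 'w \<Rightarrow> nat \<Rightarrow> nat) \<Rightarrow> bool" where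
  "owen_scrambling M b J \<pi> \<longleftrightarrow>
     prob_space M \<and>
     prob_space.indep_vars M (\<lambda>_. count_space {\<tau>. \<tau> permutes {..<b}})
       (\<lambda>(k, as). \<pi> k as) (J \<times> lists {..<b}) \<and>
     (\<forall>k\<in>J. \<forall>as\<in>lists {..<b}.
        distr M (count_space {\<tau>. \<tau> permutes {..<b}}) (\<pi> k as) =
        uniform_count_measure {\<tau>. \<tau> permutes {..<b}})"

abbreviation std_normal_cdf :: "real \<Rightarrow> real" where
  "std_normal_cdf \<equiv> cdf std_normal_distribution"

text \<open>
  The points u i are used for i = 1, ..., n.  The inverse is only meaningful on (0,1), where the
  scrambled points lie almost surely; elsewhere it is an irrelevant constant.
\<close>

definition quadrature ::
  "nat set \<Rightarrow> (nat \<Rightarrow> nat \<Rightarrow> real) \<Rightarrow> nat \<Rightarrow> ((nat \<Rightarrow> real) \<Rightarrow> real) \<Rightarrow> real" where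
  "quadrature J u n h =
     (if J = {} then h (\<lambda>_. undefined)
      else (1 / real n) * (\<Sum>i=1..n. h (\<lambda>k\<in>J. inv std_normal_cdf (u i k))))"

text \<open>
  Integrability is stated along with the bound on the mean error since the Lebesgue integral of a
  non-integrable function is 0 by convention.
\<close>

definition scrambled_L1_rate ::
  "'w measure \<Rightarrow> nat \<Rightarrow> nat set \<Rightarrow> ((nat \<Rightarrow> real) \<Rightarrow> real) \<Rightarrow> real \<Rightarrow> real \<Rightarrow> bool" where
  "scrambled_L1_rate M b J h c \<epsilon> \<longleftrightarrow>
     (\<forall>t p \<pi>. ts_sequence b t J p \<and> owen_scrambling M b J \<pi> \<longrightarrow>
        (let err = (\<lambda>n \<omega>.
               \<bar>quadrature J (\<lambda>i k. scramble_value b (\<lambda>as. \<pi> k as \<omega>) (p i k)) n h - c\<bar>)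
         in (\<forall>n\<ge>1. integrable M (err n)) \<and>
            (\<lambda>n. LINT \<omega>|M. err n \<omega>) \<in> O(\<lambda>n. real n powr (-1 + \<epsilon>))))"

end

theory Submission
  imports Defs
begin

text \<open>
  Smoothness.  If the column \<open>j\<close> of the generating matrix has one sign, the average price \<open>S\<^sub>A\<close> is
  strictly monotone in \<open>x\<^sub>j\<close>.  For \<open>j \<in> v\<close>, write \<open>\<partial>\<^sub>k\<close> of the indicator of \<open>{S\<^sub>A \<ge> K}\<close> as
  \<open>(\<partial>\<^sub>k S\<^sub>A / \<partial>\<^sub>j S\<^sub>A) \<partial>\<^sub>j\<close> of it and integrate by parts in \<open>x\<^sub>j\<close>.  This shows that a derivative of
  \<open>P\<^sub>v (g 1{S\<^sub>A \<ge> K})\<close> is again of the form \<open>P\<^sub>v (h 1{S\<^sub>A \<ge> K})\<close>, where \<open>h\<close> lies in the algebra generated by the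
  coordinates, the prices and \<open>1 / \<partial>\<^sub>j S\<^sub>A\<close>.  All elements of that algebra grow at most exponentially.

  Rate.  The fundamental theorem of calculus in each coordinate expands a smooth function of exponential
  growth as a superposition of indicators of boxes whose sides are half-lines directed away from the
  origin, weighted by its mixed derivatives.  For such a box of Gaussian volume \<open>V\<close>, the error of
  the scrambled points is almost surely at most \<open>C n\<^bsup>\<epsilon>\<^esup> / n\<close> since they still form a (t,s)-sequence, and it is at most
  \<open>2 V\<close> in the mean since each point is uniformly distributed.  Interpolating, the mean error is of order
  \<open>n\<^bsup>2\<epsilon>-1\<^esup> V\<^bsup>\<epsilon>\<^esup>\<close>, and the power \<open>V\<^bsup>\<epsilon>\<^esup>\<close> of the Gaussian tails makes the superposition integrable.
\<close>

section \<open>Discrepancy of nets and sequences\<close>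

text \<open>Taking means repairs this, since a box far out contains few scrambled points on average.
  Neither of the two bounds for a box is enough alone: the pathwise one does not decay with the
  endpoints, and the mean one does not improve with \<open>n\<close>. A geometric mean with a small
  exponent has both properties.

  For smoothness, the reciprocal of \<open>dSA j\<close> is harmless because column \<open>j\<close>
  is not zero, which follows from the covariance matrix being nonsingular; one price then bounds
  \<open>dSA j\<close> from below, and a price decays at most exponentially. The indicator itself
  cannot be differentiated, so the integration by parts is done for arctan approximations
  \<open>chi n\<close>, and only an identity between increments is passed to the limit.\<close>

definition adic_index :: "nat \<Rightarrow> nat \<Rightarrow> real \<Rightarrow> nat" where
  "adic_index b l y = nat \<lfloor>real b ^ l * y\<rfloor>"

text \<open>Cells are half-open, so membership in a cell is equality of natural numbers. This turns
  the interval conditions of \<open>tms_net\<close> into counting of indices, on which scrambling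
  acts as a bijection.\<close>

lemma adic_index_eq_iff:
  assumes "b \<ge> 2" "0 \<le> y"
  shows "adic_index b l y = a \<longleftrightarrow> real a / real b ^ l \<le> y \<and> y < (real a + 1) / real b ^ l"
proof -
  have pos: "real b ^ l > 0" using assms by simp
  have "adic_index b l y = a \<longleftrightarrow> \<lfloor>real b ^ l * y\<rfloor> = int a"
    unfolding adic_index_def using assms by (auto simp: nat_eq_iff)
  also have "\<dots> \<longleftrightarrow> real a \<le> real b ^ l * y \<and> real b ^ l * y < real a + 1"
    by (simp add: floor_eq_iff)
  finally show ?thesis using pos by (simp add: field_simps)
qed

lemma adic_index_add:
  assumes "b \<ge> 2" "0 \<le> y"
  shows "adic_index b (l + e) y div b ^ e = adic_index b l y"
proof -
  have "\<lfloor>real b ^ (l + e) * y / real_of_int (int (b ^ e))\<rfloor> = \<lfloor>real b ^ (l + e) * y\<rfloor> div int (b ^ e)"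
    by (rule floor_divide_real_eq_div) simp
  moreover have "real b ^ (l + e) * y / real_of_int (int (b ^ e)) = real b ^ l * y"
    using assms by (simp add: power_add)
  ultimately show ?thesis
    unfolding adic_index_def using assms by (simp add: nat_div_distrib nat_power_eq)
qed

lemma adic_index_Suc:
  assumes "b \<ge> 2" "0 \<le> y"
  shows "adic_index b (Suc l) y div b = adic_index b l y"
  using adic_index_add[OF assms, of l 1] by simp

lemma adic_index_less:
  assumes "b \<ge> 2" "0 \<le> y" "y < 1"
  shows "adic_index b l y < b ^ l"
proof -
  have "real b ^ l * y < real b ^ l" using assms by simp
  then have "\<lfloor>real b ^ l * y\<rfloor> < int (b ^ l)" by (simp add: floor_less_iff)
  then show ?thesis unfolding adic_index_def using assms by (simp add: nat_less_iff)
qed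

lemma adic_index_bounds:
  assumes "b \<ge> 2" "0 \<le> y"
  shows "real (adic_index b l y) / real b ^ l \<le> y" "y < (real (adic_index b l y) + 1) / real b ^ l"
  using adic_index_eq_iff[OF assms, of l "adic_index b l y"] by auto

lemma prod_inverse_power:
  assumes "finite J"
  shows "(\<Prod>k\<in>J. 1 / real b ^ l k) = 1 / real b ^ sum l J"
  using assms by (simp add: prod_dividef power_sum)

text \<open>Powers of \<open>b\<close> determine their exponents, so the volume condition of
  \<open>tms_net\<close> becomes a linear equation between levels.\<close>

lemma elementary_volume_iff:
  assumes "b \<ge> 2" "finite J"
  shows "(\<Prod>k\<in>J. 1 / real b ^ l k) = real b ^ t / real b ^ m \<longleftrightarrow> sum l J + t = m"
proof -
  have "(\<Prod>k\<in>J. 1 / real b ^ l k) = real b ^ t / real b ^ m \<longleftrightarrow> real b ^ (sum l J + t) = real b ^ m"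
    using assms by (auto simp: prod_inverse_power field_simps power_add)
  also have "\<dots> \<longleftrightarrow> sum l J + t = m"
    by (rule power_inject_exp) (use assms in simp)
  finally show ?thesis .
qed

lemma tms_net_elementary_count:
  assumes net: "tms_net b t m J I p" and b: "b \<ge> 2" and J: "finite J"
    and a: "\<forall>k\<in>J. a k < b ^ l k" and l: "sum l J + t = m"
  shows "card {i\<in>I. \<forall>k\<in>J. adic_index b (l k) (p i k) = a k} = b ^ t"
proof -
  have "{i\<in>I. \<forall>k\<in>J. adic_index b (l k) (p i k) = a k} =
        {i\<in>I. \<forall>k\<in>J. real (a k) / real b ^ l k \<le> p i k \<and> p i k < (real (a k) + 1) / real b ^ l k}"
    using net b by (auto simp: tms_net_def adic_index_eq_iff)
  moreover have "(\<Prod>k\<in>J. 1 / real b ^ l k) = real b ^ t / real b ^ m"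
    using elementary_volume_iff[OF b J] l by blast
  ultimately show ?thesis using net a unfolding tms_net_def by auto
qed

text \<open>The definition of a net only speaks of boxes of the smallest admissible volume. A larger
  box is the disjoint union of such boxes, obtained by cutting a single coordinate into
  \<open>b ^ e\<close> pieces; this is where \<open>J\<close> has to be nonempty.\<close>

lemma tms_net_count:
  assumes net: "tms_net b t m J I p" and b: "b \<ge> 2" and J: "finite J" "J \<noteq> {}"
    and a: "\<forall>k\<in>J. a k < b ^ l k" and l: "sum l J + t \<le> m"
  shows "card {i\<in>I. \<forall>k\<in>J. adic_index b (l k) (p i k) = a k} = b ^ (m - sum l J)"
proof -
  obtain k0 where k0: "k0 \<in> J" using J by auto
  define e where "e = m - t - sum l J"
  \<comment> \<open>Coordinate \<open>k0\<close> is refined by \<open>e\<close> levels, with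
    \<open>e\<close> chosen so that the volume becomes exactly \<open>b ^ t / b ^ m\<close>;
    \<open>a' c\<close> selects piece number \<open>c\<close> of the cell
    \<open>a k0\<close>.\<close>
  define l' where "l' = l(k0 := l k0 + e)"
  define a' where "a' c = a(k0 := a k0 * b ^ e + c)" for c
  have fI: "finite I" and p: "\<And>i k. i \<in> I \<Longrightarrow> k \<in> J \<Longrightarrow> 0 \<le> p i k"
    using net by (auto simp: tms_net_def)
  define B where "B c = {i\<in>I. \<forall>k\<in>J. adic_index b (l' k) (p i k) = a' c k}" for c
  have "sum l' J = l' k0 + sum l' (J - {k0})" using J k0 by (simp add: sum.remove)
  also have "sum l' (J - {k0}) = sum l (J - {k0})" by (rule sum.cong) (auto simp: l'_def)
  also have "l' k0 + sum l (J - {k0}) = e + sum l J"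
    using J k0 by (simp add: sum.remove[of J k0 l] l'_def)
  finally have suml': "sum l' J + t = m" using l by (simp add: e_def)
  have cardB: "card (B c) = b ^ t" if "c < b ^ e" for c
    unfolding B_def
  proof (rule tms_net_elementary_count[OF net b J(1) _ suml'], rule ballI)
    fix k assume k: "k \<in> J"
    have "a k0 * b ^ e + c < (a k0 + 1) * b ^ e" using that by simp
    also have "\<dots> \<le> b ^ l k0 * b ^ e" using a k0 by (intro mult_right_mono) auto
    finally show "a' c k < b ^ l' k" using a k by (auto simp: a'_def l'_def power_add)
  qed
  have eq: "{i\<in>I. \<forall>k\<in>J. adic_index b (l k) (p i k) = a k} = (\<Union>c<b ^ e. B c)"
  proof (intro equalityI subsetI)
    fix i assume i: "i \<in> {i\<in>I. \<forall>k\<in>J. adic_index b (l k) (p i k) = a k}"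
    define c where "c = adic_index b (l k0 + e) (p i k0) mod b ^ e"
    have "adic_index b (l k0 + e) (p i k0) = a k0 * b ^ e + c"
      using adic_index_add[OF b p, of i k0 "l k0" e] i k0 div_mult_mod_eq[of "adic_index b (l k0 + e) (p i k0)" "b ^ e"]
      by (auto simp: c_def)
    then have "i \<in> B c" using i by (auto simp: B_def a'_def l'_def)
    moreover have "c < b ^ e" using b by (simp add: c_def)
    ultimately show "i \<in> (\<Union>c<b ^ e. B c)" by auto
  next
    fix i assume "i \<in> (\<Union>c<b ^ e. B c)"
    then obtain c where c: "c < b ^ e" "i \<in> B c" by auto
    have iI: "i \<in> I" using c by (simp add: B_def)
    have "adic_index b (l k0 + e) (p i k0) = a k0 * b ^ e + c"
      using c k0 by (auto simp: B_def a'_def l'_def)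
    then have "adic_index b (l k0) (p i k0) = a k0"
      using adic_index_add[OF b p[OF iI k0], of "l k0" e] c
      by (metis add_cancel_right_right div_less div_mult_self3 gr_implies_not0)
    then show "i \<in> {i\<in>I. \<forall>k\<in>J. adic_index b (l k) (p i k) = a k}"
      using c by (auto simp: B_def a'_def l'_def split: if_splits)
  qed
  have "card (\<Union>c<b ^ e. B c) = (\<Sum>c<b ^ e. card (B c))"
  proof (rule card_UN_disjoint)
    show "\<forall>c\<in>{..<b ^ e}. finite (B c)" using fI by (auto simp: B_def)
    show "\<forall>c\<in>{..<b ^ e}. \<forall>c'\<in>{..<b ^ e}. c \<noteq> c' \<longrightarrow> B c \<inter> B c' = {}"
      using k0 by (auto simp: B_def a'_def)
  qed simp
  also have "\<dots> = b ^ e * b ^ t" using cardB by simp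
  also have "\<dots> = b ^ (m - sum l J)" using l by (simp add: e_def flip: power_add)
  finally show ?thesis using eq by simp
qed

text \<open>The b-adic expansion of the endpoint \<open>x\<close> splits \<open>[0, x)\<close> into fewer than \<open>b\<close> cells of each
  level up to \<open>M\<close>, and a part of one cell of level \<open>M\<close>.\<close>

lemma weighted_half_interval_discrepancy:
  fixes y q :: "'i \<Rightarrow> real"
  assumes b: "b \<ge> 2" and I: "finite I" and y: "\<And>i. i \<in> I \<Longrightarrow> 0 \<le> y i \<and> y i < 1"
    and q: "\<And>i. i \<in> I \<Longrightarrow> 0 \<le> q i" and W: "0 \<le> W"
    and cells: "\<And>l a. l \<le> M \<Longrightarrow> a < b ^ l \<Longrightarrow>
      \<bar>(\<Sum>i\<in>I. of_bool (adic_index b l (y i) = a) * q i) - W / real b ^ l\<bar> \<le> \<beta>"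
    and small: "\<And>a. a < b ^ M \<Longrightarrow> (\<Sum>i\<in>I. of_bool (adic_index b M (y i) = a) * q i) \<le> B"
      "W / real b ^ M \<le> B"
    and x: "0 \<le> x" "x < 1"
  shows "\<bar>(\<Sum>i\<in>I. of_bool (y i < x) * q i) - W * x\<bar> \<le> real M * real b * \<beta> + B"
proof -
  define X where "X l = adic_index b l x" for l
  have Xdiv: "X (Suc l) div b = X l" for l using adic_index_Suc[OF b x(1)] by (simp add: X_def)
  have Xless: "X l < b ^ l" for l using adic_index_less[OF b x] by (simp add: X_def)
  have \<beta>: "0 \<le> \<beta>" using cells[of 0 0] by simp
  have main: "\<bar>(\<Sum>i\<in>I. of_bool (adic_index b l (y i) < X l) * q i) - W * real (X l) / real b ^ l\<bar>
      \<le> real l * real b * \<beta>" if "l \<le> M" for l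
    using that
  proof (induction l)
    case 0
    then show ?case using Xless[of 0] by simp
  next
    case (Suc l)
    \<comment> \<open>Cells of level \<open>Suc l\<close> between the truncations of
      \<open>x\<close> after \<open>l\<close> and after \<open>Suc l\<close> digits; their number is
      digit number \<open>Suc l\<close> of \<open>x\<close>.\<close>
    define R where "R = {b * X l..<X (Suc l)}"
    have le: "b * X l \<le> X (Suc l)" using Xdiv[of l] by (metis div_times_less_eq_dividend mult.commute)
    have "X (Suc l) < b * X l + b"
    proof -
      have "X (Suc l) = b * X l + X (Suc l) mod b"
        using mult_div_mod_eq[of b "X (Suc l)"] Xdiv[of l] by simp
      moreover have "X (Suc l) mod b < b" using b by simp
      ultimately show ?thesis by linarith
    qed
    then have cardR: "card R \<le> b" by (simp add: R_def)
    have split: "of_bool (adic_index b (Suc l) (y i) < X (Suc l)) =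
        (of_bool (adic_index b l (y i) < X l) + (\<Sum>a\<in>R. of_bool (adic_index b (Suc l) (y i) = a)) :: real)"
      if i: "i \<in> I" for i
    proof -
      let ?n = "adic_index b (Suc l) (y i)"
      have d: "?n div b = adic_index b l (y i)" using adic_index_Suc[OF b] y[OF i] by simp
      have iff: "?n div b < X l \<longleftrightarrow> ?n < b * X l"
        using b by (simp add: div_less_iff_less_mult mult.commute)
      have "(\<Sum>a\<in>R. of_bool (?n = a)) = (of_bool (?n \<in> R) :: real)"
        by (simp add: R_def of_bool_def)
      then show ?thesis using iff d le by (auto simp: R_def)
    qed
    have "(\<Sum>i\<in>I. of_bool (adic_index b (Suc l) (y i) < X (Suc l)) * q i) =
        (\<Sum>i\<in>I. of_bool (adic_index b l (y i) < X l) * q i +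
           (\<Sum>a\<in>R. of_bool (adic_index b (Suc l) (y i) = a) * q i))"
      by (rule sum.cong[OF refl]) (simp add: split ring_distribs sum_distrib_right)
    also have "\<dots> = (\<Sum>i\<in>I. of_bool (adic_index b l (y i) < X l) * q i) +
           (\<Sum>a\<in>R. \<Sum>i\<in>I. of_bool (adic_index b (Suc l) (y i) = a) * q i)"
      by (simp add: sum.distrib sum.swap[of _ R])
    finally have s1: "(\<Sum>i\<in>I. of_bool (adic_index b (Suc l) (y i) < X (Suc l)) * q i) = \<dots>" .
    have s2: "W * real (X (Suc l)) / real b ^ Suc l =
        W * real (X l) / real b ^ l + (\<Sum>a\<in>R. W / real b ^ Suc l)"
    proof -
      have "real (X (Suc l)) = real b * real (X l) + real (card R)"
        using le by (simp add: R_def of_nat_diff)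
      then show ?thesis using b by (simp add: field_simps)
    qed
    have "\<bar>(\<Sum>a\<in>R. (\<Sum>i\<in>I. of_bool (adic_index b (Suc l) (y i) = a) * q i) - W / real b ^ Suc l)\<bar>
        \<le> (\<Sum>a\<in>R. \<beta>)"
    proof (rule order_trans[OF sum_abs], rule sum_mono)
      fix a assume "a \<in> R"
      then have "a < b ^ Suc l" using Xless[of "Suc l"] by (simp add: R_def)
      then show "\<bar>(\<Sum>i\<in>I. of_bool (adic_index b (Suc l) (y i) = a) * q i) - W / real b ^ Suc l\<bar> \<le> \<beta>"
        using cells[of "Suc l" a] Suc.prems by simp
    qed
    also have "\<dots> \<le> real b * \<beta>" using cardR \<beta> by (simp add: mult_right_mono)
    finally have "\<bar>(\<Sum>a\<in>R. \<Sum>i\<in>I. of_bool (adic_index b (Suc l) (y i) = a) * q i) -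
        (\<Sum>a\<in>R. W / real b ^ Suc l)\<bar> \<le> real b * \<beta>"
      unfolding sum_subtractf .
    moreover have "\<bar>(\<Sum>i\<in>I. of_bool (adic_index b l (y i) < X l) * q i) - W * real (X l) / real b ^ l\<bar>
        \<le> real l * real b * \<beta>" using Suc by simp
    moreover have "real (Suc l) * real b * \<beta> = real l * real b * \<beta> + real b * \<beta>"
      by (simp add: algebra_simps)
    ultimately show ?case unfolding s1 s2 by linarith
  qed
  \<comment> \<open>Contribution of the points that share the cell of level \<open>M\<close> with
    \<open>x\<close>. Both this remainder and the truncation error of \<open>W * x\<close> lie
    between 0 and \<open>B\<close>, so their difference costs \<open>B\<close> only once.\<close>
  define r where "r i = (of_bool (adic_index b M (y i) = X M \<and> y i < x) * q i)" for i
  have sp: "of_bool (y i < x) * q i = of_bool (adic_index b M (y i) < X M) * q i + r i" if i: "i \<in> I" for i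
  proof -
    have "adic_index b M (y i) \<le> X M" if "y i < x"
      unfolding X_def adic_index_def using that b
      by (intro nat_mono floor_mono mult_left_mono) auto
    moreover have "y i < x" if "adic_index b M (y i) < X M"
    proof (rule ccontr)
      assume "\<not> y i < x"
      then have "X M \<le> adic_index b M (y i)" unfolding X_def adic_index_def using b
        by (intro nat_mono floor_mono mult_left_mono) auto
      then show False using that by simp
    qed
    ultimately show ?thesis unfolding r_def by (cases "y i < x") (auto simp: le_less)
  qed
  have "(\<Sum>i\<in>I. of_bool (y i < x) * q i) =
      (\<Sum>i\<in>I. of_bool (adic_index b M (y i) < X M) * q i) + (\<Sum>i\<in>I. r i)"
    by (simp add: sp sum.distrib)
  moreover have "0 \<le> (\<Sum>i\<in>I. r i)" using q by (intro sum_nonneg) (auto simp: r_def)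
  moreover have "(\<Sum>i\<in>I. r i) \<le> (\<Sum>i\<in>I. of_bool (adic_index b M (y i) = X M) * q i)"
    using q by (intro sum_mono) (auto simp: r_def)
  moreover have "\<dots> \<le> B" using small(1) Xless by blast
  moreover have "W * real (X M) / real b ^ M \<le> W * x"
    using mult_left_mono[OF adic_index_bounds(1)[OF b x(1), of M] W] by (simp add: X_def)
  moreover have "W * x \<le> W * real (X M) / real b ^ M + B"
  proof -
    have "W * x \<le> W * ((real (X M) + 1) / real b ^ M)"
      using adic_index_bounds(2)[OF b x(1), of M] W by (intro mult_left_mono) (auto simp: X_def)
    also have "\<dots> = W * real (X M) / real b ^ M + W / real b ^ M" by (simp add: field_simps add_divide_distrib)
    finally show ?thesis using small(2) by linarith
  qed
  ultimately show ?thesis using main[of M] by (simp add: abs_le_iff)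
qed

text \<open>\<open>v\<close> is the length of the part of the interval inside \<open>[0,1)\<close>.
  Lower and upper intervals both occur, as images under the normal distribution function of
  half-lines to the left and to the right; \<open>x = 1\<close> in the first kind stands for a
  coordinate without restriction.\<close>

definition half_interval :: "(real \<Rightarrow> real) \<Rightarrow> real \<Rightarrow> bool" where
  "half_interval H v \<longleftrightarrow> (\<exists>x. 0 \<le> x \<and> x \<le> 1 \<and>
     (H = (\<lambda>y. of_bool (y < x)) \<and> v = x \<or> H = (\<lambda>y. of_bool (x \<le> y)) \<and> v = 1 - x))"

lemma half_interval_bounds:
  assumes "half_interval H v"
  shows "0 \<le> H y" "H y \<le> 1" "0 \<le> v" "v \<le> 1"
  using assms by (auto simp: half_interval_def)

lemma half_interval_full: "half_interval (\<lambda>y. of_bool (y < 1)) 1"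
  unfolding half_interval_def by (intro exI[of _ 1]) auto

text \<open>An upper interval is the complement of a lower one. Replacing the total mass by
  \<open>W\<close> costs the error of the single cell of level 0, which is the summand 1 in the
  factor of \<open>\<beta>\<close>. For the endpoint 1, excluded before, the lower interval carries
  the total mass itself.\<close>

lemma weighted_half_interval_discrepancy':
  fixes y q :: "'i \<Rightarrow> real"
  assumes b: "b \<ge> 2" and I: "finite I" and y: "\<And>i. i \<in> I \<Longrightarrow> 0 \<le> y i \<and> y i < 1"
    and q: "\<And>i. i \<in> I \<Longrightarrow> 0 \<le> q i" and W: "0 \<le> W"
    and cells: "\<And>l a. l \<le> M \<Longrightarrow> a < b ^ l \<Longrightarrow>
      \<bar>(\<Sum>i\<in>I. of_bool (adic_index b l (y i) = a) * q i) - W / real b ^ l\<bar> \<le> \<beta>"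
    and small: "\<And>a. a < b ^ M \<Longrightarrow> (\<Sum>i\<in>I. of_bool (adic_index b M (y i) = a) * q i) \<le> B"
      "W / real b ^ M \<le> B"
    and H: "half_interval H v"
  shows "\<bar>(\<Sum>i\<in>I. H (y i) * q i) - W * v\<bar> \<le> (1 + real M * real b) * \<beta> + B"
proof -
  have idx0: "adic_index b 0 (y i) = 0" if "i \<in> I" for i
    using y[OF that] by (simp add: adic_index_def)
  have tot: "\<bar>(\<Sum>i\<in>I. q i) - W\<bar> \<le> \<beta>"
    using cells[of 0 0] by (simp add: idx0 cong: sum.cong)
  have \<beta>: "0 \<le> \<beta>" using tot by linarith
  have B: "0 \<le> B" by (rule order_trans[OF _ small(2)]) (use W in simp)
  have Mb: "0 \<le> real M * real b * \<beta>" using \<beta> by simp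
  obtain x where x: "0 \<le> x" "x \<le> 1" and
    alt: "H = (\<lambda>y. of_bool (y < x)) \<and> v = x \<or> H = (\<lambda>y. of_bool (x \<le> y)) \<and> v = 1 - x"
    using H by (auto simp: half_interval_def)
  have below: "x < 1 \<Longrightarrow> \<bar>(\<Sum>i\<in>I. of_bool (y i < x) * q i) - W * x\<bar> \<le> real M * real b * \<beta> + B"
    using weighted_half_interval_discrepancy[OF b I y q W cells small x(1)] by blast
  have compl: "(\<Sum>i\<in>I. of_bool (x \<le> y i) * q i) = (\<Sum>i\<in>I. q i) - (\<Sum>i\<in>I. of_bool (y i < x) * q i)"
    unfolding sum_subtractf[symmetric] by (rule sum.cong) (auto simp: of_bool_def)
  have one: "x = 1 \<Longrightarrow> (\<Sum>i\<in>I. of_bool (y i < x) * q i) = (\<Sum>i\<in>I. q i)"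
    using y by (intro sum.cong) auto
  show ?thesis
  proof (cases "x = 1")
    case True
    have "(1 + real M * real b) * \<beta> = \<beta> + real M * real b * \<beta>" by (simp add: algebra_simps)
    moreover have "\<bar>(\<Sum>i\<in>I. H (y i) * q i) - W * v\<bar> \<le> \<beta>"
      using True alt one compl tot \<beta> by auto
    ultimately show ?thesis using Mb B by linarith
  next
    case False
    then have b': "\<bar>(\<Sum>i\<in>I. of_bool (y i < x) * q i) - W * x\<bar> \<le> real M * real b * \<beta> + B"
      using below x by simp
    from alt show ?thesis
    proof
      assume "H = (\<lambda>y. of_bool (y < x)) \<and> v = x"
      then show ?thesis using b' \<beta> by (auto simp: algebra_simps)
    next
      assume h: "H = (\<lambda>y. of_bool (x \<le> y)) \<and> v = 1 - x"
      have "(\<Sum>i\<in>I. H (y i) * q i) - W * v =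
          ((\<Sum>i\<in>I. q i) - W) - ((\<Sum>i\<in>I. of_bool (y i < x) * q i) - W * x)"
        using compl h by (auto simp: right_diff_distrib)
      then show ?thesis using b' tot by (simp add: algebra_simps)
    qed
  qed
qed

text \<open>Not divided by \<open>card I\<close>, so that it is additive over disjoint blocks of
  indices. The factors are arbitrary because cells and half-intervals are mixed in the induction
  over coordinates.\<close>

definition product_discrepancy ::
  "'k set \<Rightarrow> 'i set \<Rightarrow> ('i \<Rightarrow> 'k \<Rightarrow> real) \<Rightarrow> ('k \<Rightarrow> real \<Rightarrow> real) \<Rightarrow> ('k \<Rightarrow> real) \<Rightarrow> real" where
  "product_discrepancy J I p \<phi> v = (\<Sum>i\<in>I. \<Prod>k\<in>J. \<phi> k (p i k)) - real (card I) * (\<Prod>k\<in>J. v k)"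

text \<open>Induction on the set \<open>K\<close> of coordinates that carry a half-interval; the
  others carry a cell. Coordinate \<open>k\<close> is handled by the one-dimensional estimate with
  the product of the other factors as weights: its hypothesis on cells is the induction hypothesis,
  with \<open>k\<close> turned into a cell coordinate. The recursion
  \<open>(1 + m b) \<beta> + b ^ t\<close> leads to the stated bound.\<close>

lemma net_product_discrepancy:
  assumes net: "tms_net b t m J I p" and b: "b \<ge> 2" and J: "finite J" "J \<noteq> {}"
    and K: "K \<subseteq> J"
    and a: "\<forall>k\<in>J - K. a k < b ^ l k \<and> \<phi> k = (\<lambda>y. of_bool (adic_index b (l k) y = a k)) \<and>
      v k = 1 / real b ^ l k"
    and l: "sum l (J - K) + t \<le> m"
    and H: "\<forall>k\<in>K. half_interval (\<phi> k) (v k)"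
  shows "\<bar>product_discrepancy J I p \<phi> v\<bar> \<le> real (card K) * real b ^ t * (1 + real m * real b) ^ card K"
proof -
  have fI: "finite I" and cI: "card I = b ^ m" and p: "\<And>i k. i \<in> I \<Longrightarrow> k \<in> J \<Longrightarrow> 0 \<le> p i k \<and> p i k < 1"
    using net by (auto simp: tms_net_def)
  have "finite K" using K J finite_subset by auto
  then show ?thesis using K a l H
  proof (induction K arbitrary: \<phi> v a l)
    case empty
    have "(\<Sum>i\<in>I. \<Prod>k\<in>J. \<phi> k (p i k)) = (\<Sum>i\<in>I. of_bool (\<forall>k\<in>J. adic_index b (l k) (p i k) = a k))"
    proof (rule sum.cong[OF refl])
      fix i
      have "(\<Prod>k\<in>J. \<phi> k (p i k)) = (\<Prod>k\<in>J. of_bool (adic_index b (l k) (p i k) = a k))"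
        by (rule prod.cong) (use empty in auto)
      also have "\<dots> = of_bool (\<forall>k\<in>J. adic_index b (l k) (p i k) = a k)"
        using J(1) by (induction J rule: finite_induct) auto
      finally show "(\<Prod>k\<in>J. \<phi> k (p i k)) = of_bool (\<forall>k\<in>J. adic_index b (l k) (p i k) = a k)" .
    qed
    also have "\<dots> = real (card {i\<in>I. \<forall>k\<in>J. adic_index b (l k) (p i k) = a k})"
      using fI by (simp add: of_bool_def sum.If_cases Int_def)
    also have "\<dots> = real (b ^ (m - sum l J))"
      using tms_net_count[OF net b J, of a l] empty by simp
    finally have "(\<Sum>i\<in>I. \<Prod>k\<in>J. \<phi> k (p i k)) = real b ^ (m - sum l J)" by simp
    moreover have "(\<Prod>k\<in>J. v k) = 1 / real b ^ sum l J"
      using empty J prod_inverse_power[OF J(1), of b l] by (simp cong: prod.cong)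
    moreover have "real b ^ m / real b ^ sum l J = real b ^ (m - sum l J)"
      using empty b by (simp add: power_diff)
    ultimately show ?case by (simp add: product_discrepancy_def cI)
  next
    case (insert k K)
    have kJ: "k \<in> J" and KJ: "K \<subseteq> J" using insert by auto
    define L where "L = sum l (J - insert k K)"
    \<comment> \<open>The cells in \<open>J - insert k K\<close> already use \<open>L\<close> of the
      \<open>m - t\<close> available levels. A cell of level \<open>M\<close> in coordinate
      \<open>k\<close> completes them to a box of volume \<open>b ^ t / b ^ m\<close>.\<close>
    define M where "M = m - t - L"
    define \<beta> where "\<beta> = real (card K) * real b ^ t * (1 + real m * real b) ^ card K"
    define q where "q i = (\<Prod>k'\<in>J - {k}. \<phi> k' (p i k'))" for i
    define Q where "Q = (\<Prod>k'\<in>J - {k}. v k')"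
    have disc_eq: "product_discrepancy J I p (\<phi>(k := f)) (v(k := c)) =
        (\<Sum>i\<in>I. f (p i k) * q i) - real (card I) * Q * c" for f c
    proof -
      have "(\<Prod>k'\<in>J. (\<phi>(k := f)) k' (p i k')) = f (p i k) * q i" for i
        using J(1) kJ by (simp add: prod.remove q_def)
      moreover have "(\<Prod>k'\<in>J. (v(k := c)) k') = c * Q"
        using J(1) kJ by (simp add: prod.remove Q_def)
      ultimately show ?thesis by (simp add: product_discrepancy_def)
    qed
    have Jeq: "J - K = insert k (J - insert k K)" using kJ insert.hyps by auto
    have range: "0 \<le> \<phi> k' y \<and> \<phi> k' y \<le> 1 \<and> 0 \<le> v k' \<and> v k' \<le> 1" if "k' \<in> J" for k' y
    proof (cases "k' \<in> insert k K")
      case True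
      then show ?thesis using insert.prems half_interval_bounds[of "\<phi> k'" "v k'"] by auto
    next
      case False
      then show ?thesis using insert.prems that b by (auto simp: divide_le_eq)
    qed
    have q: "0 \<le> q i" for i unfolding q_def using range by (intro prod_nonneg) auto
    have Q: "0 \<le> Q" "Q \<le> 1" unfolding Q_def using range by (auto intro!: prod_nonneg prod_le_1)
    have lK: "sum (l(k := n)) (J - K) = n + L" for n
    proof -
      have "sum (l(k := n)) (J - K) = n + sum (l(k := n)) (J - insert k K)"
        unfolding Jeq using J(1) by simp
      also have "sum (l(k := n)) (J - insert k K) = L"
        unfolding L_def by (rule sum.cong) auto
      finally show ?thesis .
    qed
    have cells: "\<bar>(\<Sum>i\<in>I. of_bool (adic_index b n (p i k) = c) * q i) - real (card I) * Q / real b ^ n\<bar> \<le> \<beta>"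
      if n: "n \<le> M" "c < b ^ n" for n c
    proof -
      have "\<bar>product_discrepancy J I p (\<phi>(k := \<lambda>y. of_bool (adic_index b n y = c))) (v(k := 1 / real b ^ n))\<bar> \<le> \<beta>"
        unfolding \<beta>_def
      proof (rule insert.IH[of "a(k := c)" "l(k := n)"])
        show "\<forall>k'\<in>J - K. (a(k := c)) k' < b ^ (l(k := n)) k' \<and>
            (\<phi>(k := \<lambda>y. of_bool (adic_index b n y = c))) k' =
              (\<lambda>y. of_bool (adic_index b ((l(k := n)) k') y = (a(k := c)) k')) \<and>
            (v(k := 1 / real b ^ n)) k' = 1 / real b ^ (l(k := n)) k'"
          unfolding Jeq using insert.prems n by auto
        show "sum (l(k := n)) (J - K) + t \<le> m" using n insert.prems unfolding lK by (simp add: M_def L_def)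
        show "\<forall>k'\<in>K. half_interval ((\<phi>(k := \<lambda>y. of_bool (adic_index b n y = c))) k') ((v(k := 1 / real b ^ n)) k')"
          using insert by auto
      qed (rule KJ)
      then show ?thesis unfolding disc_eq by simp
    qed
    have small2: "real (card I) * Q / real b ^ M \<le> real b ^ t"
    proof -
      have "Q \<le> 1 / real b ^ L"
      proof -
        have "Q = (\<Prod>k'\<in>J - insert k K. v k') * (\<Prod>k'\<in>K. v k')"
        proof -
          have "J - {k} = (J - insert k K) \<union> K" using KJ insert.hyps by auto
          show ?thesis unfolding Q_def \<open>J - {k} = J - insert k K \<union> K\<close>
            by (rule prod.union_disjoint) (use J(1) insert.hyps in auto)
        qed
        also have "\<dots> \<le> (\<Prod>k'\<in>J - insert k K. v k') * 1"
          using range KJ by (intro mult_left_mono prod_le_1 prod_nonneg) auto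
        also have "\<dots> = (\<Prod>k'\<in>J - insert k K. 1 / real b ^ l k')"
          using insert.prems by simp
        also have "\<dots> = 1 / real b ^ L" using J(1) by (simp add: prod_inverse_power L_def)
        finally show ?thesis .
      qed
      then have "real (card I) * Q \<le> real b ^ m * (1 / real b ^ L)"
        unfolding cI by (simp only: of_nat_power, intro mult_left_mono) auto
      then have "real (card I) * Q / real b ^ M \<le> real b ^ m * (1 / real b ^ L) / real b ^ M"
        by (intro divide_right_mono) auto
      also have "\<dots> = real b ^ m / real b ^ (L + M)" by (simp add: power_add)
      also have "\<dots> = real b ^ t" using insert.prems b
        by (simp add: M_def L_def flip: power_diff)
      finally show ?thesis .
    qed
    have small1: "(\<Sum>i\<in>I. of_bool (adic_index b M (p i k) = c) * q i) \<le> real b ^ t" if c: "c < b ^ M" for c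
    proof -
      \<comment> \<open>Half-interval coordinates are relaxed to level 0, the whole interval. The
        weighted sum is then at most the number of points in one elementary box, which is exactly
        \<open>b ^ t\<close>.\<close>
      define l' where "l' = (\<lambda>k'. if k' \<in> K then 0 else (l(k := M)) k')"
      define a' where "a' = (\<lambda>k'. if k' \<in> K then 0 else (a(k := c)) k')"
      have "sum l' J = sum l' (J - K) + sum l' K"
        using J(1) KJ by (simp add: sum.subset_diff)
      also have "sum l' (J - K) = sum (l(k := M)) (J - K)" by (rule sum.cong) (auto simp: l'_def)
      also have "sum l' K = 0" by (simp add: l'_def)
      finally have suml': "sum l' J = M + L" unfolding lK by simp
      have suml2: "sum l' J + t = m" using insert.prems suml' by (simp add: M_def L_def)
      have "(\<Sum>i\<in>I. of_bool (adic_index b M (p i k) = c) * q i) \<le>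
          (\<Sum>i\<in>I. of_bool (\<forall>k'\<in>J. adic_index b (l' k') (p i k') = a' k'))"
      proof (rule sum_mono)
        fix i assume i: "i \<in> I"
        have q1: "q i \<le> 1" unfolding q_def using range by (intro prod_le_1) auto
        show "of_bool (adic_index b M (p i k) = c) * q i \<le>
            of_bool (\<forall>k'\<in>J. adic_index b (l' k') (p i k') = a' k')"
        proof (cases "\<forall>k'\<in>J. adic_index b (l' k') (p i k') = a' k'")
          case True
          then show ?thesis using q1 q[of i] by simp
        next
          case False
          then obtain k' where k': "k' \<in> J" "adic_index b (l' k') (p i k') \<noteq> a' k'" by auto
          have nK: "k' \<notin> K"
          proof
            assume "k' \<in> K"
            then have "adic_index b 0 (p i k') \<noteq> 0" using k' by (simp add: l'_def a'_def)
            then show False using p[OF i k'(1)] by (simp add: adic_index_def)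
          qed
          show ?thesis
          proof (cases "k' = k")
            case True
            then show ?thesis using k' nK by (simp add: l'_def a'_def)
          next
            case False
            then have "\<phi> k' (p i k') = 0" using k' nK insert.prems by (simp add: l'_def a'_def)
            then have "q i = 0" unfolding q_def using J(1) k' False by (intro prod_zero) auto
            then show ?thesis by simp
          qed
        qed
      qed
      also have "\<dots> = real (card {i\<in>I. \<forall>k'\<in>J. adic_index b (l' k') (p i k') = a' k'})"
        using fI by (simp add: of_bool_def sum.If_cases Int_def)
      also have "\<dots> = real (b ^ t)"
      proof (subst tms_net_elementary_count[OF net b J(1) _ suml2])
        show "\<forall>k'\<in>J. a' k' < b ^ l' k'" using insert.prems c by (auto simp: a'_def l'_def)
      qed simp
      finally show ?thesis by simp
    qed
    have "\<bar>(\<Sum>i\<in>I. \<phi> k (p i k) * q i) - real (card I) * Q * v k\<bar> \<le> (1 + real M * real b) * \<beta> + real b ^ t"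
      by (rule weighted_half_interval_discrepancy'[OF b fI _ _ _ cells small1 small2])
        (use p kJ q Q insert.prems in auto)
    also have "\<dots> \<le> (1 + real m * real b) * \<beta> + real b ^ t"
      by (intro add_right_mono mult_right_mono add_left_mono) (auto simp: M_def \<beta>_def)
    also have "\<dots> \<le> real (card (insert k K)) * real b ^ t * (1 + real m * real b) ^ card (insert k K)"
    proof -
      have "1 * real b ^ t \<le> (1 + real m * real b) ^ Suc (card K) * real b ^ t"
        by (intro mult_right_mono one_le_power) auto
      then show ?thesis using insert.hyps by (simp add: \<beta>_def algebra_simps)
    qed
    finally show ?case using disc_eq[of "\<phi> k" "v k"] by simp
  qed
qed

lemma net_half_interval_discrepancy:
  assumes net: "tms_net b t m J I p" and b: "b \<ge> 2" and J: "finite J" "J \<noteq> {}"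
    and "t \<le> m" and H: "\<forall>k\<in>J. half_interval (\<phi> k) (v k)"
  shows "\<bar>product_discrepancy J I p \<phi> v\<bar> \<le> real (card J) * real b ^ t * (1 + real m * real b) ^ card J"
  by (rule net_product_discrepancy[OF net b J subset_refl]) (use assms in auto)

lemma product_discrepancy_Un:
  assumes "finite I" "finite I'" "I \<inter> I' = {}"
  shows "product_discrepancy J (I \<union> I') p \<phi> v = product_discrepancy J I p \<phi> v + product_discrepancy J I' p \<phi> v"
  using assms by (simp add: product_discrepancy_def sum.union_disjoint card_Un_disjoint algebra_simps)

lemma product_discrepancy_trivial:
  assumes "finite I" and H: "\<forall>k\<in>J. half_interval (\<phi> k) (v k)"
  shows "\<bar>product_discrepancy J I p \<phi> v\<bar> \<le> real (card I)"
proof -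
  have r: "0 \<le> \<phi> k y" "\<phi> k y \<le> 1" "0 \<le> v k" "v k \<le> 1" if "k \<in> J" for k y
    using H that half_interval_bounds[of "\<phi> k" "v k"] by auto
  have "0 \<le> (\<Sum>i\<in>I. \<Prod>k\<in>J. \<phi> k (p i k))" using r by (intro sum_nonneg prod_nonneg) auto
  moreover have "(\<Sum>i\<in>I. \<Prod>k\<in>J. \<phi> k (p i k)) \<le> (\<Sum>i\<in>I. 1)"
    using r by (intro sum_mono prod_le_1) auto
  moreover have "0 \<le> (\<Prod>k\<in>J. v k)" "(\<Prod>k\<in>J. v k) \<le> 1" using r by (auto intro!: prod_nonneg prod_le_1)
  moreover have "real (card I) * (\<Prod>k\<in>J. v k) \<le> real (card I)"
    using calculation(4) by (simp add: mult_left_le)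
  ultimately show ?thesis unfolding product_discrepancy_def by (simp add: abs_le_iff)
    (smt (verit) mult_nonneg_nonneg of_nat_0_le_iff)
qed

text \<open>Blocks with \<open>m < t\<close> need not be nets, but then their length
  \<open>b ^ m\<close> is below \<open>b ^ t\<close> and the trivial bound suffices, with
  \<open>card J >= 1\<close> because \<open>J\<close> is nonempty.\<close>

lemma ts_block_discrepancy:
  assumes seq: "ts_sequence b t J p" and b: "b \<ge> 2" and J: "finite J" "J \<noteq> {}"
    and H: "\<forall>k\<in>J. half_interval (\<phi> k) (v k)"
  shows "\<bar>product_discrepancy J {c * b ^ m + 1..(c + 1) * b ^ m} p \<phi> v\<bar>
    \<le> real (card J) * real b ^ t * (1 + real m * real b) ^ card J"
proof (cases "t \<le> m")
  case True
  then have "tms_net b t m J {c * b ^ m + 1..(c + 1) * b ^ m} p" using seq by (simp add: ts_sequence_def)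
  then show ?thesis by (rule net_half_interval_discrepancy[OF _ b J True H])
next
  case False
  have "\<bar>product_discrepancy J {c * b ^ m + 1..(c + 1) * b ^ m} p \<phi> v\<bar> \<le> real (card {c * b ^ m + 1..(c + 1) * b ^ m})"
    by (rule product_discrepancy_trivial[OF _ H]) simp
  also have "\<dots> = 1 * real b ^ m * 1" by simp
  also have "\<dots> \<le> real (card J) * real b ^ t * (1 + real m * real b) ^ card J"
    using False b J by (intro mult_mono power_increasing one_le_power) (auto simp: Suc_le_eq card_gt_0_iff)
  finally show ?thesis .
qed

text \<open>The base-b digits of \<open>n\<close> split \<open>{1..n}\<close> into fewer than \<open>b\<close> blocks of each size \<open>b ^ m\<close>.\<close>

lemma ts_initial_discrepancy:
  assumes block: "\<And>c m. \<bar>product_discrepancy J {c * b ^ m + 1..(c + 1) * b ^ m} p \<phi> v\<bar> \<le> \<gamma> m"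
    and b: "b \<ge> 2" and n: "n < b ^ r"
  shows "\<bar>product_discrepancy J {c * b ^ r + 1..c * b ^ r + n} p \<phi> v\<bar> \<le> (\<Sum>m<r. real b * \<gamma> m)"
  using n
proof (induction r arbitrary: c n)
  case 0
  then show ?case by (simp add: product_discrepancy_def)
next
  case (Suc r)
  have \<gamma>: "0 \<le> \<gamma> m" for m using block[of 0 m] by (rule order_trans[OF abs_ge_zero])
  \<comment> \<open>The leading digit of \<open>n\<close>. After \<open>e\<close> full blocks of
    size \<open>b ^ r\<close> the remaining \<open>n mod b ^ r\<close> indices again start at a
    multiple of \<open>b ^ r\<close>, which is why the offset \<open>c\<close> is arbitrary in the
    induction.\<close>
  define e where "e = n div b ^ r"
  have bpos: "0 < b ^ r" using b by simp
  have e: "e < b" using Suc.prems bpos by (simp add: e_def div_less_iff_less_mult)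
  have blocks: "\<bar>product_discrepancy J {c * b ^ Suc r + 1..c * b ^ Suc r + e * b ^ r} p \<phi> v\<bar> \<le> real e * \<gamma> r" for e
  proof (induction e)
    case 0
    then show ?case by (simp add: product_discrepancy_def)
  next
    case (Suc e)
    have "{c * b ^ Suc r + 1..c * b ^ Suc r + Suc e * b ^ r} =
      {c * b ^ Suc r + 1..c * b ^ Suc r + e * b ^ r} \<union>
      {(c * b + e) * b ^ r + 1..(c * b + e + 1) * b ^ r}"
      by (auto simp: algebra_simps)
    then have "product_discrepancy J {c * b ^ Suc r + 1..c * b ^ Suc r + Suc e * b ^ r} p \<phi> v =
      product_discrepancy J {c * b ^ Suc r + 1..c * b ^ Suc r + e * b ^ r} p \<phi> v +
      product_discrepancy J {(c * b + e) * b ^ r + 1..(c * b + e + 1) * b ^ r} p \<phi> v"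
      by (simp only:, intro product_discrepancy_Un) (auto simp: algebra_simps)
    then show ?case using Suc.IH block[of "c * b + e" r] by (simp add: algebra_simps)
  qed
  have neq: "n = e * b ^ r + n mod b ^ r" unfolding e_def by (rule div_mult_mod_eq[symmetric])
  have un: "{c * b ^ Suc r + 1..c * b ^ Suc r + n} =
      {c * b ^ Suc r + 1..c * b ^ Suc r + e * b ^ r} \<union>
      {(c * b + e) * b ^ r + 1..(c * b + e) * b ^ r + n mod b ^ r}"
    using neq by (auto simp: algebra_simps)
  have "product_discrepancy J {c * b ^ Suc r + 1..c * b ^ Suc r + n} p \<phi> v =
      product_discrepancy J {c * b ^ Suc r + 1..c * b ^ Suc r + e * b ^ r} p \<phi> v +
      product_discrepancy J {(c * b + e) * b ^ r + 1..(c * b + e) * b ^ r + n mod b ^ r} p \<phi> v"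
    unfolding un by (intro product_discrepancy_Un) (auto simp: algebra_simps)
  moreover have "\<bar>product_discrepancy J {(c * b + e) * b ^ r + 1..(c * b + e) * b ^ r + n mod b ^ r} p \<phi> v\<bar>
      \<le> (\<Sum>m<r. real b * \<gamma> m)"
    by (rule Suc.IH) (use bpos in simp)
  moreover have "real e * \<gamma> r \<le> real b * \<gamma> r" using e \<gamma> by (intro mult_right_mono) auto
  ultimately show ?case using blocks[of e] by simp
qed

text \<open>The blocks given by the digits of \<open>n\<close> contribute a power of the logarithm
  of \<open>n\<close>, which \<open>n powr \<delta>\<close> absorbs. The constant does not depend on
  the points or the intervals: the bound is applied pathwise to scrambled points, and to half-lines
  with arbitrary endpoints.\<close>

lemma ts_sequence_discrepancy:
  fixes b t :: nat
  assumes b: "b \<ge> 2" and J: "finite J" "J \<noteq> {}" and \<delta>: "0 < \<delta>"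
  shows "\<exists>C>0. \<forall>p (n::nat) \<phi> v. ts_sequence b t J p \<longrightarrow> 1 \<le> n \<longrightarrow> (\<forall>k\<in>J. half_interval (\<phi> k) (v k)) \<longrightarrow>
    \<bar>product_discrepancy J {1..n} p \<phi> v\<bar> \<le> C * real n powr \<delta>"
proof -
  define s where "s = card J"
  define c where "c = real s * real b ^ t"
  have c: "0 \<le> c" by (simp add: c_def)
  \<comment> \<open>Chosen such that the power \<open>Suc s\<close> of
    \<open>exp (\<eta> * r)\<close> equals \<open>(b ^ r) powr \<delta>\<close>. Of the
    \<open>Suc s\<close> factors \<open>r + 1\<close>, one counts the block sizes and
    \<open>s\<close> come from the bound for a single block.\<close>
  define \<eta> where "\<eta> = \<delta> * ln (real b) / real (Suc s)"
  have \<eta>: "0 < \<eta>" using b \<delta> by (simp add: \<eta>_def)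
  define C where "C = c * (real b * (1 + 1 / \<eta>)) ^ Suc s + 1"
  have C1: "0 < C" using c \<eta> by (simp add: C_def add_nonneg_pos)
  have C2: "(real r + 1) * (real b * (c * (1 + real r * real b) ^ s)) \<le> C * real (b ^ r) powr \<delta>" for r
  proof -
    have "(real r + 1) * (real b * (c * (1 + real r * real b) ^ s)) \<le>
        (real r + 1) * (real b * (c * (real b * (real r + 1)) ^ s))"
      using b c by (intro mult_left_mono power_mono) (auto simp: algebra_simps)
    also have "\<dots> = c * (real b * (real r + 1)) ^ Suc s" by simp
    also have "\<dots> \<le> c * (real b * ((1 + 1 / \<eta>) * exp (\<eta> * real r))) ^ Suc s"
    proof -
      have "real r + 1 \<le> (1 + 1 / \<eta>) * (1 + \<eta> * real r)"
        using \<eta> by (simp add: field_simps)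
      also have "\<dots> \<le> (1 + 1 / \<eta>) * exp (\<eta> * real r)"
        using \<eta> by (intro mult_left_mono) auto
      finally show ?thesis using c by (intro mult_left_mono power_mono) auto
    qed
    also have "\<dots> = c * (real b * (1 + 1 / \<eta>)) ^ Suc s * exp (\<eta> * real r) ^ Suc s"
      by (simp only: power_mult_distrib mult.assoc)
    also have "exp (\<eta> * real r) ^ Suc s = exp (real (Suc s) * (\<eta> * real r))"
      by (rule exp_of_nat_mult[symmetric])
    also have "real (Suc s) * (\<eta> * real r) = \<delta> * (real r * ln (real b))"
      by (simp add: \<eta>_def)
    also have "exp (\<delta> * (real r * ln (real b))) = real (b ^ r) powr \<delta>"
      using b by (simp add: powr_def ln_realpow)
    also have "c * (real b * (1 + 1 / \<eta>)) ^ Suc s * real (b ^ r) powr \<delta> \<le> C * real (b ^ r) powr \<delta>"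
      by (intro mult_right_mono) (auto simp: C_def)
    finally show ?thesis .
  qed
  show ?thesis
  proof (intro exI[of _ C] conjI allI impI C1)
    fix p \<phi> v and n :: nat
    assume seq: "ts_sequence b t J p" and n: "1 \<le> n" and H: "\<forall>k\<in>J. half_interval (\<phi> k) (v k)"
    obtain r where r: "b ^ r \<le> n" "n < b ^ Suc r" using ex_power_ivl1[OF b n] by auto
    have "\<bar>product_discrepancy J {1..n} p \<phi> v\<bar> \<le> (\<Sum>m<Suc r. real b * (c * (1 + real m * real b) ^ s))"
      using ts_initial_discrepancy[of J b p \<phi> v "\<lambda>m. c * (1 + real m * real b) ^ s" n "Suc r" 0]
        ts_block_discrepancy[OF seq b J H] b r by (simp add: c_def s_def)
    also have "\<dots> \<le> (\<Sum>m<Suc r. real b * (c * (1 + real r * real b) ^ s))"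
      using c by (intro sum_mono mult_left_mono power_mono add_left_mono mult_right_mono) auto
    also have "\<dots> = (real r + 1) * (real b * (c * (1 + real r * real b) ^ s))" by simp
    also have "\<dots> \<le> C * real (b ^ r) powr \<delta>" by (rule C2)
    also have "\<dots> \<le> C * real n powr \<delta>"
      using r(1) \<delta> C1 by (intro mult_left_mono powr_mono2) (auto simp flip: of_nat_power)
    finally show "\<bar>product_discrepancy J {1..n} p \<phi> v\<bar> \<le> C * real n powr \<delta>" .
  qed
qed

text \<open>The range of the points is recorded only in the net property, so \<open>i\<close> is
  placed in the first block of length \<open>b ^ (i + t)\<close>, which is long enough both to
  contain it and to be a net.\<close>

lemma ts_sequence_range:
  assumes seq: "ts_sequence b t J p" and b2: "b \<ge> 2" and "1 \<le> i" "k \<in> J"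
  shows "0 \<le> p i k" "p i k < 1"
proof -
  have "i + t < b ^ (i + t)" using b2 by (intro power_gt_expt) auto
  then have "i \<le> b ^ (i + t)" by simp
  then have "i \<in> {0 * b ^ (i + t) + 1 .. (0 + 1) * b ^ (i + t)}" using assms by simp
  moreover have "tms_net b t (i + t) J {0 * b ^ (i + t) + 1 .. (0 + 1) * b ^ (i + t)} p"
    using seq unfolding ts_sequence_def by (metis le_add2)
  ultimately show "0 \<le> p i k" "p i k < 1" using assms unfolding tms_net_def by blast+
qed

section \<open>Owen's scrambling\<close>

primrec prefix_digits :: "nat \<Rightarrow> nat \<Rightarrow> nat \<Rightarrow> nat list" where
  "prefix_digits b 0 c = []"
| "prefix_digits b (Suc l) c = prefix_digits b l (c div b) @ [c mod b]"

text \<open>The scrambling as it acts on cells. The permutation of a digit depends only on the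
  digits before it, so the first \<open>l\<close> scrambled digits are a function of the index of
  level \<open>l\<close>.\<close>

primrec scramble_index :: "nat \<Rightarrow> (nat list \<Rightarrow> nat \<Rightarrow> nat) \<Rightarrow> nat \<Rightarrow> nat \<Rightarrow> nat" where
  "scramble_index b \<tau> 0 c = 0"
| "scramble_index b \<tau> (Suc l) c =
     b * scramble_index b \<tau> l (c div b) + \<tau> (prefix_digits b l (c div b)) (c mod b)"

lemma length_prefix_digits [simp]: "length (prefix_digits b l c) = l"
  by (induction l arbitrary: c) auto

lemma prefix_digits_in_lists: "b > 0 \<Longrightarrow> prefix_digits b l c \<in> lists {..<b}"
  by (induction l arbitrary: c) auto

lemma map_digit_eq:
  assumes "b \<ge> 2" "0 \<le> x"
  shows "map (digit b x) [1..<Suc l] = prefix_digits b l (adic_index b l x)"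
proof (induction l)
  case (Suc l)
  then show ?case using adic_index_Suc[OF assms, of l]
    by (simp add: digit_def adic_index_def)
qed simp

lemma digit_Suc_eq: "digit b x k = adic_index b k x mod b"
  by (simp add: digit_def adic_index_def)

lemma scramble_index_less:
  assumes "b > 0" and \<tau>: "\<forall>as\<in>lists {..<b}. \<tau> as permutes {..<b}"
  shows "scramble_index b \<tau> l c < b ^ l"
proof (induction l arbitrary: c)
  case (Suc l)
  have "\<tau> (prefix_digits b l (c div b)) (c mod b) < b"
    using \<tau> prefix_digits_in_lists[OF assms(1)] permutes_in_image[of _ "{..<b}" "c mod b"] assms(1) by auto
  then have "scramble_index b \<tau> (Suc l) c < b * (scramble_index b \<tau> l (c div b) + 1)" by simp
  also have "\<dots> \<le> b * b ^ l" using Suc[of "c div b"] by (intro mult_left_mono) auto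
  finally show ?case by simp
qed simp

text \<open>Injectivity is inherited from level \<open>l\<close>: division by \<open>b\<close>
  recovers the leading part, after which one and the same permutation has been applied to both last
  digits. On a finite set this gives a bijection.\<close>

lemma bij_betw_scramble_index:
  assumes "b > 0" and \<tau>: "\<forall>as\<in>lists {..<b}. \<tau> as permutes {..<b}"
  shows "bij_betw (scramble_index b \<tau> l) {..<b ^ l} {..<b ^ l}"
proof -
  have inj: "inj_on (scramble_index b \<tau> l) {..<b ^ l}"
  proof (induction l)
    case (Suc l)
    show ?case
    proof (rule inj_onI)
      fix c c' assume c: "c \<in> {..<b ^ Suc l}" "c' \<in> {..<b ^ Suc l}"
        and eq: "scramble_index b \<tau> (Suc l) c = scramble_index b \<tau> (Suc l) c'"
      have less: "\<tau> (prefix_digits b l (e div b)) (e mod b) < b" for e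
        using \<tau> prefix_digits_in_lists[OF assms(1)] permutes_in_image[of _ "{..<b}" "e mod b"] assms(1) by auto
      have "scramble_index b \<tau> l (c div b) = scramble_index b \<tau> (Suc l) c div b"
        using less[of c] by simp
      also have "\<dots> = scramble_index b \<tau> l (c' div b)" unfolding eq using less[of c'] by simp
      finally have "c div b = c' div b"
        using Suc c assms(1) by (auto simp: inj_on_def div_less_iff_less_mult mult.commute)
      moreover from this eq have "\<tau> (prefix_digits b l (c div b)) (c mod b) = \<tau> (prefix_digits b l (c div b)) (c' mod b)"
        by simp
      then have "c mod b = c' mod b"
        using \<tau> prefix_digits_in_lists[OF assms(1)] by (auto dest: permutes_inj injD)
      ultimately show "c = c'" by (metis div_mult_mod_eq)
    qed
  qed (simp add: lessThan_Suc)
  have "scramble_index b \<tau> l ` {..<b ^ l} \<subseteq> {..<b ^ l}"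
    by (rule image_subsetI) (simp add: scramble_index_less[OF assms])
  then have "scramble_index b \<tau> l ` {..<b ^ l} = {..<b ^ l}"
    by (rule endo_inj_surj[OF finite_lessThan _ inj])
  then show ?thesis using inj by (simp add: bij_betw_def)
qed

text \<open>The partial sums of the defining series are the left endpoints of the scrambled cells,
  and the tail is at most one cell width. The upper bound is not strict, because all later digits
  may be \<open>b - 1\<close>, and these sum to the next endpoint.\<close>

lemma scramble_value_bounds:
  assumes b: "b \<ge> 2" and \<tau>: "\<forall>as\<in>lists {..<b}. \<tau> as permutes {..<b}" and x: "0 \<le> x"
  defines "c \<equiv> \<lambda>l. scramble_index b \<tau> l (adic_index b l x)"
  shows "real (c l) / real b ^ l \<le> scramble_value b \<tau> x"
    and "scramble_value b \<tau> x \<le> (real (c l) + 1) / real b ^ l"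
proof -
  define e where "e k = \<tau> (map (digit b x) [1..<Suc k]) (digit b x (Suc k))" for k
  have eless: "e k < b" for k
  proof -
    have "map (digit b x) [1..<Suc k] \<in> lists {..<b}"
      unfolding map_digit_eq[OF b x] using b by (intro prefix_digits_in_lists) simp
    moreover have "digit b x (Suc k) < b" using b by (simp add: digit_def)
    ultimately show ?thesis
      unfolding e_def using \<tau> permutes_in_image[of _ "{..<b}" "digit b x (Suc k)"] by blast
  qed
  have csuc: "c (Suc k) = b * c k + e k" for k
    unfolding c_def e_def map_digit_eq[OF b x] digit_Suc_eq
    by (simp add: adic_index_Suc[OF b x])
  have S: "(\<Sum>k<n. real (e k) / real b ^ Suc k) = real (c n) / real b ^ n" for n
  proof (induction n)
    case 0
    then show ?case by (simp add: c_def)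
  next
    case (Suc n)
    then show ?case using b by (simp add: csuc field_simps)
  qed
  have summ: "summable (\<lambda>k. real (e k) / real b ^ Suc k)"
  proof (rule summable_comparison_test)
    have "summable (\<lambda>k. (1 / real b) ^ k)" using b by (intro summable_geometric) simp
    then show "summable (\<lambda>k. 1 / real b ^ k)" by (simp add: power_one_over)
    show "\<exists>N. \<forall>n\<ge>N. norm (real (e n) / real b ^ Suc n) \<le> 1 / real b ^ n"
      using eless b by (intro exI[of _ 0]) (auto simp: field_simps less_imp_le)
  qed
  have sv: "scramble_value b \<tau> x = (\<Sum>k. real (e k) / real b ^ Suc k)"
    by (simp add: scramble_value_def e_def)
  have lim: "(\<lambda>n. real (c n) / real b ^ n) \<longlonglongrightarrow> scramble_value b \<tau> x"
    using summable_LIMSEQ[OF summ] unfolding S sv .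
  have expand: "real m / real b ^ n = real (b * m) / real b ^ Suc n" for m n
    using b by simp
  have inc: "incseq (\<lambda>n. real (c n) / real b ^ n)"
    unfolding incseq_Suc_iff
  proof
    fix n
    show "real (c n) / real b ^ n \<le> real (c (Suc n)) / real b ^ Suc n"
      unfolding expand[of "c n" n] csuc by (intro divide_right_mono) auto
  qed
  have dec: "decseq (\<lambda>n. real (c n) / real b ^ n + 1 / real b ^ n)"
    unfolding decseq_Suc_iff
  proof
    fix n
    have "real (c (Suc n) + 1) / real b ^ Suc n \<le> real (b * (c n + 1)) / real b ^ Suc n"
      using eless[of n] by (intro divide_right_mono of_nat_mono) (auto simp: csuc)
    then show "real (c (Suc n)) / real b ^ Suc n + 1 / real b ^ Suc n \<le> real (c n) / real b ^ n + 1 / real b ^ n"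
      unfolding expand[of "c n + 1" n, symmetric] by (simp add: add_divide_distrib)
  qed
  have "(\<lambda>n. (1 / real b) ^ n) \<longlonglongrightarrow> 0" using b by (intro LIMSEQ_power_zero) simp
  then have "(\<lambda>n. real (c n) / real b ^ n + 1 / real b ^ n) \<longlonglongrightarrow> scramble_value b \<tau> x + 0"
    by (intro tendsto_add lim) (simp add: power_one_over)
  then have "scramble_value b \<tau> x \<le> real (c l) / real b ^ l + 1 / real b ^ l"
    using decseq_ge[OF dec] by simp
  then show "scramble_value b \<tau> x \<le> (real (c l) + 1) / real b ^ l" by (simp add: add_divide_distrib)
  show "real (c l) / real b ^ l \<le> scramble_value b \<tau> x" using incseq_le[OF inc lim] .
qed

text \<open>Hitting a cell endpoint is the only way in which the index of the scrambled value can
  differ from the scrambled index; otherwise both bounds above are strict.\<close>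

lemma adic_index_scramble_value:
  assumes b: "b \<ge> 2" and \<tau>: "\<forall>as\<in>lists {..<b}. \<tau> as permutes {..<b}" and x: "0 \<le> x"
    and generic: "\<forall>l a. scramble_value b \<tau> x \<noteq> real a / real b ^ l"
  shows "adic_index b l (scramble_value b \<tau> x) = scramble_index b \<tau> l (adic_index b l x)"
    and "0 < scramble_value b \<tau> x" and "scramble_value b \<tau> x < 1"
proof -
  note bds = scramble_value_bounds[OF b \<tau> x]
  show "0 < scramble_value b \<tau> x"
    using bds(1)[of 0] generic[rule_format, of 0 0] by simp
  moreover show "scramble_value b \<tau> x < 1"
    using bds(2)[of 0] generic[rule_format, of 1 0] by simp
  ultimately show "adic_index b l (scramble_value b \<tau> x) = scramble_index b \<tau> l (adic_index b l x)"
    using bds[of l] generic[rule_format, of "Suc (scramble_index b \<tau> l (adic_index b l x))" l]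
    by (subst adic_index_eq_iff[OF b]) (auto simp: add.commute less_le)
qed

text \<open>The preimage of an elementary box under the bijections of indices is an elementary box
  of the same shape, so the counts agree. The values \<open>y\<close> enter only through their
  indices, since scrambled values have the right indices only almost surely.\<close>

lemma tms_net_scramble:
  assumes net: "tms_net b t m J I p" and b: "b \<ge> 2" and J: "finite J"
    and \<tau>: "\<forall>k\<in>J. \<forall>as\<in>lists {..<b}. \<tau> k as permutes {..<b}"
    and y: "\<And>i k. i \<in> I \<Longrightarrow> k \<in> J \<Longrightarrow> 0 \<le> y i k \<and> y i k < 1"
    and idx: "\<And>i k l. i \<in> I \<Longrightarrow> k \<in> J \<Longrightarrow>
      adic_index b l (y i k) = scramble_index b (\<tau> k) l (adic_index b l (p i k))"
  shows "tms_net b t m J I y"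
  unfolding tms_net_def
proof (intro conjI allI impI ballI)
  show "finite I" "card I = b ^ m" using net by (auto simp: tms_net_def)
  show "0 \<le> y i k" "y i k < 1" if "i \<in> I" "k \<in> J" for i k using y[OF that] by auto
  fix l a
  assume "(\<forall>k\<in>J. a k < b ^ l k) \<and> (\<Prod>k\<in>J. 1 / real b ^ l k) = real b ^ t / real b ^ m"
  then have a: "\<And>k. k \<in> J \<Longrightarrow> a k < b ^ l k" and l: "sum l J + t = m"
    using elementary_volume_iff[OF b J] by auto
  define a' where "a' k = inv_into {..<b ^ l k} (scramble_index b (\<tau> k) (l k)) (a k)" for k
  have bij: "bij_betw (scramble_index b (\<tau> k) (l k)) {..<b ^ l k} {..<b ^ l k}" if "k \<in> J" for k
    using bij_betw_scramble_index \<tau> b that by auto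
  have a'1: "a' k < b ^ l k" and a'2: "scramble_index b (\<tau> k) (l k) (a' k) = a k" if "k \<in> J" for k
  proof -
    have im: "a k \<in> scramble_index b (\<tau> k) (l k) ` {..<b ^ l k}" using bij[OF that] a[OF that] by (simp add: bij_betw_def)
    show "a' k < b ^ l k" using inv_into_into[OF im] by (simp add: a'_def)
    show "scramble_index b (\<tau> k) (l k) (a' k) = a k" using f_inv_into_f[OF im] by (simp add: a'_def)
  qed
  have p: "0 \<le> p i k \<and> p i k < 1" if "i \<in> I" "k \<in> J" for i k using net that by (auto simp: tms_net_def)
  have iff: "adic_index b (l k) (y i k) = a k \<longleftrightarrow> adic_index b (l k) (p i k) = a' k"
    if "i \<in> I" "k \<in> J" for i k
  proof -
    have "adic_index b (l k) (p i k) < b ^ l k" using adic_index_less[OF b] p[OF that] by blast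
    then show ?thesis using idx[OF that] a'1[OF that(2)] a'2[OF that(2)] bij[OF that(2)]
      by (auto simp: bij_betw_def inj_on_def)
  qed
  have "{i \<in> I. \<forall>k\<in>J. real (a k) / real b ^ l k \<le> y i k \<and> y i k < (real (a k) + 1) / real b ^ l k} =
      {i \<in> I. \<forall>k\<in>J. adic_index b (l k) (y i k) = a k}"
    using y by (auto simp: adic_index_eq_iff[OF b])
  also have "\<dots> = {i \<in> I. \<forall>k\<in>J. adic_index b (l k) (p i k) = a' k}" using iff by auto
  also have "card \<dots> = b ^ t"
    by (rule tms_net_elementary_count[OF net b J _ l]) (use a'1 in auto)
  finally show "card {i \<in> I. \<forall>k\<in>J. real (a k) / real b ^ l k \<le> y i k \<and> y i k < (real (a k) + 1) / real b ^ l k} = b ^ t" .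
qed

text \<open>Composition with the transposition of \<open>c\<close> and \<open>c'\<close> exchanges
  the permutations with value \<open>c\<close> and those with value \<open>c'\<close>, so all
  \<open>b\<close> values are equally frequent.\<close>

lemma card_permutes_value:
  fixes b :: nat
  assumes "d < b" "c < b"
  shows "b * card {\<tau>. \<tau> permutes {..<b} \<and> \<tau> d = c} = card {\<tau>. \<tau> permutes {..<b}}"
proof -
  define P where "P c = {\<tau>. \<tau> permutes {..<b} \<and> \<tau> d = c}" for c
  have fin: "finite {\<tau>. \<tau> permutes {..<b}}" by (simp add: finite_permutations)
  have card: "card (P c') = card (P c)" if "c' < b" for c'
  proof (rule bij_betw_same_card[of "\<lambda>\<tau>. Transposition.transpose c c' \<circ> \<tau>"], rule bij_betw_byWitness[where f' = "\<lambda>\<tau>. Transposition.transpose c c' \<circ> \<tau>"])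
    have "Transposition.transpose c c' permutes {..<b}" using assms that by (intro permutes_swap_id) auto
    then have comp: "\<tau> permutes {..<b} \<Longrightarrow> Transposition.transpose c c' \<circ> \<tau> permutes {..<b}" for \<tau>
      by (rule permutes_compose[rotated])
    show "(\<circ>) (Transposition.transpose c c') ` P c' \<subseteq> P c" "(\<circ>) (Transposition.transpose c c') ` P c \<subseteq> P c'"
      using comp by (auto simp: P_def)
  qed (auto simp: P_def fun_eq_iff)
  have "{\<tau>. \<tau> permutes {..<b}} = (\<Union>c'<b. P c')"
    using assms permutes_in_image by (fastforce simp: P_def)
  then have "card {\<tau>. \<tau> permutes {..<b}} = card (\<Union>c'<b. P c')" by simp
  also have "\<dots> = (\<Sum>c'<b. card (P c'))"
    by (rule card_UN_disjoint) (auto simp: P_def intro: finite_subset[OF _ fin])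
  also have "\<dots> = b * card (P c)" using card by simp
  finally show ?thesis by (simp add: P_def)
qed

locale scrambling = prob_space M for M :: "'w measure" +
  fixes b :: nat and J :: "nat set" and \<pi> :: "nat \<Rightarrow> nat list \<Rightarrow> 'w \<Rightarrow> nat \<Rightarrow> nat"
  assumes owen: "owen_scrambling M b J \<pi>" and b2: "b \<ge> 2" and finJ: "finite J"
begin

definition scrambled :: "nat \<Rightarrow> real \<Rightarrow> 'w \<Rightarrow> real" where
  "scrambled k x \<omega> = scramble_value b (\<lambda>as. \<pi> k as \<omega>) x"

lemma indep_permutations:
  "indep_vars (\<lambda>_. count_space {\<tau>. \<tau> permutes {..<b}}) (\<lambda>(k, as). \<pi> k as) (J \<times> lists {..<b})"
  using owen by (simp add: owen_scrambling_def)

lemma measurable_permutation: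
  assumes "k \<in> J" "as \<in> lists {..<b}"
  shows "\<pi> k as \<in> M \<rightarrow>\<^sub>M count_space {\<tau>. \<tau> permutes {..<b}}"
  using indep_permutations assms unfolding indep_vars_def2 by auto

lemma permutation:
  assumes "k \<in> J" "as \<in> lists {..<b}" "\<omega> \<in> space M"
  shows "\<pi> k as \<omega> permutes {..<b}"
  using measurable_space[OF measurable_permutation[OF assms(1,2)] assms(3)] by simp

lemma prob_permutation_value:
  assumes "k \<in> J" "as \<in> lists {..<b}" "d < b" "c < b"
  shows "prob {\<omega>\<in>space M. \<pi> k as \<omega> d = c} = 1 / real b"
proof -
  let ?P = "{\<tau>. \<tau> permutes {..<b}}" and ?Q = "{\<tau>. \<tau> permutes {..<b} \<and> \<tau> d = c}"
  have fin: "finite ?P" by (simp add: finite_permutations)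
  have "id \<in> ?P" by (simp add: permutes_id)
  then have ne: "card ?P \<noteq> 0" using fin by (auto simp only: card_0_eq)
  have "{\<omega>\<in>space M. \<pi> k as \<omega> d = c} = \<pi> k as -` ?Q \<inter> space M"
    using permutation[OF assms(1,2)] by auto
  then have "prob {\<omega>\<in>space M. \<pi> k as \<omega> d = c} = measure (distr M (count_space ?P) (\<pi> k as)) ?Q"
    using measurable_permutation[OF assms(1,2)] by (subst measure_distr) auto
  also have "distr M (count_space ?P) (\<pi> k as) = uniform_count_measure ?P"
    using owen assms by (simp add: owen_scrambling_def)
  also have "measure (uniform_count_measure ?P) ?Q = real (card ?Q) / real (card ?P)"
    by (rule measure_uniform_count_measure[OF fin]) auto
  also have "\<dots> = 1 / real b"
    using card_permutes_value[OF assms(3,4)] ne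
    by (metis (no_types, lifting) mult_eq_0_iff nonzero_divide_mult_cancel_right of_nat_eq_0_iff of_nat_mult)
  finally show ?thesis .
qed

lemma measurable_digit_summand:
  assumes "k \<in> J" "as \<in> lists {..<b}"
  shows "(\<lambda>\<omega>. real (\<pi> k as \<omega> d)) \<in> borel_measurable M"
  by (rule measurable_compose[OF measurable_permutation[OF assms]]) simp

lemma digits_in_lists: "map (digit b x) [1..<Suc l] \<in> lists {..<b}"
  using b2 by (auto simp: digit_def)

lemma measurable_scrambled [measurable]: "k \<in> J \<Longrightarrow> scrambled k x \<in> borel_measurable M"
  unfolding scrambled_def scramble_value_def
  by (intro borel_measurable_suminf borel_measurable_divide measurable_digit_summand digits_in_lists) auto

text \<open>Different coordinates use disjoint families of permutations, and a scrambled value is a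
  measurable function of the family of its coordinate.\<close>

lemma indep_vars_scrambled: "indep_vars (\<lambda>_. borel) (\<lambda>k. scrambled k (x k)) J"
proof -
  let ?N = "\<lambda>_::nat \<times> nat list. count_space {\<tau>. \<tau> permutes {..<b}}"
  let ?K = "\<lambda>k. {k} \<times> lists {..<b}"
  let ?X = "\<lambda>k \<omega>. restrict (\<lambda>i. (case i of (k, as) \<Rightarrow> \<pi> k as) \<omega>) (?K k)"
  let ?V = "\<lambda>k f. \<Sum>l. real ((f (k, map (digit b (x k)) [1..<Suc l])) (digit b (x k) (Suc l))) / real b ^ Suc l"
  have "indep_vars (\<lambda>k. PiM (?K k) ?N) ?X J"
    by (rule indep_vars_restrict[OF indep_permutations]) (auto simp: disjoint_family_on_def)
  then have "indep_vars (\<lambda>_. borel) (\<lambda>k \<omega>. ?V k (?X k \<omega>)) J"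
  proof (rule indep_vars_compose2)
    fix k assume "k \<in> J"
    show "?V k \<in> borel_measurable (PiM (?K k) ?N)"
    proof (intro borel_measurable_suminf borel_measurable_divide)
      fix l
      have "(\<lambda>f. f (k, map (digit b (x k)) [1..<Suc l])) \<in> PiM (?K k) ?N \<rightarrow>\<^sub>M count_space {\<tau>. \<tau> permutes {..<b}}"
        by (rule measurable_component_singleton) (use digits_in_lists in auto)
      then show "(\<lambda>f. real ((f (k, map (digit b (x k)) [1..<Suc l])) (digit b (x k) (Suc l)))) \<in> borel_measurable (PiM (?K k) ?N)"
        by (rule measurable_compose) simp
    qed simp
  qed
  moreover have "?V k (?X k \<omega>) = scrambled k (x k) \<omega>" for k \<omega>
    unfolding scrambled_def scramble_value_def using digits_in_lists[of "x k"] by simp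
  ultimately show ?thesis by simp
qed

text \<open>The scrambled index equals \<open>a\<close> iff each of its \<open>l\<close> digits is
  right. These digits come from permutations attached to prefixes of different lengths, hence
  independent, and each is right with probability \<open>1 / b\<close>.\<close>

lemma prob_scramble_index:
  assumes k: "k \<in> J" and x: "0 \<le> x" and a: "a < b ^ l"
  shows "prob {\<omega>\<in>space M. scramble_index b (\<lambda>as. \<pi> k as \<omega>) l (adic_index b l x) = a} = 1 / real b ^ l"
proof -
  define D where "D m \<omega> = \<pi> k (prefix_digits b m (adic_index b m x)) \<omega> (adic_index b (Suc m) x mod b)" for m \<omega>
  have lists: "prefix_digits b m c \<in> lists {..<b}" for m c using prefix_digits_in_lists b2 by simp
  have Dless: "D m \<omega> < b" if "\<omega> \<in> space M" for m \<omega>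
    using permutation[OF k lists that] permutes_in_image[of _ "{..<b}" "adic_index b (Suc m) x mod b"] b2
    unfolding D_def by auto
  have iff: "scramble_index b (\<lambda>as. \<pi> k as \<omega>) l (adic_index b l x) = a \<longleftrightarrow>
      (\<forall>m<l. D m \<omega> = (a div b ^ (l - 1 - m)) mod b)" if "\<omega> \<in> space M" "a < b ^ l" for l a \<omega>
    using that(2)
  proof (induction l arbitrary: a)
    case (Suc l)
    have "scramble_index b (\<lambda>as. \<pi> k as \<omega>) (Suc l) (adic_index b (Suc l) x) =
        b * scramble_index b (\<lambda>as. \<pi> k as \<omega>) l (adic_index b l x) + D l \<omega>"
      using adic_index_Suc[OF b2 x, of l] by (simp add: D_def)
    also have "\<dots> = a \<longleftrightarrow> scramble_index b (\<lambda>as. \<pi> k as \<omega>) l (adic_index b l x) = a div b \<and> D l \<omega> = a mod b"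
      using Dless[OF that(1), of l] by (auto simp: div_mult_mod_eq mult_div_mod_eq)
    also have "\<dots> \<longleftrightarrow> (\<forall>m<l. D m \<omega> = ((a div b) div b ^ (l - 1 - m)) mod b) \<and> D l \<omega> = a mod b"
      using Suc.prems b2 by (subst Suc.IH) (auto simp: div_less_iff_less_mult mult.commute)
    also have "\<dots> \<longleftrightarrow> (\<forall>m<Suc l. D m \<omega> = (a div b ^ (Suc l - 1 - m)) mod b)"
    proof -
      have "(a div b) div b ^ (l - 1 - m) = a div b ^ (l - m)" if "m < l" for m
        using that by (simp add: div_mult2_eq[symmetric] power_Suc[symmetric] Suc_diff_Suc del: power_Suc)
      then show ?thesis by (auto simp: less_Suc_eq)
    qed
    finally show ?case .
  qed simp
  define c where "c m = (a div b ^ (l - 1 - m)) mod b" for m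
  have cless: "c m < b" for m using b2 by (simp add: c_def)
  have "prob {\<omega>\<in>space M. \<forall>m<l. D m \<omega> = c m} = 1 / real b ^ l"
  proof (cases "l = 0")
    case True
    then show ?thesis by (simp add: prob_space)
  next
    case False
    define f where "f m = (k, prefix_digits b m (adic_index b m x))" for m
    have inj: "inj_on f {..<l}" unfolding f_def inj_on_def by (auto dest: arg_cong[where f = length])
    have invf: "length (snd (f m)) = m" for m by (simp add: f_def)
    define A where "A i = {\<tau>. \<tau> permutes {..<b} \<and> \<tau> (adic_index b (Suc (length (snd i))) x mod b) = c (length (snd i))}"
      for i :: "nat \<times> nat list"
    have ev: "(case f m of (k, as) \<Rightarrow> \<pi> k as) -` A (f m) \<inter> space M = {\<omega>\<in>space M. D m \<omega> = c m}" for m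
      using permutation[OF k lists] by (auto simp: f_def A_def D_def)
    have "{\<omega>\<in>space M. \<forall>m<l. D m \<omega> = c m} = (\<Inter>i\<in>f ` {..<l}. (case i of (k, as) \<Rightarrow> \<pi> k as) -` A i \<inter> space M)"
      unfolding image_image ev using False by auto
    also have "prob \<dots> = (\<Prod>i\<in>f ` {..<l}. prob ((case i of (k, as) \<Rightarrow> \<pi> k as) -` A i \<inter> space M))"
      by (rule indep_varsD[OF indep_permutations]) (use False k lists in \<open>auto simp: f_def A_def\<close>)
    also have "\<dots> = (\<Prod>m<l. prob {\<omega>\<in>space M. D m \<omega> = c m})"
      using inj by (subst prod.reindex) (auto simp: ev)
    also have "\<dots> = (\<Prod>m<l. 1 / real b)"
      unfolding D_def using prob_permutation_value[OF k lists _ cless] b2 by (intro prod.cong) auto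
    finally show ?thesis by (simp add: power_one_over)
  qed
  moreover have "{\<omega>\<in>space M. scramble_index b (\<lambda>as. \<pi> k as \<omega>) l (adic_index b l x) = a} = {\<omega>\<in>space M. \<forall>m<l. D m \<omega> = c m}"
    using iff a by (auto simp: c_def)
  ultimately show ?thesis by simp
qed

lemma permutations:
  assumes "k \<in> J" "\<omega> \<in> space M"
  shows "\<forall>as\<in>lists {..<b}. \<pi> k as \<omega> permutes {..<b}"
  using permutation assms by auto

lemma scrambled_bounds:
  assumes "k \<in> J" "\<omega> \<in> space M" "0 \<le> x"
  shows "real (scramble_index b (\<lambda>as. \<pi> k as \<omega>) l (adic_index b l x)) / real b ^ l \<le> scrambled k x \<omega>"
    "scrambled k x \<omega> \<le> (real (scramble_index b (\<lambda>as. \<pi> k as \<omega>) l (adic_index b l x)) + 1) / real b ^ l"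
  unfolding scrambled_def using scramble_value_bounds[OF b2 permutations[OF assms(1,2)] assms(3)] by auto

lemma measurable_scramble_index:
  assumes k: "k \<in> J"
  shows "(\<lambda>\<omega>. scramble_index b (\<lambda>as. \<pi> k as \<omega>) l c) \<in> M \<rightarrow>\<^sub>M count_space UNIV"
proof (induction l arbitrary: c)
  case (Suc l)
  have "(\<lambda>\<omega>. \<pi> k (prefix_digits b l (c div b)) \<omega> (c mod b)) \<in> M \<rightarrow>\<^sub>M count_space UNIV"
    by (rule measurable_compose[OF measurable_permutation[OF k prefix_digits_in_lists]]) (use b2 in auto)
  then show ?case using Suc[of "c div b"] by simp
qed simp

lemma prob_scramble_index_Collect:
  assumes k: "k \<in> J" and x: "0 \<le> x" and R: "R \<subseteq> {..<b ^ l}"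
  shows "prob {\<omega>\<in>space M. scramble_index b (\<lambda>as. \<pi> k as \<omega>) l (adic_index b l x) \<in> R} = real (card R) / real b ^ l"
proof -
  let ?N = "\<lambda>\<omega>. scramble_index b (\<lambda>as. \<pi> k as \<omega>) l (adic_index b l x)"
  note measurable_scramble_index[OF k, measurable]
  have "{\<omega>\<in>space M. ?N \<omega> \<in> R} = (\<Union>a\<in>R. {\<omega>\<in>space M. ?N \<omega> = a})" by auto
  also have "prob \<dots> = (\<Sum>a\<in>R. prob {\<omega>\<in>space M. ?N \<omega> = a})"
    using R finite_subset[OF R] by (intro finite_measure_finite_Union) (auto simp: disjoint_family_on_def)
  also have "\<dots> = (\<Sum>a\<in>R. 1 / real b ^ l)"
    using prob_scramble_index[OF k x] R by (intro sum.cong) auto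
  finally show ?thesis by simp
qed

lemma inverse_power_tendsto_0: "(\<lambda>l. 1 / real b ^ l) \<longlonglongrightarrow> 0"
  using LIMSEQ_power_zero[of "1 / real b"] b2 by (simp add: power_one_over)

text \<open>At every level \<open>c\<close> belongs to at most two closed cells, each reached with
  probability \<open>1 / b ^ l\<close>, and \<open>l\<close> is arbitrary.\<close>

lemma AE_scrambled_neq:
  assumes k: "k \<in> J" and x: "0 \<le> x"
  shows "AE \<omega> in M. scrambled k x \<omega> \<noteq> c"
proof -
  note measurable_scrambled[OF k, measurable] and measurable_scramble_index[OF k, measurable]
  let ?N = "\<lambda>l \<omega>. scramble_index b (\<lambda>as. \<pi> k as \<omega>) l (adic_index b l x)"
  have "prob {\<omega>\<in>space M. scrambled k x \<omega> = c} \<le> 2 * (1 / real b ^ l)" for l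
  proof -
    \<comment> \<open>The second candidate is the cell whose right endpoint is \<open>c\<close>. A
      negative value becomes 0 under \<open>nat\<close>, which is harmless for an upper
      bound.\<close>
    let ?R = "{..<b ^ l} \<inter> {nat \<lfloor>real b ^ l * c\<rfloor>, nat (\<lfloor>real b ^ l * c\<rfloor> - 1)}"
    have "?N l \<omega> \<in> ?R" if "\<omega> \<in> space M" "scrambled k x \<omega> = c" for \<omega>
    proof -
      have "real (?N l \<omega>) \<le> real b ^ l * c" "real b ^ l * c \<le> real (?N l \<omega>) + 1"
        using scrambled_bounds[OF k that(1) x, of l] that(2) b2 by (auto simp: field_simps)
      then have "int (?N l \<omega>) = \<lfloor>real b ^ l * c\<rfloor> \<or> int (?N l \<omega>) = \<lfloor>real b ^ l * c\<rfloor> - 1" by linarith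
      moreover have "?N l \<omega> < b ^ l" using scramble_index_less permutations[OF k that(1)] b2 by simp
      ultimately show ?thesis by auto
    qed
    then have "prob {\<omega>\<in>space M. scrambled k x \<omega> = c} \<le> prob {\<omega>\<in>space M. ?N l \<omega> \<in> ?R}"
      by (intro finite_measure_mono) auto
    also have "\<dots> = real (card ?R) / real b ^ l"
      by (rule prob_scramble_index_Collect[OF k x]) auto
    also have "\<dots> \<le> 2 / real b ^ l"
    proof (rule divide_right_mono)
      have "card ?R \<le> card {nat \<lfloor>real b ^ l * c\<rfloor>, nat (\<lfloor>real b ^ l * c\<rfloor> - 1)}" by (rule card_mono) auto
      also have "\<dots> \<le> 2" by (simp add: card_insert_if)
      finally show "real (card ?R) \<le> 2" by simp
    qed simp
    finally show ?thesis by simp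
  qed
  then have "prob {\<omega>\<in>space M. scrambled k x \<omega> = c} \<le> 2 * 0"
    by (intro tendsto_lowerbound[OF tendsto_mult[OF tendsto_const inverse_power_tendsto_0]]) auto
  then have "prob {\<omega>\<in>space M. scrambled k x \<omega> = c} = 0" by (simp add: measure_le_0_iff)
  then show ?thesis
    by (subst AE_iff_measurable[OF _ refl]) (auto simp: emeasure_eq_measure)
qed

text \<open>With \<open>a\<close> the floor of \<open>b ^ l * y\<close>, the event lies between
  \<open>index < a\<close> and \<open>index <= a\<close>, up to the null event that \<open>y\<close>
  is hit. This puts its probability between \<open>a / b ^ l\<close> and
  \<open>(a + 1) / b ^ l\<close> for every \<open>l\<close>.\<close>

lemma prob_scrambled_less:
  assumes k: "k \<in> J" and x: "0 \<le> x" and y: "0 \<le> y" "y \<le> 1"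
  shows "prob {\<omega>\<in>space M. scrambled k x \<omega> < y} = y"
proof -
  note measurable_scrambled[OF k, measurable] and measurable_scramble_index[OF k, measurable]
  let ?N = "\<lambda>l \<omega>. scramble_index b (\<lambda>as. \<pi> k as \<omega>) l (adic_index b l x)"
  have eq: "prob {\<omega>\<in>space M. scrambled k x \<omega> < y} = prob {\<omega>\<in>space M. scrambled k x \<omega> \<le> y}"
    using AE_scrambled_neq[OF k x, of y] by (intro finite_measure_eq_AE) auto
  have Nless: "?N l \<omega> < b ^ l" if "\<omega> \<in> space M" for l \<omega>
    using scramble_index_less permutations[OF k that] b2 by simp
  have bounds: "\<bar>prob {\<omega>\<in>space M. scrambled k x \<omega> < y} - y\<bar> \<le> 1 / real b ^ l" for l
  proof -
    define a where "a = nat \<lfloor>real b ^ l * y\<rfloor>"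
    have bl: "0 < real b ^ l" using b2 by simp
    have a: "real a \<le> real b ^ l * y" "real b ^ l * y < real a + 1"
      using y by (auto simp: a_def)
    have "real a \<le> real b ^ l" using a(1) y(2) bl by (smt (verit) mult_left_le)
    then have ab: "a \<le> b ^ l" by (simp flip: of_nat_power)
    have a': "y \<le> (real a + 1) / real b ^ l" "real a / real b ^ l \<le> y"
      using a bl by (auto simp: field_simps)
    have "prob {\<omega>\<in>space M. ?N l \<omega> \<in> {..<a}} \<le> prob {\<omega>\<in>space M. scrambled k x \<omega> \<le> y}"
    proof (rule finite_measure_mono)
      show "{\<omega>\<in>space M. ?N l \<omega> \<in> {..<a}} \<subseteq> {\<omega>\<in>space M. scrambled k x \<omega> \<le> y}"
      proof safe
        fix \<omega> assume w: "\<omega> \<in> space M" "?N l \<omega> < a"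
        have "scrambled k x \<omega> \<le> (real (?N l \<omega>) + 1) / real b ^ l" by (rule scrambled_bounds(2)[OF k w(1) x])
        also have "\<dots> \<le> real a / real b ^ l" using w(2) by (intro divide_right_mono) auto
        finally show "scrambled k x \<omega> \<le> y" using a'(2) by simp
      qed
    qed simp
    then have lower: "real a / real b ^ l \<le> prob {\<omega>\<in>space M. scrambled k x \<omega> < y}"
      using ab by (subst (asm) prob_scramble_index_Collect[OF k x]) (auto simp: eq)
    have "prob {\<omega>\<in>space M. scrambled k x \<omega> < y} \<le> prob {\<omega>\<in>space M. ?N l \<omega> \<in> {..a} \<inter> {..<b ^ l}}"
    proof (rule finite_measure_mono)
      show "{\<omega>\<in>space M. scrambled k x \<omega> < y} \<subseteq> {\<omega>\<in>space M. ?N l \<omega> \<in> {..a} \<inter> {..<b ^ l}}"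
      proof (rule subsetI)
        fix \<omega> assume "\<omega> \<in> {\<omega>\<in>space M. scrambled k x \<omega> < y}"
        then have w: "\<omega> \<in> space M" "scrambled k x \<omega> < y" by auto
        have "real (?N l \<omega>) / real b ^ l < y" using scrambled_bounds(1)[OF k w(1) x, of l] w(2) by simp
        also have "y \<le> (real a + 1) / real b ^ l" by (rule a')
        finally have "real (?N l \<omega>) < real a + 1" using b2 by (simp add: divide_less_cancel)
        then show "\<omega> \<in> {\<omega>\<in>space M. ?N l \<omega> \<in> {..a} \<inter> {..<b ^ l}}"
          using Nless[OF w(1)] w(1) by auto
      qed
    qed simp
    also have "\<dots> = real (card ({..a} \<inter> {..<b ^ l})) / real b ^ l"
      by (rule prob_scramble_index_Collect[OF k x]) auto
    also have "\<dots> \<le> real (card {..a}) / real b ^ l"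
      by (intro divide_right_mono of_nat_mono card_mono) auto
    finally have upper: "prob {\<omega>\<in>space M. scrambled k x \<omega> < y} \<le> (real a + 1) / real b ^ l" by (simp add: add.commute)
    show ?thesis using lower upper a' by (simp add: add_divide_distrib abs_le_iff)
  qed
  have "\<bar>prob {\<omega>\<in>space M. scrambled k x \<omega> < y} - y\<bar> \<le> 0"
    by (rule tendsto_lowerbound[OF inverse_power_tendsto_0]) (use bounds in auto)
  then show ?thesis by simp
qed

lemma half_interval_expectation:
  assumes k: "k \<in> J" and x: "0 \<le> x" and H: "half_interval H v"
  shows "(\<lambda>\<omega>. H (scrambled k x \<omega>)) \<in> borel_measurable M" "(LINT \<omega>|M. H (scrambled k x \<omega>)) = v"
proof -
  note measurable_scrambled[OF k, measurable]
  obtain y where y: "0 \<le> y" "y \<le> 1" and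
    alt: "H = (\<lambda>z. of_bool (z < y)) \<and> v = y \<or> H = (\<lambda>z. of_bool (y \<le> z)) \<and> v = 1 - y"
    using H by (auto simp: half_interval_def)
  have less: "(LINT \<omega>|M. of_bool (scrambled k x \<omega> < y)) = y"
  proof -
    have "(LINT \<omega>|M. of_bool (scrambled k x \<omega> < y)) = (LINT \<omega>|M. indicator {\<omega>\<in>space M. scrambled k x \<omega> < y} \<omega>)"
      by (intro Bochner_Integration.integral_cong) (auto simp: indicator_def)
    also have "\<dots> = prob {\<omega>\<in>space M. scrambled k x \<omega> < y}" by simp
    finally show ?thesis using prob_scrambled_less[OF k x y] by simp
  qed
  show m: "(\<lambda>\<omega>. H (scrambled k x \<omega>)) \<in> borel_measurable M" using alt by (elim disjE) simp_all
  show "(LINT \<omega>|M. H (scrambled k x \<omega>)) = v"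
    using alt
  proof (elim disjE conjE)
    assume "H = (\<lambda>z. of_bool (y \<le> z))" "v = 1 - y"
    moreover have "(LINT \<omega>|M. of_bool (y \<le> scrambled k x \<omega>) :: real) = (LINT \<omega>|M. 1 - of_bool (scrambled k x \<omega> < y))"
      by (intro Bochner_Integration.integral_cong) auto
    moreover have "\<dots> = 1 - y"
      using less by (subst Bochner_Integration.integral_diff)
        (auto simp: prob_space intro!: integrable_const_bound[where B = 1])
    ultimately show ?thesis by (simp only:)
  qed (use less in simp)
qed

text \<open>For one point of the sequence the coordinates are independent and each of them is
  uniform.\<close>

lemma half_interval_product_expectation:
  assumes x: "\<And>k. k \<in> J \<Longrightarrow> 0 \<le> x k" and H: "\<forall>k\<in>J. half_interval (H k) (v k)"
  shows "(LINT \<omega>|M. (\<Prod>k\<in>J. H k (scrambled k (x k) \<omega>))) = (\<Prod>k\<in>J. v k)"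
proof (cases "J = {}")
  case True
  then show ?thesis by (simp add: prob_space)
next
  case False
  have Hm: "H k \<in> borel_measurable borel" if "k \<in> J" for k
    using H that by (auto simp: half_interval_def)
  have "indep_vars (\<lambda>_. borel) (\<lambda>k \<omega>. H k (scrambled k (x k) \<omega>)) J"
    by (rule indep_vars_compose2[OF indep_vars_scrambled]) (use Hm in auto)
  then have "(LINT \<omega>|M. (\<Prod>k\<in>J. H k (scrambled k (x k) \<omega>))) = (\<Prod>k\<in>J. LINT \<omega>|M. H k (scrambled k (x k) \<omega>))"
  proof (rule indep_vars_lebesgue_integral[OF finJ])
    fix k assume k: "k \<in> J"
    show "integrable M (\<lambda>\<omega>. H k (scrambled k (x k) \<omega>))"
      using half_interval_expectation(1)[OF k x[OF k]] H k half_interval_bounds[of "H k" "v k"]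
      by (intro integrable_const_bound[where B = 1]) auto
  qed
  also have "\<dots> = (\<Prod>k\<in>J. v k)"
    using half_interval_expectation(2) x H by (intro prod.cong) auto
  finally show ?thesis .
qed

text \<open>Cell endpoints, points of the sequence and coordinates are countably many, so almost
  surely no scrambled value is an endpoint. On this event the net property carries over for all
  blocks at once.\<close>

lemma AE_scrambled_ts_sequence:
  assumes seq: "ts_sequence b t J p"
  shows "AE \<omega> in M. ts_sequence b t J (\<lambda>i k. scrambled k (p i k) \<omega>) \<and>
    (\<forall>i\<ge>1. \<forall>k\<in>J. 0 < scrambled k (p i k) \<omega> \<and> scrambled k (p i k) \<omega> < 1)"
proof -
  have p: "0 \<le> p i k \<and> p i k < 1" if "1 \<le> i" "k \<in> J" for i k
    using ts_sequence_range[OF seq b2 that] by simp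
  have "AE \<omega> in M. \<forall>i l a. \<forall>k\<in>J. 1 \<le> i \<longrightarrow> scrambled k (p i k) \<omega> \<noteq> real a / real b ^ l"
    unfolding AE_all_countable using p AE_scrambled_neq finJ by (simp add: AE_finite_all)
  then show ?thesis
  proof (rule AE_mp[OF _ AE_I2], intro impI)
    fix \<omega> assume w: "\<omega> \<in> space M"
      and gen: "\<forall>i l a. \<forall>k\<in>J. 1 \<le> i \<longrightarrow> scrambled k (p i k) \<omega> \<noteq> real a / real b ^ l"
    have idx: "adic_index b l (scrambled k (p i k) \<omega>) = scramble_index b (\<lambda>as. \<pi> k as \<omega>) l (adic_index b l (p i k))"
      "0 < scrambled k (p i k) \<omega>" "scrambled k (p i k) \<omega> < 1" if "1 \<le> i" "k \<in> J" for i k l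
      using adic_index_scramble_value[OF b2 permutations[OF that(2) w], of "p i k"] p[OF that] gen that
      by (auto simp: scrambled_def)
    have "tms_net b t m J {c * b ^ m + 1..(c + 1) * b ^ m} (\<lambda>i k. scrambled k (p i k) \<omega>)" if "t \<le> m" for c m
    proof (rule tms_net_scramble[where \<tau> = "\<lambda>k as. \<pi> k as \<omega>" and p = p])
      show "tms_net b t m J {c * b ^ m + 1..(c + 1) * b ^ m} p"
        using seq that by (simp add: ts_sequence_def)
      show "\<forall>k\<in>J. \<forall>as\<in>lists {..<b}. \<pi> k as \<omega> permutes {..<b}" using permutations w by auto
    qed (use b2 finJ idx in \<open>auto simp: less_imp_le\<close>)
    then show "ts_sequence b t J (\<lambda>i k. scrambled k (p i k) \<omega>) \<and>
        (\<forall>i\<ge>1. \<forall>k\<in>J. 0 < scrambled k (p i k) \<omega> \<and> scrambled k (p i k) \<omega> < 1)"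
      using idx by (auto simp: ts_sequence_def)
  qed
qed

end

section \<open>A Koksma-Hlawka inequality in expectation\<close>

abbreviation std_normal :: "real measure" where
  "std_normal \<equiv> std_normal_distribution"

abbreviation gauss_measure :: "nat set \<Rightarrow> (nat \<Rightarrow> real) measure" where
  "gauss_measure J \<equiv> PiM J (\<lambda>_. std_normal_distribution)"

text \<open>Completing the square gives \<open>c * |x| <= c^2 / (2 a) + a x^2 / 2\<close>, so half
  of the quadratic term survives and the function is dominated by a multiple of the normal density
  with variance \<open>1 / a\<close>.\<close>

lemma integrable_exp_abs_minus_square:
  fixes a c :: real
  assumes "0 < a" "0 \<le> c"
  shows "integrable lborel (\<lambda>x. exp (c * \<bar>x\<bar> - a * x\<^sup>2))"
proof (rule Bochner_Integration.integrable_bound)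
  define s where "s = 1 / sqrt a"
  have s: "0 < s" "2 * s\<^sup>2 = 2 / a" using assms by (auto simp: s_def power_divide)
  define B where "B = exp (c\<^sup>2 / (2 * a)) * sqrt (2 * pi * s\<^sup>2)"
  show "integrable lborel (\<lambda>x. B * normal_density 0 s x)" by (intro integrable_mult_right integrable_normal_density s)
  show "AE x in lborel. norm (exp (c * \<bar>x\<bar> - a * x\<^sup>2)) \<le> norm (B * normal_density 0 s x)"
  proof (rule AE_I2)
    fix x :: real
    have "0 \<le> (a * \<bar>x\<bar> - c)\<^sup>2 / (2 * a)" using assms by simp
    also have "\<dots> = c\<^sup>2 / (2 * a) + a * x\<^sup>2 / 2 - c * \<bar>x\<bar>"
      using assms by (simp add: field_simps power2_eq_square)
    finally have "exp (c * \<bar>x\<bar> - a * x\<^sup>2) \<le> exp (c\<^sup>2 / (2 * a)) * exp (- (a * x\<^sup>2 / 2))"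
      unfolding exp_add[symmetric] by simp
    also have "\<dots> = B * normal_density 0 s x"
      using s assms by (simp add: B_def normal_density_def)
    finally show "norm (exp (c * \<bar>x\<bar> - a * x\<^sup>2)) \<le> norm (B * normal_density 0 s x)" by simp
  qed
qed simp

lemma prob_space_std_normal: "prob_space std_normal"
  by (rule prob_space_normal_density) simp

interpretation std_normal: real_distribution std_normal
  by (rule real_dist_normal_dist)

interpretation gauss: product_prob_space "\<lambda>_::nat. std_normal" UNIV
  by (intro product_prob_spaceI prob_space_std_normal)

lemma prob_space_gauss_measure: "prob_space (gauss_measure J)"
  by (intro prob_space_PiM prob_space_std_normal)

lemma integrable_std_normal_iff:
  fixes f :: "real \<Rightarrow> real"
  assumes [measurable]: "f \<in> borel_measurable borel"
  shows "integrable std_normal f \<longleftrightarrow> integrable lborel (\<lambda>x. std_normal_density x * f x)"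
  using integrable_density[of f lborel std_normal_density] by simp

lemma integral_std_normal:
  fixes f :: "real \<Rightarrow> real"
  assumes [measurable]: "f \<in> borel_measurable borel"
  shows "(LINT x|std_normal. f x) = (LINT x|lborel. std_normal_density x * f x)"
  using integral_density[of f lborel std_normal_density] by simp

text \<open>The quadratic part leaves \<open>exp (- 3 x^2 / 8)\<close> of the normal density, so all
  these weights are integrable. It is the reserve from which Gaussian factors are paid: in the tail
  bound by Markov's inequality, and in the majorant that justifies Fubini's theorem.\<close>

definition weight :: "real \<Rightarrow> real \<Rightarrow> real" where
  "weight c x = exp (c * \<bar>x\<bar> + x\<^sup>2 / 8)"

lemma weight_ge_exp: "exp (c * \<bar>x\<bar>) \<le> weight c x"
  by (simp add: weight_def)

lemma measurable_weight [measurable]: "weight c \<in> borel_measurable borel"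
  unfolding weight_def by measurable

lemma integrable_weight:
  assumes "0 \<le> c"
  shows "integrable std_normal (weight c)"
proof -
  have "integrable lborel (\<lambda>x. (1 / sqrt (2 * pi)) * exp (c * \<bar>x\<bar> - (3/8) * x\<^sup>2))"
    by (intro integrable_mult_right integrable_exp_abs_minus_square) (use assms in auto)
  also have "(\<lambda>x. (1 / sqrt (2 * pi)) * exp (c * \<bar>x\<bar> - (3/8) * x\<^sup>2)) = (\<lambda>x. std_normal_density x * weight c x)"
    by (auto simp: std_normal_density_def weight_def fun_eq_iff mult_exp_exp)
  finally show ?thesis by (subst integrable_std_normal_iff) auto
qed

lemma integrable_prod_weight:
  assumes "finite J" "0 \<le> c"
  shows "integrable (gauss_measure J) (\<lambda>x. \<Prod>k\<in>J. weight c (x k))"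
  by (rule gauss.product_integrable_prod) (use assms integrable_weight in auto)

lemma measurable_continuous_fun:
  fixes h :: "(nat \<Rightarrow> real) \<Rightarrow> real"
  assumes "continuous_on UNIV h" and "\<And>k. (\<lambda>\<omega>. G \<omega> k) \<in> borel_measurable N"
  shows "(\<lambda>\<omega>. h (G \<omega>)) \<in> borel_measurable N"
  by (rule measurable_compose[OF measurable_coordinatewise_then_product borel_measurable_continuous_onI])
    (use assms in auto)

text \<open>Part of the exponent \<open>s\<^sup>2 / 2\<close> of the Gaussian tail is given up, so that Markov's inequality suffices.\<close>

lemma std_normal_tail:
  "\<exists>B. \<forall>s\<ge>0. std_normal.prob {x. s \<le> \<bar>x\<bar>} \<le> B * exp (- (s\<^sup>2 / 8))"
proof (intro exI allI impI)
  fix s :: real assume s: "0 \<le> s"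
  have "exp (s\<^sup>2 / 8) * std_normal.prob {x. s \<le> \<bar>x\<bar>} = (LINT x|std_normal. exp (s\<^sup>2 / 8) * indicator {x. s \<le> \<bar>x\<bar>} x)"
    by simp
  also have "\<dots> \<le> (LINT x|std_normal. weight 0 x)"
  proof (rule integral_mono)
    show "integrable std_normal (\<lambda>x. exp (s\<^sup>2 / 8) * indicator {x. s \<le> \<bar>x\<bar>} x)"
      by (intro integrable_mult_right integrable_real_indicator) (auto simp: std_normal.emeasure_eq_measure)
    show "exp (s\<^sup>2 / 8) * indicator {x. s \<le> \<bar>x\<bar>} x \<le> weight 0 x" for x
      using s abs_le_square_iff[of s x] by (auto simp: weight_def indicator_def)
  qed (simp add: integrable_weight)
  finally show "std_normal.prob {x. s \<le> \<bar>x\<bar>} \<le> (LINT x|std_normal. weight 0 x) * exp (- (s\<^sup>2 / 8))"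
    by (simp add: exp_minus field_simps)
qed

section \<open>Functions of exponential growth and their expansion in half-lines\<close>

abbreviation abs_sum :: "nat set \<Rightarrow> (nat \<Rightarrow> real) \<Rightarrow> real" where
  "abs_sum D z \<equiv> \<Sum>k\<in>D. \<bar>z k\<bar>"

text \<open>Arguments are total functions, with growth measured on \<open>D\<close> only. This
  avoids carrying the domain \<open>PiE J\<close> through updates of single coordinates.\<close>

definition tame :: "nat set \<Rightarrow> ((nat \<Rightarrow> real) \<Rightarrow> real) \<Rightarrow> bool" where
  "tame D h \<longleftrightarrow> continuous_on UNIV h \<and>
     (\<exists>C\<ge>0. \<exists>c\<ge>0. \<forall>z. \<bar>h z\<bar> \<le> C * exp (c * abs_sum D z))"

definition has_partial :: "nat \<Rightarrow> ((nat \<Rightarrow> real) \<Rightarrow> real) \<Rightarrow> ((nat \<Rightarrow> real) \<Rightarrow> real) \<Rightarrow> bool" where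
  "has_partial k h h' \<longleftrightarrow> (\<forall>z. ((\<lambda>s. h (z(k := s))) has_real_derivative h' z) (at (z k)))"

lemma has_partialD:
  assumes "has_partial k h h'"
  shows "((\<lambda>s. h (z(k := s))) has_real_derivative h' (z(k := t))) (at t)"
  using assms[unfolded has_partial_def, rule_format, of "z(k := t)"] by simp

text \<open>Closure under partial derivatives replaces an induction over orders: membership in such
  a set yields derivatives of every order, all of exponential growth.\<close>

definition smooth_class :: "nat set \<Rightarrow> ((nat \<Rightarrow> real) \<Rightarrow> real) set \<Rightarrow> bool" where
  "smooth_class D P \<longleftrightarrow> (\<forall>h\<in>P. tame D h \<and> (\<forall>k. \<exists>h'\<in>P. has_partial k h h'))"

text \<open>Each index of the list is either skipped or differentiated. For a list without
  repetitions, one pair \<open>C\<close>, \<open>c\<close> thus bounds all mixed partial derivatives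
  of order at most one in each listed coordinate, the ones that enter the Hardy-Krause
  variation.\<close>

primrec iter_bounded ::
  "nat set \<Rightarrow> nat list \<Rightarrow> real \<Rightarrow> real \<Rightarrow> ((nat \<Rightarrow> real) \<Rightarrow> real) \<Rightarrow> bool" where
  "iter_bounded D [] C c h \<longleftrightarrow>
     continuous_on UNIV h \<and> (\<forall>z. \<bar>h z\<bar> \<le> C * exp (c * abs_sum D z))"
| "iter_bounded D (k # ks) C c h \<longleftrightarrow> iter_bounded D ks C c h \<and>
     (\<exists>h'. has_partial k h h' \<and> iter_bounded D ks C c h')"

lemma exp_bound_mono:
  fixes C C' c c' r :: real
  assumes "C \<le> C'" "0 \<le> C'" "c \<le> c'" "0 \<le> r"
  shows "C * exp (c * r) \<le> C' * exp (c' * r)"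
proof -
  have "C * exp (c * r) \<le> C' * exp (c * r)" using assms by (intro mult_right_mono) auto
  also have "\<dots> \<le> C' * exp (c' * r)" using assms by (intro mult_left_mono) (auto intro: mult_right_mono)
  finally show ?thesis .
qed

lemma iter_bounded_mono:
  assumes "iter_bounded D ks C c h" "C \<le> C'" "0 \<le> C'" "c \<le> c'"
  shows "iter_bounded D ks C' c' h"
  using assms(1)
proof (induction ks arbitrary: h)
  case Nil
  have "C * exp (c * abs_sum D z) \<le> C' * exp (c' * abs_sum D z)" for z :: "nat \<Rightarrow> real"
    using assms by (intro exp_bound_mono sum_nonneg) auto
  then show ?case using Nil by (auto intro: order_trans)
next
  case (Cons k ks)
  then show ?case by auto
qed

lemma smooth_class_iter_bounded:
  assumes "smooth_class D P" "h \<in> P"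
  shows "\<exists>C\<ge>0. \<exists>c\<ge>0. iter_bounded D ks C c h"
  using assms(2)
proof (induction ks arbitrary: h)
  case Nil
  then show ?case using assms(1) by (auto simp: smooth_class_def tame_def)
next
  case (Cons k ks)
  obtain h' where h': "h' \<in> P" "has_partial k h h'"
    using assms(1) Cons.prems unfolding smooth_class_def by blast
  obtain C1 c1 where 1: "0 \<le> C1" "0 \<le> c1" "iter_bounded D ks C1 c1 h" using Cons.IH[OF Cons.prems] by auto
  obtain C2 c2 where 2: "0 \<le> C2" "0 \<le> c2" "iter_bounded D ks C2 c2 h'" using Cons.IH[OF h'(1)] by auto
  have "iter_bounded D ks (max C1 C2) (max c1 c2) h" "iter_bounded D ks (max C1 C2) (max c1 c2) h'"
    by (rule iter_bounded_mono[OF 1(3)] iter_bounded_mono[OF 2(3)]; use 1 2 in auto)+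
  then have "iter_bounded D (k # ks) (max C1 C2) (max c1 c2) h" using h'(2) by auto
  moreover have "0 \<le> max C1 C2" "0 \<le> max c1 c2" using 1 2 by auto
  ultimately show ?case by blast
qed

lemma iter_bounded_base:
  assumes "iter_bounded D ks C c h"
  shows "continuous_on UNIV h" "\<bar>h z\<bar> \<le> C * exp (c * abs_sum D z)"
  using assms by (induction ks) auto

text \<open>The signed kernel of the fundamental theorem of calculus based at 0:
  \<open>g t - g 0\<close> is the integral of \<open>ramp_step t s * g' s\<close> over
  \<open>s\<close>. As a function of \<open>t\<close> it is, up to sign, the indicator of the
  half-line beyond \<open>s\<close> as seen from 0, whose Gaussian measure is small for large
  \<open>|s|\<close>.\<close>

definition ramp_step :: "real \<Rightarrow> real \<Rightarrow> real" where
  "ramp_step t s = (if 0 < s then of_bool (s \<le> t) else - of_bool (t < s))"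

lemma measurable_ramp_step [measurable (raw)]:
  assumes [measurable]: "f \<in> borel_measurable N" "g \<in> borel_measurable N"
  shows "(\<lambda>x. ramp_step (f x) (g x)) \<in> borel_measurable N"
  unfolding ramp_step_def by measurable

lemma abs_ramp_step: "\<bar>ramp_step t s\<bar> \<le> 1" "\<bar>ramp_step t s\<bar> \<le> of_bool (\<bar>s\<bar> \<le> \<bar>t\<bar>)"
  by (auto simp: ramp_step_def)

lemma ramp_step_representation:
  fixes g g' :: "real \<Rightarrow> real"
  assumes g: "\<And>s. (g has_real_derivative g' s) (at s)" and g': "continuous_on UNIV g'"
  shows "g t = g 0 + (LINT s|lborel. ramp_step t s * g' s)"
proof -
  have [measurable]: "g' \<in> borel_measurable borel" using g' by (rule borel_measurable_continuous_onI)
  have cont: "continuous_on {a..b} g'" for a b using g' continuous_on_subset by blast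
  have vd: "(g has_vector_derivative g' s) (at s within A)" for s A
    using g[of s] by (auto simp: has_real_derivative_iff_has_vector_derivative intro: has_vector_derivative_at_within)
  have ae: "AE s in lborel. s \<noteq> (0::real)" "AE s in lborel. s \<noteq> t" by (rule AE_lborel_singleton)+
  show ?thesis
  proof (cases "0 \<le> t")
    case True
    have "(LINT s|lborel. ramp_step t s * g' s) = (LINT s|lborel. indicator {0..t} s *\<^sub>R g' s)"
      using ae True by (intro integral_cong_AE) (auto simp: ramp_step_def indicator_def elim!: eventually_mono)
    also have "\<dots> = g t - g 0" by (rule integral_FTC_atLeastAtMost[OF True vd cont])
    finally show ?thesis by simp
  next
    case False
    have "(LINT s|lborel. ramp_step t s * g' s) = (LINT s|lborel. - (indicator {t..0} s *\<^sub>R g' s))"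
    proof (intro integral_cong_AE)
      show "AE s in lborel. ramp_step t s * g' s = - (indicator {t..0} s *\<^sub>R g' s)"
        using ae(2) by eventually_elim (use False in \<open>auto simp: ramp_step_def indicator_def\<close>)
    qed auto
    also have "\<dots> = - (g 0 - g t)"
      using integral_FTC_atLeastAtMost[of t 0 g g', OF _ vd cont] False by simp
    finally show ?thesis by simp
  qed
qed

text \<open>In contrast to \<open>merge\<close>, coordinates outside \<open>A\<close> keep the
  values of \<open>z\<close>, so coordinates can be moved from the argument \<open>x\<close> to the
  base point one at a time.\<close>

definition override :: "(nat \<Rightarrow> real) \<Rightarrow> nat set \<Rightarrow> (nat \<Rightarrow> real) \<Rightarrow> nat \<Rightarrow> real" where
  "override z A x = (\<lambda>k. if k \<in> A then x k else z k)"

lemma override_upd: "k \<notin> A \<Longrightarrow> override (z(k := s)) A x = (override z A x)(k := s)"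
  by (auto simp: override_def fun_eq_iff)

lemma override_insert: "k \<notin> A \<Longrightarrow> override z (insert k A) x = override (z(k := x k)) A x"
  by (auto simp: override_def fun_eq_iff)

lemma sum_abs_override:
  assumes "finite D" "finite J" "A \<subseteq> J"
  shows "abs_sum D (override z A x) \<le> abs_sum D z + abs_sum J x"
proof -
  have "abs_sum D (override z A x) \<le> (\<Sum>k\<in>D. \<bar>z k\<bar> + (if k \<in> A then \<bar>x k\<bar> else 0))"
    by (intro sum_mono) (auto simp: override_def)
  also have "\<dots> = abs_sum D z + abs_sum (D \<inter> A) x"
    using assms by (simp add: sum.distrib sum.inter_restrict)
  also have "abs_sum (D \<inter> A) x \<le> abs_sum J x"
    using assms by (intro sum_mono2) auto
  finally show ?thesis by simp
qed

lemma exp_sum_abs_le_prod_weight: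
  assumes "finite J"
  shows "exp (c * abs_sum J x) \<le> (\<Prod>k\<in>J. weight c (x k))"
proof -
  have "exp (c * abs_sum J x) = (\<Prod>k\<in>J. exp (c * \<bar>x k\<bar>))"
    using assms by (simp add: sum_distrib_left exp_sum)
  also have "\<dots> \<le> (\<Prod>k\<in>J. weight c (x k))" by (intro prod_mono) (auto simp: weight_ge_exp)
  finally show ?thesis .
qed

lemma integrable_pair_mult:
  fixes f :: "'a \<Rightarrow> real" and g :: "'b \<Rightarrow> real"
  assumes "sigma_finite_measure M1" "sigma_finite_measure M2" "integrable M1 f" "integrable M2 g"
  shows "integrable (M1 \<Otimes>\<^sub>M M2) (\<lambda>p. f (fst p) * g (snd p))"
proof -
  interpret pair_sigma_finite M1 M2 using assms by (simp add: pair_sigma_finite_def)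
  have [measurable]: "f \<in> borel_measurable M1" "g \<in> borel_measurable M2" using assms by auto
  have "(\<integral>\<^sup>+p. ennreal (norm (f (fst p) * g (snd p))) \<partial>(M1 \<Otimes>\<^sub>M M2)) =
      (\<integral>\<^sup>+x. \<integral>\<^sup>+y. ennreal (norm (f x)) * ennreal (norm (g y)) \<partial>M2 \<partial>M1)"
    by (subst M2.nn_integral_fst[symmetric]) (auto simp: abs_mult ennreal_mult)
  also have "\<dots> = (\<integral>\<^sup>+x. ennreal (norm (f x)) \<partial>M1) * (\<integral>\<^sup>+y. ennreal (norm (g y)) \<partial>M2)"
    by (simp add: nn_integral_cmult nn_integral_multc)
  also have "\<dots> < \<infinity>" using assms(3,4) by (simp add: integrable_iff_bounded ennreal_mult_less_top)
  finally show ?thesis by (intro integrableI_bounded) auto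
qed

lemma continuous_on_fun_upd: "continuous_on UNIV (\<lambda>s. (z :: nat \<Rightarrow> real)(k := s))"
proof (rule continuous_on_coordinatewise_then_product)
  show "continuous_on UNIV (\<lambda>s. (z(k := s)) i)" for i by (cases "i = k") auto
qed

lemma sum_abs_fun_upd:
  fixes y :: "nat \<Rightarrow> real"
  assumes "finite D"
  shows "abs_sum D (y(k := s)) \<le> abs_sum D y + \<bar>s\<bar>"
proof -
  have "abs_sum D (y(k := s)) \<le> (\<Sum>l\<in>D. \<bar>y l\<bar> + (if l = k then \<bar>s\<bar> else 0))" by (intro sum_mono) auto
  also have "\<dots> = abs_sum D y + (if k \<in> D then \<bar>s\<bar> else 0)"
    using assms by (simp add: sum.distrib)
  finally show ?thesis by (auto split: if_splits)
qed

definition step_product :: "nat set \<Rightarrow> (nat \<Rightarrow> real) \<Rightarrow> (nat \<Rightarrow> real) \<Rightarrow> real" where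
  "step_product u z x = (\<Prod>k\<in>u. ramp_step (x k) (z k))"

lemma abs_step_product: "\<bar>step_product u z x\<bar> \<le> 1"
  unfolding step_product_def abs_prod by (rule prod_le_1) (simp add: abs_ramp_step)

text \<open>What is used of the scrambled points: measurability, and for every box of half-lines a
  bound on the mean error that factorises over the endpoints. \<open>\<kappa>\<close> bounds the
  integral of one factor \<open>w\<close> against the exponential growth. Errors are not divided by
  \<open>n\<close>.\<close>

locale sample = prob_space M for M :: "'w measure" +
  fixes D J :: "nat set" and n :: nat and X :: "nat \<Rightarrow> 'w \<Rightarrow> nat \<Rightarrow> real"
    and w :: "real \<Rightarrow> real" and \<beta> c \<kappa> :: real
  assumes fin: "finite D" "J \<subseteq> D" and c: "0 \<le> c" and \<beta>: "0 \<le> \<beta>" and \<kappa>: "0 \<le> \<kappa>"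
    and X: "\<And>i k. k \<in> J \<Longrightarrow> (\<lambda>\<omega>. X i \<omega> k) \<in> borel_measurable M"
    and w: "w \<in> borel_measurable borel" "\<And>s. 0 \<le> w s"
    and w_int: "(\<integral>\<^sup>+s. ennreal (exp (c * \<bar>s\<bar>) * w s) \<partial>lborel) \<le> ennreal \<kappa>"
    and base: "\<And>u z. u \<subseteq> J \<Longrightarrow>
      (\<integral>\<^sup>+\<omega>. ennreal \<bar>(\<Sum>i=1..n. step_product u z (X i \<omega>)) -
         real n * (LINT x|gauss_measure J. step_product u z x)\<bar> \<partial>M) \<le> ennreal (\<beta> * (\<Prod>k\<in>u. w (z k)))"
begin

lemma finJ: "finite J" using fin finite_subset by auto

definition error :: "((nat \<Rightarrow> real) \<Rightarrow> real) \<Rightarrow> 'w \<Rightarrow> real" where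
  "error F \<omega> = (\<Sum>i=1..n. F (X i \<omega>)) - real n * (LINT x|gauss_measure J. F x)"

lemma measurable_step_product:
  assumes "u \<subseteq> J" "\<And>k. k \<in> u \<Longrightarrow> (\<lambda>x. G x k) \<in> borel_measurable N"
    "\<And>k. k \<in> u \<Longrightarrow> (\<lambda>x. Z x k) \<in> borel_measurable N"
  shows "(\<lambda>x. step_product u (Z x) (G x)) \<in> borel_measurable N"
  unfolding step_product_def using assms by (intro borel_measurable_prod measurable_ramp_step) auto

text \<open>One coordinate at a time, the fundamental theorem of calculus writes the integrand as a
  superposition of indicators of half-lines, weighted by its partial derivative; the coordinates in
  \<open>ks\<close> are still to be processed, those in \<open>u\<close> carry a half-line with endpoint \<open>z k\<close>.\<close>

theorem koksma_hlawka_expectation: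
  assumes "iter_bounded D ks C c h" "0 \<le> C" "set ks \<subseteq> J" "distinct ks" "u \<subseteq> J - set ks"
  shows "(\<integral>\<^sup>+\<omega>. ennreal \<bar>error (\<lambda>x. step_product u z x * h (override z (set ks) x)) \<omega>\<bar> \<partial>M) \<le>
    ennreal (C * exp (c * abs_sum (D - set ks) z) * (1 + \<kappa>) ^ length ks * \<beta> * (\<Prod>k\<in>u. w (z k)))"
  using assms
proof (induction ks arbitrary: h u z)
  case Nil
  have hb: "\<bar>h z\<bar> \<le> C * exp (c * abs_sum D z)" using Nil by simp
  have eq: "error (\<lambda>x. step_product u z x * h (override z (set []) x)) \<omega> =
      error (step_product u z) \<omega> * h z" for \<omega>
    by (simp add: error_def override_def left_diff_distrib sum_distrib_right)
  have [measurable]: "(\<lambda>\<omega>. error (step_product u z) \<omega>) \<in> borel_measurable M"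
    unfolding error_def using Nil X by (intro borel_measurable_diff borel_measurable_sum measurable_step_product) auto
  have "(\<integral>\<^sup>+\<omega>. ennreal \<bar>error (step_product u z) \<omega> * h z\<bar> \<partial>M) =
      (\<integral>\<^sup>+\<omega>. ennreal \<bar>error (step_product u z) \<omega>\<bar> \<partial>M) * ennreal \<bar>h z\<bar>"
    by (simp add: abs_mult ennreal_mult nn_integral_multc)
  also have "\<dots> \<le> ennreal (\<beta> * (\<Prod>k\<in>u. w (z k))) * ennreal (C * exp (c * abs_sum D z))"
    using base[of u z] Nil hb by (intro mult_mono ennreal_leI) (auto simp: error_def)
  also have "\<dots> = ennreal (C * exp (c * abs_sum D z) * \<beta> * (\<Prod>k\<in>u. w (z k)))"
    using Nil \<beta> w by (subst ennreal_mult[symmetric]) (auto simp: prod_nonneg mult_ac)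
  finally show ?case unfolding eq by simp
next
  case (Cons k ks)
  define A where "A = set ks"
  have k: "k \<in> J" "k \<notin> A" "A \<subseteq> J" "distinct ks" "k \<notin> u" "u \<subseteq> J" "u \<subseteq> J - A" "insert k u \<subseteq> J - A"
    using Cons.prems by (auto simp: A_def)
  have kD: "k \<in> D" using k fin by auto
  have finu: "finite u" using k finJ finite_subset by auto
  obtain h' where h': "has_partial k h h'"
    and ib: "iter_bounded D ks C c h" "iter_bounded D ks C c h'" using Cons.prems by auto
  have conth: "continuous_on UNIV h" and conth': "continuous_on UNIV h'"
    and hb: "\<bar>h z\<bar> \<le> C * exp (c * abs_sum D z)" and hb': "\<bar>h' z\<bar> \<le> C * exp (c * abs_sum D z)" for z
    using iter_bounded_base[OF ib(1)] iter_bounded_base[OF ib(2)] by auto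
  \<comment> \<open>\<open>Fa\<close> is the value at \<open>x k = 0\<close>; \<open>Fb s\<close> is
    the part of the superposition whose half-line in coordinate \<open>k\<close> ends at
    \<open>s\<close>.\<close>
  define Fa where "Fa x = step_product u z x * h (override (z(k := 0)) A x)" for x
  define Fb where "Fb s x = step_product (insert k u) (z(k := s)) x * h' (override (z(k := s)) A x)" for s x
  have sp: "step_product u (z(k := s)) x = step_product u z x" for s x
    using k by (auto simp: step_product_def intro!: prod.cong)
  have spi: "step_product (insert k u) (z(k := s)) x = ramp_step (x k) s * step_product u z x" for s x
  proof -
    have "step_product (insert k u) (z(k := s)) x = ramp_step (x k) s * step_product u (z(k := s)) x"
      using finu k by (simp add: step_product_def)
    then show ?thesis by (simp only: sp)
  qed
  have F: "step_product u z x * h (override z (insert k A) x) = Fa x + (LINT s|lborel. Fb s x)" for x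
  proof -
    let ?z = "override z A x"
    have "h (?z(k := x k)) = h (?z(k := 0)) + (LINT s|lborel. ramp_step (x k) s * h' (?z(k := s)))"
    proof (rule ramp_step_representation)
      show "((\<lambda>s. h (?z(k := s))) has_real_derivative h' (?z(k := s))) (at s)" for s
        by (rule has_partialD[OF h'])
      show "continuous_on UNIV (\<lambda>s. h' (?z(k := s)))"
        by (rule continuous_on_compose2[OF conth' continuous_on_fun_upd]) auto
    qed
    moreover have "(LINT s|lborel. ramp_step (x k) s * step_product u z x * h' (?z(k := s))) =
        (LINT s|lborel. step_product u z x * (ramp_step (x k) s * h' (?z(k := s))))"
      by (rule Bochner_Integration.integral_cong) (simp_all only: mult_ac)
    ultimately show ?thesis unfolding Fa_def Fb_def spi override_insert[OF k(2)] override_upd[OF k(2)]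
      by (simp add: ring_distribs)
  qed
  have ovm: "(\<lambda>p. override (z(k := S p)) A (G p) l) \<in> borel_measurable N"
    if "\<And>l. l \<in> J \<Longrightarrow> (\<lambda>p. G p l) \<in> borel_measurable N" "S \<in> borel_measurable N" for N G l and S :: "_ \<Rightarrow> real"
    using that k by (cases "l \<in> A"; cases "l = k") (auto simp: override_def)
  have Fb_meas: "(\<lambda>p. Fb (S p) (G p)) \<in> borel_measurable N"
    if "\<And>l. l \<in> J \<Longrightarrow> (\<lambda>p. G p l) \<in> borel_measurable N" "S \<in> borel_measurable N" for N G and S :: "_ \<Rightarrow> real"
    unfolding Fb_def spi using that k
    by (intro borel_measurable_times measurable_continuous_fun[OF conth'] ovm measurable_ramp_step measurable_step_product) auto
  have Fa_meas: "(\<lambda>p. Fa (G p)) \<in> borel_measurable N"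
    if "\<And>l. l \<in> J \<Longrightarrow> (\<lambda>p. G p l) \<in> borel_measurable N" for N G
    unfolding Fa_def using that k
    by (intro borel_measurable_times measurable_continuous_fun[OF conth] ovm measurable_step_product) auto
  have coord: "(\<lambda>x. x l) \<in> borel_measurable (gauss_measure J)" if "l \<in> J" for l
    using measurable_component_singleton[OF that, of "\<lambda>_. std_normal"] by simp
  define L where "L = abs_sum D z"
  have updL: "abs_sum D (z(k := s)) \<le> L + \<bar>s\<bar>" for s
    unfolding L_def by (rule sum_abs_fun_upd[OF fin(1)])
  have Lw: "exp (c * abs_sum D (override (z(k := s)) A x)) \<le> exp (c * L) * exp (c * \<bar>s\<bar>) * exp (c * abs_sum J x)" for s x
  proof -
    have "abs_sum D (override (z(k := s)) A x) \<le> (L + \<bar>s\<bar>) + abs_sum J x"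
      using sum_abs_override[OF fin(1) finJ k(3), of "z(k := s)" x] updL[of s] by linarith
    then have "exp (c * abs_sum D (override (z(k := s)) A x)) \<le> exp (c * ((L + \<bar>s\<bar>) + abs_sum J x))"
      using c by (simp add: mult_left_mono)
    also have "\<dots> = exp (c * L) * exp (c * \<bar>s\<bar>) * exp (c * abs_sum J x)"
      by (simp add: ring_distribs exp_add)
    finally show ?thesis .
  qed
  interpret G: prob_space "gauss_measure J" by (rule prob_space_gauss_measure)
  interpret GL: pair_sigma_finite "gauss_measure J" lborel ..
  interpret MS: pair_sigma_finite M lborel ..
  have Fa_int: "integrable (gauss_measure J) Fa"
  proof (rule Bochner_Integration.integrable_bound)
    show "integrable (gauss_measure J) (\<lambda>x. C * exp (c * L) * (\<Prod>l\<in>J. weight c (x l)))"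
      by (intro integrable_mult_right integrable_prod_weight finJ c)
    show "Fa \<in> borel_measurable (gauss_measure J)" using Fa_meas[of "\<lambda>x. x"] coord by auto
    show "AE x in gauss_measure J. norm (Fa x) \<le> norm (C * exp (c * L) * (\<Prod>l\<in>J. weight c (x l)))"
    proof (rule AE_I2)
      fix x
      have "norm (Fa x) \<le> 1 * (C * exp (c * abs_sum D (override (z(k := 0)) A x)))"
        unfolding Fa_def norm_mult by (intro mult_mono) (auto simp: abs_step_product hb)
      also have "\<dots> \<le> 1 * (C * (exp (c * L) * exp (c * \<bar>0\<bar>) * exp (c * abs_sum J x)))"
        by (intro mult_left_mono Lw Cons.prems) auto
      also have "\<dots> \<le> 1 * (C * (exp (c * L) * exp (c * \<bar>0\<bar>) * (\<Prod>l\<in>J. weight c (x l))))"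
        by (intro mult_left_mono exp_sum_abs_le_prod_weight finJ Cons.prems) auto
      finally show "norm (Fa x) \<le> norm (C * exp (c * L) * (\<Prod>l\<in>J. weight c (x l)))"
        by (simp add: mult.assoc)
    qed
  qed
  define g where "g x = C * exp (c * L) * (\<Prod>l\<in>J. weight (c + c) (x l))" for x
  \<comment> \<open>A majorant integrable in \<open>x\<close> and \<open>s\<close> together. The
    kernel vanishes unless \<open>|s| <= |x k|\<close>, so \<open>exp (s^2 / 8)\<close> can be taken
    from the weight of \<open>x k\<close> and leaves a Gaussian factor in \<open>s\<close>.
    Replacing \<open>exp (c * |s|)\<close> by \<open>exp (c * |x k|)\<close> is the reason for
    \<open>c + c\<close>.\<close>
  have Fb_bound: "norm (Fb s x) \<le> g x * exp (0 * \<bar>s\<bar> - (1/8) * s\<^sup>2)" for s x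
  proof (cases "\<bar>s\<bar> \<le> \<bar>x k\<bar>")
    case False
    then have "ramp_step (x k) s = 0" using abs_ramp_step(2)[of "x k" s] by simp
    moreover have "0 \<le> g x" using Cons.prems by (auto simp: g_def weight_def intro!: mult_nonneg_nonneg prod_nonneg)
    ultimately show ?thesis by (simp add: Fb_def spi)
  next
    case True
    have "norm (Fb s x) \<le> 1 * (C * exp (c * abs_sum D (override (z(k := s)) A x)))"
      unfolding Fb_def norm_mult by (intro mult_mono) (auto simp: abs_step_product hb')
    also have "\<dots> \<le> 1 * (C * (exp (c * L) * exp (c * \<bar>s\<bar>) * exp (c * abs_sum J x)))"
      by (intro mult_left_mono Lw Cons.prems) auto
    also have "\<dots> = C * exp (c * L) * (exp (c * \<bar>s\<bar>) * exp (c * abs_sum J x))"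
      by (simp add: mult_ac)
    also have "\<dots> \<le> C * exp (c * L) * ((\<Prod>l\<in>J. weight (c + c) (x l)) * exp (0 * \<bar>s\<bar> - (1/8) * s\<^sup>2))"
    proof (rule mult_left_mono)
      have "s\<^sup>2 \<le> (x k)\<^sup>2" using True by (simp add: abs_le_square_iff)
      then have "c * \<bar>s\<bar> + s\<^sup>2 / 8 \<le> c * \<bar>x k\<bar> + (x k)\<^sup>2 / 8"
        using True c by (intro add_mono mult_left_mono) auto
      then have "exp (c * \<bar>s\<bar>) \<le> weight c (x k) * exp (0 * \<bar>s\<bar> - (1/8) * s\<^sup>2)"
        unfolding weight_def mult_exp_exp by simp
      then have "exp (c * \<bar>s\<bar>) * exp (c * abs_sum J x) \<le>
          (weight c (x k) * exp (0 * \<bar>s\<bar> - (1/8) * s\<^sup>2)) * exp (c * abs_sum J x)"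
        by (intro mult_right_mono) auto
      also have "\<dots> = (weight c (x k) * exp (c * abs_sum J x)) * exp (0 * \<bar>s\<bar> - (1/8) * s\<^sup>2)"
        by (simp add: mult_ac)
      also have "weight c (x k) * exp (c * abs_sum J x) =
          (\<Prod>l\<in>J. (if l = k then weight c (x k) else 1) * exp (c * \<bar>x l\<bar>))"
        using k finJ by (simp add: prod.distrib sum_distrib_left exp_sum)
      also have "\<dots> \<le> (\<Prod>l\<in>J. weight (c + c) (x l))"
        using c by (intro prod_mono) (auto simp: weight_def mult_exp_exp ring_distribs)
      finally show "exp (c * \<bar>s\<bar>) * exp (c * abs_sum J x) \<le>
          (\<Prod>l\<in>J. weight (c + c) (x l)) * exp (0 * \<bar>s\<bar> - (1/8) * s\<^sup>2)"
        by (simp add: mult_right_mono)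
    qed (use Cons.prems in auto)
    finally show ?thesis by (simp add: g_def mult.assoc)
  qed
  have gauss8: "integrable lborel (\<lambda>s::real. exp (0 * \<bar>s\<bar> - (1/8) * s\<^sup>2))"
    by (rule integrable_exp_abs_minus_square) auto
  have Fb_meas1: "(\<lambda>s. Fb s x) \<in> borel_measurable borel" for x
    by (rule Fb_meas) auto
  have Fb_int1: "integrable lborel (\<lambda>s. Fb s x)" for x
  proof (rule Bochner_Integration.integrable_bound)
    show "integrable lborel (\<lambda>s. g x * exp (0 * \<bar>s\<bar> - (1/8) * s\<^sup>2))"
      by (intro integrable_mult_right gauss8)
    show "AE s in lborel. norm (Fb s x) \<le> norm (g x * exp (0 * \<bar>s\<bar> - (1/8) * s\<^sup>2))"
      by (rule AE_I2, rule order_trans[OF Fb_bound]) simp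
  qed (use Fb_meas1 in simp)
  have Fb_int: "integrable (gauss_measure J \<Otimes>\<^sub>M lborel) (\<lambda>p. Fb (snd p) (fst p))"
  proof (rule Bochner_Integration.integrable_bound)
    have "integrable (gauss_measure J) g"
      unfolding g_def by (intro integrable_mult_right integrable_prod_weight finJ) (use c in auto)
    then show "integrable (gauss_measure J \<Otimes>\<^sub>M lborel) (\<lambda>p. g (fst p) * exp (0 * \<bar>snd p\<bar> - (1/8) * (snd p)\<^sup>2))"
      by (intro integrable_pair_mult gauss8) (auto intro: G.sigma_finite_measure_axioms sigma_finite_lborel)
    show "(\<lambda>p. Fb (snd p) (fst p)) \<in> borel_measurable (gauss_measure J \<Otimes>\<^sub>M lborel)"
      by (rule Fb_meas) (auto intro: measurable_compose[OF measurable_fst coord])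
    show "AE p in gauss_measure J \<Otimes>\<^sub>M lborel. norm (Fb (snd p) (fst p)) \<le> norm (g (fst p) * exp (0 * \<bar>snd p\<bar> - (1/8) * (snd p)\<^sup>2))"
      by (rule AE_I2, rule order_trans[OF Fb_bound]) simp
  qed
  have Fb_int': "integrable (gauss_measure J \<Otimes>\<^sub>M lborel) (case_prod (\<lambda>x s. Fb s x))"
    using Fb_int by (simp add: case_prod_beta')
  \<comment> \<open>The error is linear in the integrand, so by Fubini's theorem it can be taken
    under the integral over \<open>s\<close>.\<close>
  have err_split: "error (\<lambda>x. step_product u z x * h (override z (insert k A) x)) \<omega> =
      error Fa \<omega> + (LINT s|lborel. error (Fb s) \<omega>)" for \<omega>
  proof -
    have "(LINT x|gauss_measure J. step_product u z x * h (override z (insert k A) x)) =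
        (LINT x|gauss_measure J. Fa x) + (LINT x|gauss_measure J. LINT s|lborel. Fb s x)"
      unfolding F using GL.integrable_fst'[OF Fb_int'] by (intro Bochner_Integration.integral_add Fa_int) simp
    also have "(LINT x|gauss_measure J. LINT s|lborel. Fb s x) = (LINT s|lborel. LINT x|gauss_measure J. Fb s x)"
      by (rule GL.Fubini_integral[OF Fb_int', symmetric])
    finally have 1: "(LINT x|gauss_measure J. step_product u z x * h (override z (insert k A) x)) =
        (LINT x|gauss_measure J. Fa x) + (LINT s|lborel. LINT x|gauss_measure J. Fb s x)" .
    have "(LINT s|lborel. error (Fb s) \<omega>) =
        (LINT s|lborel. (\<Sum>i=1..n. Fb s (X i \<omega>))) - (LINT s|lborel. real n * (LINT x|gauss_measure J. Fb s x))"
      unfolding error_def using GL.integrable_snd[OF Fb_int']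
      by (intro Bochner_Integration.integral_diff Bochner_Integration.integrable_sum Fb_int1 integrable_mult_right) simp
    also have "(LINT s|lborel. (\<Sum>i=1..n. Fb s (X i \<omega>))) = (\<Sum>i=1..n. LINT s|lborel. Fb s (X i \<omega>))"
      by (intro Bochner_Integration.integral_sum Fb_int1)
    finally show ?thesis unfolding error_def 1 by (simp add: F sum.distrib algebra_simps)
  qed
  have Xm: "\<And>l. l \<in> J \<Longrightarrow> (\<lambda>\<omega>. X i \<omega> l) \<in> borel_measurable M" for i using X by auto
  have meas_a: "error Fa \<in> borel_measurable M"
    unfolding error_def by (intro borel_measurable_diff borel_measurable_sum borel_measurable_const Fa_meas Xm)
  have meas_b: "(\<lambda>p. error (Fb (snd p)) (fst p)) \<in> borel_measurable (M \<Otimes>\<^sub>M lborel)"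
  proof -
    have "(\<lambda>s. LINT x|gauss_measure J. Fb s x) \<in> borel_measurable lborel"
      using GL.integrable_snd[OF Fb_int'] by auto
    then have "(\<lambda>p. LINT x|gauss_measure J. Fb (snd p) x) \<in> borel_measurable (M \<Otimes>\<^sub>M lborel)"
      by (rule measurable_compose[OF measurable_snd])
    then show ?thesis unfolding error_def
      by (intro borel_measurable_diff borel_measurable_sum borel_measurable_times Fb_meas)
        (auto intro: measurable_compose[OF measurable_fst Xm])
  qed
  define L' where "L' = abs_sum (D - insert k A) z"
  \<comment> \<open>The induction hypothesis bounds the mean error of \<open>Fa\<close> by
    \<open>Q\<close>. For \<open>Fb s\<close> there are two further factors, \<open>w s\<close> and
    \<open>exp (c * |s|)\<close>, the latter being the growth in the coordinate now fixed at
    \<open>s\<close>. Their integral is at most \<open>\<kappa>\<close>, hence one factor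
    \<open>1 + \<kappa>\<close> per coordinate.\<close>
  define Q where "Q = C * exp (c * L') * (1 + \<kappa>) ^ length ks * \<beta> * (\<Prod>l\<in>u. w (z l))"
  have Q: "0 \<le> Q" unfolding Q_def using Cons.prems \<beta> \<kappa> w by (intro mult_nonneg_nonneg prod_nonneg) auto
  have L's: "abs_sum (D - A) (z(k := s)) = \<bar>s\<bar> + L'" for s
  proof -
    have "abs_sum (D - A) (z(k := s)) = \<bar>(z(k := s)) k\<bar> + abs_sum (D - A - {k}) (z(k := s))"
      by (rule sum.remove) (use fin k kD in auto)
    also have "D - A - {k} = D - insert k A" by auto
    also have "(z(k := s)) k = s" by simp
    also have "abs_sum (D - insert k A) (z(k := s)) = L'" unfolding L'_def by (rule sum.cong) auto
    finally show ?thesis .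
  qed
  have wu: "(\<Prod>l\<in>u. w ((z(k := s)) l)) = (\<Prod>l\<in>u. w (z l))" for s
    using k by (intro prod.cong) auto
  have Ia: "(\<integral>\<^sup>+\<omega>. ennreal \<bar>error Fa \<omega>\<bar> \<partial>M) \<le> ennreal Q"
    using Cons.IH[OF ib(1), of u "z(k := 0)"] k Cons.prems(2) L's[of 0] wu[of 0]
    unfolding sp A_def[symmetric] Fa_def[symmetric] Q_def by simp
  have Ib: "(\<integral>\<^sup>+\<omega>. ennreal \<bar>error (Fb s) \<omega>\<bar> \<partial>M) \<le> ennreal (Q * (exp (c * \<bar>s\<bar>) * w s))" for s
  proof -
    have "(\<Prod>l\<in>insert k u. w ((z(k := s)) l)) = w s * (\<Prod>l\<in>u. w (z l))"
      using finu k wu[of s] by simp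
    then show ?thesis
      using Cons.IH[OF ib(2), of "insert k u" "z(k := s)"] k Cons.prems(2) L's[of s]
      unfolding A_def[symmetric] Fb_def[symmetric] Q_def by (simp add: exp_add ring_distribs mult_ac)
  qed
  have "(\<integral>\<^sup>+\<omega>. ennreal \<bar>error (\<lambda>x. step_product u z x * h (override z (insert k A) x)) \<omega>\<bar> \<partial>M) \<le>
      (\<integral>\<^sup>+\<omega>. ennreal \<bar>error Fa \<omega>\<bar> + (\<integral>\<^sup>+s. ennreal \<bar>error (Fb s) \<omega>\<bar> \<partial>lborel) \<partial>M)"
  proof (rule nn_integral_mono)
    fix \<omega>
    have "integrable lborel (\<lambda>s. error (Fb s) \<omega>)"
      unfolding error_def using GL.integrable_snd[OF Fb_int']
      by (intro Bochner_Integration.integrable_diff Bochner_Integration.integrable_sum Fb_int1 integrable_mult_right) simp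
    then have "ennreal \<bar>LINT s|lborel. error (Fb s) \<omega>\<bar> \<le> (\<integral>\<^sup>+s. ennreal \<bar>error (Fb s) \<omega>\<bar> \<partial>lborel)"
      using integral_norm_bound_ennreal by fastforce
    moreover have "ennreal \<bar>error Fa \<omega> + (LINT s|lborel. error (Fb s) \<omega>)\<bar> \<le>
        ennreal \<bar>error Fa \<omega>\<bar> + ennreal \<bar>LINT s|lborel. error (Fb s) \<omega>\<bar>"
      by (subst ennreal_plus[symmetric], simp, simp) (rule ennreal_leI, rule abs_triangle_ineq)
    ultimately show "ennreal \<bar>error (\<lambda>x. step_product u z x * h (override z (insert k A) x)) \<omega>\<bar> \<le>
        ennreal \<bar>error Fa \<omega>\<bar> + (\<integral>\<^sup>+s. ennreal \<bar>error (Fb s) \<omega>\<bar> \<partial>lborel)"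
      unfolding err_split by (meson add_left_mono order_trans)
  qed
  also have "\<dots> = (\<integral>\<^sup>+\<omega>. ennreal \<bar>error Fa \<omega>\<bar> \<partial>M) + (\<integral>\<^sup>+\<omega>. \<integral>\<^sup>+s. ennreal \<bar>error (Fb s) \<omega>\<bar> \<partial>lborel \<partial>M)"
  proof (rule nn_integral_add)
    have "(\<lambda>p. ennreal \<bar>error (Fb (snd p)) (fst p)\<bar>) \<in> borel_measurable (M \<Otimes>\<^sub>M lborel)"
      using meas_b by measurable
    then show "(\<lambda>\<omega>. \<integral>\<^sup>+s. ennreal \<bar>error (Fb s) \<omega>\<bar> \<partial>lborel) \<in> borel_measurable M"
      using lborel.borel_measurable_nn_integral_fst by fastforce
  qed (use meas_a in measurable)
  also have "(\<integral>\<^sup>+\<omega>. \<integral>\<^sup>+s. ennreal \<bar>error (Fb s) \<omega>\<bar> \<partial>lborel \<partial>M) = (\<integral>\<^sup>+s. \<integral>\<^sup>+\<omega>. ennreal \<bar>error (Fb s) \<omega>\<bar> \<partial>M \<partial>lborel)"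
  proof (rule MS.Fubini'[symmetric])
    show "(\<lambda>(\<omega>, s). ennreal \<bar>error (Fb s) \<omega>\<bar>) \<in> borel_measurable (M \<Otimes>\<^sub>M lborel)"
      unfolding case_prod_beta' using meas_b by measurable
  qed
  also have "\<dots> \<le> (\<integral>\<^sup>+s. ennreal Q * ennreal (exp (c * \<bar>s\<bar>) * w s) \<partial>lborel)"
    using Ib Q by (intro nn_integral_mono) (simp add: ennreal_mult' mult.assoc)
  also have "\<dots> = ennreal Q * (\<integral>\<^sup>+s. ennreal (exp (c * \<bar>s\<bar>) * w s) \<partial>lborel)"
    using w by (intro nn_integral_cmult) measurable
  also have "\<dots> \<le> ennreal Q * ennreal \<kappa>" using w_int by (rule mult_left_mono) simp
  also note Ia
  also have "ennreal Q + ennreal Q * ennreal \<kappa> = ennreal (Q * (1 + \<kappa>))"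
    using Q \<kappa> by (simp add: ring_distribs ennreal_mult)
  finally show ?case
    by (simp add: A_def Q_def L'_def mult_ac add_mono)
qed

end

section \<open>The normal distribution function, its inverse and its tails\<close>

lemma std_normal_null_iff:
  assumes "A \<in> sets borel"
  shows "A \<in> null_sets std_normal \<longleftrightarrow> A \<in> null_sets lborel"
proof -
  have "A \<in> null_sets std_normal \<longleftrightarrow> (AE x in lborel. x \<in> A \<longrightarrow> ennreal (std_normal_density x) = 0)"
    using assms by (subst null_sets_density_iff) auto
  also have "\<dots> \<longleftrightarrow> (AE x in lborel. x \<notin> A)"
      proof (rule AE_cong)
    show "(x \<in> A \<longrightarrow> ennreal (std_normal_density x) = 0) \<longleftrightarrow> x \<notin> A" for x
      using normal_density_pos[of 1 0 x] by (auto simp: ennreal_eq_0_iff)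
  qed
  also have "\<dots> \<longleftrightarrow> A \<in> null_sets lborel"
    using AE_iff_null_sets[of A lborel] assms by simp
  finally show ?thesis .
qed

lemma std_normal_prob_singleton: "std_normal.prob {x} = 0"
  using std_normal_null_iff[of "{x}"] by (auto simp: null_sets_def std_normal.emeasure_eq_measure)

lemma isCont_std_normal_cdf: "isCont std_normal_cdf x"
  by (simp add: std_normal.isCont_cdf std_normal_prob_singleton)

lemma std_normal_cdf_less:
  assumes "s < t"
  shows "std_normal_cdf s < std_normal_cdf t"
proof -
  have "{s<..t} \<notin> null_sets std_normal"
    using assms by (subst std_normal_null_iff) (auto simp: null_sets_def)
  then have "std_normal.prob {s<..t} \<noteq> 0"
    by (auto simp: null_sets_def std_normal.emeasure_eq_measure)
  then show ?thesis
    using std_normal.cdf_diff_eq[OF assms] measure_nonneg[of std_normal "{s<..t}"] by linarith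
qed

lemma std_normal_cdf_strict_mono: "strict_mono std_normal_cdf"
  by (rule strict_monoI) (rule std_normal_cdf_less)

lemma std_normal_cdf_bounds: "0 < std_normal_cdf s" "std_normal_cdf s < 1"
proof -
  show "0 < std_normal_cdf s"
    using std_normal_cdf_less[of "s - 1" s] std_normal.cdf_nonneg[of "s - 1"] by simp
  show "std_normal_cdf s < 1"
    using std_normal_cdf_less[of s "s + 1"] std_normal.cdf_bounded_prob[of "s + 1"] by simp
qed

lemma std_normal_cdf_inv:
  assumes "0 < y" "y < 1"
  shows "std_normal_cdf (inv std_normal_cdf y) = y"
proof (rule f_inv_into_f)
  have "eventually (\<lambda>x. std_normal_cdf x < y) at_bot"
    using std_normal.cdf_lim_at_bot assms by (auto intro: order_tendstoD)
  then obtain a0 where a0: "\<And>x. x \<le> a0 \<Longrightarrow> std_normal_cdf x < y"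
    by (auto simp: eventually_at_bot_linorder)
  have "eventually (\<lambda>x. y < std_normal_cdf x) at_top"
    using std_normal.cdf_lim_at_top_prob assms by (auto intro: order_tendstoD)
  then obtain b0 where b0: "\<And>x. b0 \<le> x \<Longrightarrow> y < std_normal_cdf x"
    by (auto simp: eventually_at_top_linorder)
  have "\<exists>x. min a0 b0 \<le> x \<and> x \<le> max a0 b0 \<and> std_normal_cdf x = y"
    using a0[of "min a0 b0"] b0[of "max a0 b0"] isCont_std_normal_cdf
    by (intro IVT) (auto intro: less_imp_le)
  then show "y \<in> range std_normal_cdf" by auto
qed

lemma le_inv_std_normal_cdf_iff:
  assumes "0 < y" "y < 1"
  shows "s \<le> inv std_normal_cdf y \<longleftrightarrow> std_normal_cdf s \<le> y"
  using strict_mono_less_eq[OF std_normal_cdf_strict_mono, of s "inv std_normal_cdf y"]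
  by (simp add: std_normal_cdf_inv[OF assms])

text \<open>On \<open>(0,1)\<close> the preimages of half-lines are intervals; elsewhere
  \<open>inv\<close> chooses from an empty set, which always yields the same value.\<close>

lemma measurable_inv_std_normal_cdf [measurable]: "inv std_normal_cdf \<in> borel_measurable borel"
proof (rule borel_measurableI_ge)
  fix s :: real
  define r where "r = (SOME x::real. False)"
  have out: "inv std_normal_cdf y = r" if "\<not> (0 < y \<and> y < 1)" for y
  proof -
    have "(\<lambda>x. std_normal_cdf x = y) = (\<lambda>x. False)" using std_normal_cdf_bounds that by fastforce
    then show ?thesis by (simp add: inv_into_def r_def)
  qed
  have "{y. s \<le> inv std_normal_cdf y} =
      ({0<..<1} \<inter> {std_normal_cdf s..}) \<union> (if s \<le> r then - {0<..<1} else {})"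
    using le_inv_std_normal_cdf_iff[of _ s] out by (auto split: if_splits) (metis+)
  also have "\<dots> \<in> sets borel" by auto
  finally show "{y \<in> space borel. s \<le> inv std_normal_cdf y} \<in> sets borel" by simp
qed

text \<open>The Gaussian measure of the half-line that \<open>ramp_step\<close> selects for the
  endpoint \<open>s\<close>, on the side away from 0.\<close>

definition tail_prob :: "real \<Rightarrow> real" where
  "tail_prob s = (if 0 < s then 1 - std_normal_cdf s else std_normal_cdf s)"

lemma tail_prob_nonneg: "0 \<le> tail_prob s"
  using std_normal_cdf_bounds[of s] by (auto simp: tail_prob_def)

lemma std_normal_prob_less: "std_normal.prob {x. x < s} = std_normal_cdf s"
proof -
  have "std_normal_cdf s = std_normal.prob ({x. x < s} \<union> {s})"
    by (simp add: cdf_def) (rule arg_cong[where f = "measure _"], auto)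
  also have "\<dots> = std_normal.prob {x. x < s} + std_normal.prob {s}"
    by (rule std_normal.finite_measure_Union) auto
  finally show ?thesis by (simp add: std_normal_prob_singleton)
qed

lemma std_normal_prob_ge: "std_normal.prob {x. s \<le> x} = 1 - std_normal_cdf s"
proof -
  have "{x. s \<le> x} = space std_normal - {x. x < s}" by auto
  then show ?thesis using std_normal_prob_less[of s] std_normal.prob_compl[of "{x. x < s}"] by simp
qed

lemma ramp_step_integral:
  "(LINT x|std_normal. ramp_step x s) = (if 0 < s then 1 else -1) * tail_prob s"
  "integrable std_normal (\<lambda>x. ramp_step x s)"
proof -
  have eq: "ramp_step x s = (if 0 < s then indicator {x. s \<le> x} x else - indicator {x. x < s} x)" for x
    by (auto simp: ramp_step_def indicator_def)
  have 1: "(LINT x|std_normal. indicator {x. s \<le> x} x) = 1 - std_normal_cdf s"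
    "(LINT x|std_normal. indicator {x. x < s} x) = std_normal_cdf s"
    using std_normal_prob_ge[of s] std_normal_prob_less[of s] by simp_all
  show "(LINT x|std_normal. ramp_step x s) = (if 0 < s then 1 else -1) * tail_prob s"
    unfolding eq using 1 by (cases "0 < s") (auto simp: tail_prob_def)
  show "integrable std_normal (\<lambda>x. ramp_step x s)"
    by (rule std_normal.integrable_const_bound[where B = 1]) (auto simp: abs_ramp_step)
qed

lemma tail_prob_decay: "\<exists>B\<ge>0. \<forall>s. tail_prob s \<le> B * exp (- (s\<^sup>2 / 8))"
proof -
  obtain B where B: "\<And>s. 0 \<le> s \<Longrightarrow> std_normal.prob {x. s \<le> \<bar>x\<bar>} \<le> B * exp (- (s\<^sup>2 / 8))"
    using std_normal_tail by auto
  have "tail_prob s \<le> std_normal.prob {x. \<bar>s\<bar> \<le> \<bar>x\<bar>}" for s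
  proof (cases "0 < s")
    case True
    then have "tail_prob s = std_normal.prob {x. s \<le> x}" by (simp add: tail_prob_def std_normal_prob_ge)
    also have "\<dots> \<le> std_normal.prob {x. \<bar>s\<bar> \<le> \<bar>x\<bar>}"
      using True by (intro std_normal.finite_measure_mono) auto
    finally show ?thesis .
  next
    case False
    then have "tail_prob s = std_normal.prob {x. x < s}" by (simp add: tail_prob_def std_normal_prob_less)
    also have "\<dots> \<le> std_normal.prob {x. \<bar>s\<bar> \<le> \<bar>x\<bar>}"
      using False by (intro std_normal.finite_measure_mono) auto
    finally show ?thesis .
  qed
  then have "tail_prob s \<le> B * exp (- (s\<^sup>2 / 8))" for s
    by (rule order_trans) (use B[of "\<bar>s\<bar>"] in simp)
  moreover have "std_normal.prob UNIV \<le> B" using B[of 0] by simp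
  then have "0 \<le> B" by (rule order_trans[OF measure_nonneg])
  ultimately show ?thesis by auto
qed

lemma measurable_tail_prob [measurable]: "tail_prob \<in> borel_measurable borel"
proof -
  have [measurable]: "std_normal_cdf \<in> borel_measurable borel"
    by (intro borel_measurable_continuous_onI continuous_at_imp_continuous_on) (simp add: isCont_std_normal_cdf)
  show ?thesis unfolding tail_prob_def by measurable
qed

text \<open>A positive power of a Gaussian tail still decays like a Gaussian, with the smaller rate
  \<open>e / 8\<close>, and so beats every exponential.\<close>

lemma tail_prob_powr_integral:
  assumes "0 < e" "0 \<le> c"
  shows "\<exists>\<kappa>\<ge>0. (\<integral>\<^sup>+s. ennreal (exp (c * \<bar>s\<bar>) * tail_prob s powr e) \<partial>lborel) \<le> ennreal \<kappa>"
proof -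
  obtain B where B: "0 \<le> B" "\<And>s. tail_prob s \<le> B * exp (- (s\<^sup>2 / 8))" using tail_prob_decay by auto
  let ?g = "\<lambda>s::real. B powr e * exp (c * \<bar>s\<bar> - (e / 8) * s\<^sup>2)"
  have int: "integrable lborel ?g"
    by (intro integrable_mult_right integrable_exp_abs_minus_square) (use assms in auto)
  have "(\<integral>\<^sup>+s. ennreal (exp (c * \<bar>s\<bar>) * tail_prob s powr e) \<partial>lborel) \<le> (\<integral>\<^sup>+s. ennreal (?g s) \<partial>lborel)"
  proof (intro nn_integral_mono ennreal_leI)
    fix s :: real
    have "tail_prob s powr e \<le> (B * exp (- (s\<^sup>2 / 8))) powr e"
      using B tail_prob_nonneg assms by (intro powr_mono2) auto
    also have "\<dots> = B powr e * exp (- ((e / 8) * s\<^sup>2))"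
      using B by (simp add: powr_mult exp_powr_real)
    finally have "exp (c * \<bar>s\<bar>) * tail_prob s powr e \<le> exp (c * \<bar>s\<bar>) * (B powr e * exp (- ((e / 8) * s\<^sup>2)))"
      by (intro mult_left_mono) auto
    also have "\<dots> = ?g s" by (simp add: mult_exp_exp mult.left_commute)
    finally show "exp (c * \<bar>s\<bar>) * tail_prob s powr e \<le> ?g s" .
  qed
  also have "\<dots> = ennreal (LINT s|lborel. ?g s)" by (rule nn_integral_eq_integral[OF int]) simp
  finally show ?thesis by (intro exI[of _ "LINT s|lborel. ?g s"]) (auto intro!: integral_nonneg_AE)
qed

text \<open>With \<open>R\<close> the mean error, the pathwise bound is used in
  \<open>R powr (1 - e)\<close> and the bound by the volume in \<open>R powr e\<close>; the
  exponents of \<open>n\<close> add up to \<open>e * (1 - e) + e\<close>, which is at most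
  \<open>2 * e\<close>.\<close>

lemma (in scrambling) step_product_error:
  assumes C: "\<And>p n \<phi> v. ts_sequence b t J p \<Longrightarrow> 1 \<le> n \<Longrightarrow> (\<forall>k\<in>J. half_interval (\<phi> k) (v k)) \<Longrightarrow>
      \<bar>product_discrepancy J {1..n} p \<phi> v\<bar> \<le> C * real n powr e"
    and "0 < C" and e: "0 < e" "e < 1" and seq: "ts_sequence b t J p" and n: "1 \<le> n" and u: "u \<subseteq> J"
  defines "X \<equiv> \<lambda>i \<omega>. \<lambda>k\<in>J. inv std_normal_cdf (scrambled k (p i k) \<omega>)"
  shows "(\<integral>\<^sup>+\<omega>. ennreal \<bar>(\<Sum>i=1..n. step_product u z (X i \<omega>)) -
       real n * (LINT x|gauss_measure J. step_product u z x)\<bar> \<partial>M)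
     \<le> ennreal (2 * (1 + C) * real n powr (2 * e) * (\<Prod>k\<in>u. tail_prob (z k) powr e))"
proof -
  have finu: "finite u" using u finJ finite_subset by auto
  \<comment> \<open>Images of the half-lines under the normal distribution function; coordinates
    outside \<open>u\<close> get the full interval, so that all of \<open>J\<close> is covered. The
    signs of the kernels are collected in \<open>sg\<close>.\<close>
  define H where "H k = (if k \<in> u then (if 0 < z k then (\<lambda>y. of_bool (std_normal_cdf (z k) \<le> y))
      else (\<lambda>y. of_bool (y < std_normal_cdf (z k)))) else (\<lambda>y. of_bool (y < 1)) :: real \<Rightarrow> real)" for k
  define v where "v k = (if k \<in> u then tail_prob (z k) else 1)" for k
  define sg where "sg = (\<Prod>k\<in>u. if 0 < z k then 1 else -1 :: real)"
  define V where "V = (\<Prod>k\<in>u. tail_prob (z k))"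
  have H: "\<forall>k\<in>J. half_interval (H k) (v k)"
  proof
    fix k
    have "0 \<le> std_normal_cdf (z k)" "std_normal_cdf (z k) \<le> 1" using std_normal_cdf_bounds[of "z k"] by auto
    then show "half_interval (H k) (v k)"
      using half_interval_full unfolding H_def v_def tail_prob_def half_interval_def by auto
  qed
  have Vv: "(\<Prod>k\<in>J. v k) = V" unfolding V_def v_def using u finJ
    by (simp add: prod.If_cases Int_absorb1)
  have V0: "0 \<le> V" unfolding V_def by (intro prod_nonneg) (simp add: tail_prob_nonneg)
  have sg: "\<bar>sg\<bar> = 1" unfolding sg_def abs_prod by (rule prod.neutral) auto
  have p: "0 \<le> p i k" if "1 \<le> i" "k \<in> J" for i k
    using ts_sequence_range(1)[OF seq b2] that by auto
  have int: "(LINT x|gauss_measure J. step_product u z x) = sg * V"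
  proof -
    have "(LINT x|gauss_measure J. step_product u z x) =
        (LINT x|gauss_measure J. (\<Prod>k\<in>J. if k \<in> u then ramp_step (x k) (z k) else 1))"
      using u finJ by (simp add: step_product_def prod.If_cases Int_absorb1)
    also have "\<dots> = (\<Prod>k\<in>J. LINT x|std_normal. (if k \<in> u then ramp_step x (z k) else 1))"
    proof (rule gauss.product_integral_prod[OF finJ, of "\<lambda>k x. if k \<in> u then ramp_step x (z k) else 1"])
      show "integrable std_normal (\<lambda>x. if k \<in> u then ramp_step x (z k) else 1)" for k
        by (cases "k \<in> u") (auto simp: ramp_step_integral(2))
    qed
    also have "\<dots> = (\<Prod>k\<in>J. if k \<in> u then (if 0 < z k then 1 else -1) * tail_prob (z k) else 1)"
      using std_normal.prob_space by (intro prod.cong refl) (simp add: ramp_step_integral(1))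
    also have "\<dots> = (\<Prod>k\<in>u. (if 0 < z k then 1 else -1) * tail_prob (z k))"
      using u finJ by (simp add: prod.If_cases Int_absorb1)
    also have "\<dots> = sg * V" unfolding sg_def V_def by (rule prod.distrib)
    finally show ?thesis .
  qed
  define Y where "Y \<omega> = product_discrepancy J {1..n} (\<lambda>i k. scrambled k (p i k) \<omega>) H v" for \<omega>
  have Ydef: "Y \<omega> = (\<Sum>i=1..n. \<Prod>k\<in>J. H k (scrambled k (p i k) \<omega>)) - real n * V" for \<omega>
    by (simp add: Y_def product_discrepancy_def Vv)
  have ae: "AE \<omega> in M. \<bar>(\<Sum>i=1..n. step_product u z (X i \<omega>)) -
       real n * (LINT x|gauss_measure J. step_product u z x)\<bar> = \<bar>Y \<omega>\<bar> \<and> \<bar>Y \<omega>\<bar> \<le> C * real n powr e"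
    using AE_scrambled_ts_sequence[OF seq]
  proof eventually_elim
    case (elim \<omega>)
    have "step_product u z (X i \<omega>) = sg * (\<Prod>k\<in>J. H k (scrambled k (p i k) \<omega>))" if i: "1 \<le> i" for i
    proof -
      have U01: "0 < scrambled k (p i k) \<omega>" "scrambled k (p i k) \<omega> < 1" if "k \<in> J" for k using elim i that by auto
      have "(\<Prod>k\<in>J. H k (scrambled k (p i k) \<omega>)) =
          (\<Prod>k\<in>J. if k \<in> u then (if 0 < z k then of_bool (std_normal_cdf (z k) \<le> scrambled k (p i k) \<omega>)
            else of_bool (scrambled k (p i k) \<omega> < std_normal_cdf (z k))) else 1)"
        using U01 by (intro prod.cong) (auto simp: H_def)
      also have "\<dots> = (\<Prod>k\<in>u. if 0 < z k then of_bool (std_normal_cdf (z k) \<le> scrambled k (p i k) \<omega>)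
            else of_bool (scrambled k (p i k) \<omega> < std_normal_cdf (z k)))"
        using u finJ by (simp add: prod.If_cases Int_absorb1)
      also have "sg * \<dots> = (\<Prod>k\<in>u. ramp_step (X i \<omega> k) (z k))"
        unfolding sg_def prod.distrib[symmetric]
      proof (rule prod.cong[OF refl])
        fix k assume "k \<in> u"
        then have kJ: "k \<in> J" using u by auto
        show "(if 0 < z k then 1 else - 1) *
            (if 0 < z k then of_bool (std_normal_cdf (z k) \<le> scrambled k (p i k) \<omega>)
             else of_bool (scrambled k (p i k) \<omega> < std_normal_cdf (z k))) = ramp_step (X i \<omega> k) (z k)"
          using kJ le_inv_std_normal_cdf_iff[OF U01[OF kJ], of "z k"]
          by (auto simp: X_def ramp_step_def not_le[symmetric])
      qed
      finally show ?thesis by (simp add: step_product_def)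
    qed
    then have "(\<Sum>i=1..n. step_product u z (X i \<omega>)) - real n * (LINT x|gauss_measure J. step_product u z x) = sg * Y \<omega>"
      unfolding int Ydef by (simp add: sum_distrib_left right_diff_distrib mult.left_commute)
    then show ?case using sg C[OF _ n H] elim by (simp add: abs_mult Y_def)
  qed
  have Hm: "(\<lambda>\<omega>. \<Prod>k\<in>J. H k (scrambled k (p i k) \<omega>)) \<in> borel_measurable M" if "1 \<le> i" for i
    using half_interval_expectation(1) p[OF that] H by (intro borel_measurable_prod) auto
  have Hint: "integrable M (\<lambda>\<omega>. \<Prod>k\<in>J. H k (scrambled k (p i k) \<omega>))" if "1 \<le> i" for i
  proof (rule integrable_const_bound[where B = 1])
    show "AE \<omega> in M. norm (\<Prod>k\<in>J. H k (scrambled k (p i k) \<omega>)) \<le> 1"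
      using H half_interval_bounds by (intro AE_I2) (auto simp: abs_prod intro!: prod_le_1)
  qed (rule Hm[OF that])
  have Yint: "integrable M Y" unfolding Ydef using Hint by (intro Bochner_Integration.integrable_diff Bochner_Integration.integrable_sum) auto
  define R where "R = (LINT \<omega>|M. \<bar>Y \<omega>\<bar>)"
  have R0: "0 \<le> R" unfolding R_def by (intro integral_nonneg_AE) auto
  have R1: "R \<le> C * real n powr e"
  proof -
    have "R \<le> (LINT \<omega>|M. C * real n powr e)"
      unfolding R_def using Yint ae by (intro integral_mono_AE) auto
    then show ?thesis by (simp add: prob_space)
  qed
  \<comment> \<open>No cancellation is used: the number of points in the box and \<open>n V\<close>
    are added, and each has mean \<open>n V\<close>.\<close>
  have R2: "R \<le> 2 * real n * V"
  proof -
    have "R \<le> (LINT \<omega>|M. (\<Sum>i=1..n. \<Prod>k\<in>J. H k (scrambled k (p i k) \<omega>)) + real n * V)"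
      unfolding R_def
    proof (rule integral_mono)
      show "\<bar>Y \<omega>\<bar> \<le> (\<Sum>i=1..n. \<Prod>k\<in>J. H k (scrambled k (p i k) \<omega>)) + real n * V" for \<omega>
      proof -
        have "0 \<le> (\<Sum>i=1..n. \<Prod>k\<in>J. H k (scrambled k (p i k) \<omega>))"
          using H half_interval_bounds by (intro sum_nonneg prod_nonneg) auto
        moreover have "0 \<le> real n * V" using V0 by simp
        ultimately show ?thesis unfolding Ydef by linarith
      qed
    qed (use Yint Hint in \<open>auto intro!: Bochner_Integration.integrable_add Bochner_Integration.integrable_sum\<close>)
    also have "\<dots> = (\<Sum>i=1..n. LINT \<omega>|M. (\<Prod>k\<in>J. H k (scrambled k (p i k) \<omega>))) + real n * V"
      using Hint by (subst Bochner_Integration.integral_add) (auto simp: prob_space intro!: Bochner_Integration.integrable_sum)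
    also have "(\<Sum>i=1..n. LINT \<omega>|M. (\<Prod>k\<in>J. H k (scrambled k (p i k) \<omega>))) = (\<Sum>i=1..n. V)"
      using half_interval_product_expectation[OF p H] by (intro sum.cong) (auto simp: Vv)
    finally show ?thesis by (simp add: mult_ac)
  qed
  have "R \<le> 2 * (1 + C) * real n powr (2 * e) * V powr e"
  proof (cases "R = 0")
    case True
    then show ?thesis using \<open>0 < C\<close> by simp
  next
    case False
    then have "R = R powr (1 - e) * R powr e" using R0 by (simp flip: powr_add)
    also have "\<dots> \<le> (C * real n powr e) powr (1 - e) * (2 * real n * V) powr e"
      using R0 R1 R2 e by (intro mult_mono powr_mono2) auto
    also have "\<dots> = C powr (1 - e) * real n powr (e * (1 - e)) * (2 powr e * real n powr e * V powr e)"
      using \<open>0 < C\<close> V0 n by (simp add: powr_mult powr_powr)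
    also have "\<dots> \<le> (1 + C) * real n powr e * (2 * real n powr e * V powr e)"
    proof (intro mult_mono)
      have "C powr (1 - e) \<le> (1 + C) powr (1 - e)" using \<open>0 < C\<close> e by (intro powr_mono2) auto
      also have "\<dots> \<le> (1 + C) powr 1" using \<open>0 < C\<close> e by (intro powr_mono) auto
      finally show "C powr (1 - e) \<le> 1 + C" using \<open>0 < C\<close> by simp
      show "real n powr (e * (1 - e)) \<le> real n powr e" using n e by (intro powr_mono) auto
      have "2 powr e \<le> 2 powr (1::real)" using e by (intro powr_mono) auto
      then show "2 powr e \<le> (2::real)" by simp
    qed (use \<open>0 < C\<close> in auto)
    also have "\<dots> = 2 * (1 + C) * real n powr (2 * e) * V powr e"
    proof -
      have "real n powr (2 * e) = real n powr e * real n powr e" by (simp add: powr_add[symmetric])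
      then show ?thesis by (simp add: mult_ac)
    qed
    finally show ?thesis .
  qed
  also have "V powr e = (\<Prod>k\<in>u. tail_prob (z k) powr e)"
    unfolding V_def by (rule prod_powr_distrib)
  finally have Rfin: "R \<le> 2 * (1 + C) * real n powr (2 * e) * (\<Prod>k\<in>u. tail_prob (z k) powr e)" .
  have "(\<integral>\<^sup>+\<omega>. ennreal \<bar>(\<Sum>i=1..n. step_product u z (X i \<omega>)) -
       real n * (LINT x|gauss_measure J. step_product u z x)\<bar> \<partial>M) = (\<integral>\<^sup>+\<omega>. ennreal \<bar>Y \<omega>\<bar> \<partial>M)"
    using ae by (intro nn_integral_cong_AE) (auto elim: eventually_mono)
  also have "\<dots> = ennreal R" unfolding R_def using Yint by (intro nn_integral_eq_integral) auto
  also have "\<dots> \<le> ennreal (2 * (1 + C) * real n powr (2 * e) * (\<Prod>k\<in>u. tail_prob (z k) powr e))"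
    using Rfin by (rule ennreal_leI)
  finally show ?thesis .
qed

theorem smooth_class_scrambled_L1_rate:
  fixes M :: "'w measure"
  assumes sc: "smooth_class D P" "h \<in> P" and fin: "finite D" "J \<subseteq> D" and b: "b \<ge> 2" and \<epsilon>: "0 < \<epsilon>"
  shows "scrambled_L1_rate M b J h (LINT x|gauss_measure J. h x) \<epsilon>"
  unfolding scrambled_L1_rate_def Let_def
proof (intro allI impI)
  fix t p \<pi>
  assume as: "ts_sequence b t J p \<and> owen_scrambling M b J \<pi>"
  let ?c = "LINT x|gauss_measure J. h x"
  let ?err = "\<lambda>n \<omega>. \<bar>quadrature J (\<lambda>i k. scramble_value b (\<lambda>as. \<pi> k as \<omega>) (p i k)) n h - ?c\<bar>"
  have seq: "ts_sequence b t J p" and owen: "owen_scrambling M b J \<pi>" using as by auto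
  have finJ: "finite J" using fin finite_subset by auto
  interpret prob_space M using owen by (simp add: owen_scrambling_def)
  interpret scrambling M b J \<pi> by unfold_locales (use owen b finJ in auto)
  show "(\<forall>n\<ge>1. integrable M (?err n)) \<and> (\<lambda>n. LINT \<omega>|M. ?err n \<omega>) \<in> O(\<lambda>n. real n powr (- 1 + \<epsilon>))"
  proof (cases "J = {}")
    case True
    \<comment> \<open>The product measure over no coordinates is the point mass at the function that
      is undefined everywhere, the argument that \<open>quadrature\<close> uses in this
      case.\<close>
    have "?c = h (\<lambda>_. undefined)"
      using True by (simp add: PiM_empty lebesgue_integral_count_space_finite)
    then have "?err n \<omega> = 0" for n \<omega> using True by (simp add: quadrature_def)
    then show ?thesis by simp
  next
    case False
    \<comment> \<open>\<open>2 * e <= \<epsilon>\<close> serves the final rate, \<open>e < 1\<close>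
      the interpolation.\<close>
    define e where "e = min (\<epsilon> / 2) (1 / 2)"
    have e: "0 < e" "e < 1" "2 * e \<le> \<epsilon>" using \<epsilon> by (auto simp: e_def)
    obtain C1 where C1: "0 < C1" "\<And>p n \<phi> v. ts_sequence b t J p \<Longrightarrow> 1 \<le> n \<Longrightarrow> (\<forall>k\<in>J. half_interval (\<phi> k) (v k)) \<Longrightarrow>
      \<bar>product_discrepancy J {1..n} p \<phi> v\<bar> \<le> C1 * real n powr e"
      using ts_sequence_discrepancy[OF b finJ False e(1), of t] by blast
    define ks where "ks = sorted_list_of_set J"
    have ks: "set ks = J" "distinct ks" using finJ by (auto simp: ks_def)
    obtain C c where C: "0 \<le> C" "0 \<le> c" "iter_bounded D ks C c h"
      using smooth_class_iter_bounded[OF sc] by blast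
    have conth: "continuous_on UNIV h" using iter_bounded_base(1)[OF C(3)] .
    obtain \<kappa> where \<kappa>: "0 \<le> \<kappa>" "(\<integral>\<^sup>+s. ennreal (exp (c * \<bar>s\<bar>) * tail_prob s powr e) \<partial>lborel) \<le> ennreal \<kappa>"
      using tail_prob_powr_integral[OF e(1) C(2)] by auto
    define X where "X i \<omega> = (\<lambda>k\<in>J. inv std_normal_cdf (scrambled k (p i k) \<omega>))" for i \<omega>
    have Xm: "(\<lambda>\<omega>. X i \<omega> k) \<in> borel_measurable M" for i k
      by (cases "k \<in> J") (auto simp: X_def intro: measurable_compose[OF measurable_scrambled measurable_inv_std_normal_cdf])
    define K where "K = C * exp (c * (\<Sum>k\<in>D - J. \<bar>undefined :: real\<bar>)) * (1 + \<kappa>) ^ length ks * (2 * (1 + C1))"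
    have K: "0 \<le> K" using C C1 \<kappa> by (simp add: K_def)
    have bound: "integrable M (?err n) \<and> (LINT \<omega>|M. ?err n \<omega>) \<le> K * real n powr (- 1 + \<epsilon>)" if n: "1 \<le> n" for n
    proof -
      define \<beta> where "\<beta> = 2 * (1 + C1) * real n powr (2 * e)"
      interpret sample M D J n X "\<lambda>s. tail_prob s powr e" \<beta> c \<kappa>
      proof unfold_locales
        show "0 \<le> \<beta>" using C1 by (simp add: \<beta>_def)
        show "(\<integral>\<^sup>+\<omega>. ennreal \<bar>(\<Sum>i=1..n. step_product u z (X i \<omega>)) -
            real n * (LINT x|gauss_measure J. step_product u z x)\<bar> \<partial>M) \<le> ennreal (\<beta> * (\<Prod>k\<in>u. tail_prob (z k) powr e))"
          if "u \<subseteq> J" for u z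
          unfolding \<beta>_def X_def by (rule step_product_error[OF C1(2) C1(1) e(1,2) seq n that])
      qed (use fin C \<kappa> Xm in auto)
      \<comment> \<open>With a base point undefined everywhere, overriding all of \<open>J\<close>
        gives back the extensional points \<open>X i \<omega>\<close>; the coordinates in
        \<open>D - J\<close> contribute only a constant exponential to \<open>K\<close>.\<close>
      define z :: "nat \<Rightarrow> real" where "z = (\<lambda>_. undefined)"
      have "error (\<lambda>x. step_product {} z x * h (override z (set ks) x)) \<omega> = (\<Sum>i=1..n. h (X i \<omega>)) - real n * ?c" for \<omega>
      proof -
        have "override z J (X i \<omega>) = X i \<omega>" for i by (auto simp: override_def X_def z_def fun_eq_iff)
        moreover have "(LINT x|gauss_measure J. h (override z J x)) = ?c"
          by (rule Bochner_Integration.integral_cong)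
            (auto simp: override_def z_def space_PiM PiE_def extensional_def fun_eq_iff intro!: arg_cong[where f = h])
        ultimately show ?thesis by (simp add: error_def ks step_product_def)
      qed
      then have kh: "(\<integral>\<^sup>+\<omega>. ennreal \<bar>(\<Sum>i=1..n. h (X i \<omega>)) - real n * ?c\<bar> \<partial>M) \<le> ennreal (K * real n powr (2 * e))"
        using koksma_hlawka_expectation[OF C(3,1), of "{}" z] ks
        by (simp add: K_def \<beta>_def z_def mult.assoc)
      have err: "?err n \<omega> = \<bar>(\<Sum>i=1..n. h (X i \<omega>)) - real n * ?c\<bar> / real n" for \<omega>
      proof -
        have "quadrature J (\<lambda>i k. scramble_value b (\<lambda>as. \<pi> k as \<omega>) (p i k)) n h - ?c =
            ((\<Sum>i=1..n. h (X i \<omega>)) - real n * ?c) / real n"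
          using n False by (simp add: quadrature_def X_def scrambled_def field_simps)
        then show ?thesis by simp
      qed
      let ?E = "\<lambda>\<omega>. \<bar>(\<Sum>i=1..n. h (X i \<omega>)) - real n * ?c\<bar>"
      have hX: "(\<lambda>\<omega>. h (X i \<omega>)) \<in> borel_measurable M" for i
        by (rule measurable_continuous_fun[OF conth Xm])
      have intE: "integrable M ?E"
      proof (rule integrableI_bounded)
        have "(\<integral>\<^sup>+\<omega>. ennreal (norm (?E \<omega>)) \<partial>M) \<le> ennreal (K * real n powr (2 * e))" using kh by simp
        then show "(\<integral>\<^sup>+\<omega>. ennreal (norm (?E \<omega>)) \<partial>M) < \<infinity>" by (rule le_less_trans) simp
      qed (use hX in measurable)
      have "ennreal (LINT \<omega>|M. ?E \<omega>) \<le> ennreal (K * real n powr (2 * e))"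
        using kh nn_integral_eq_integral[OF intE] by simp
      then have "(LINT \<omega>|M. ?E \<omega>) \<le> K * real n powr (2 * e)"
        using K by (subst (asm) ennreal_le_iff) auto
      then have "(LINT \<omega>|M. ?E \<omega>) / real n \<le> K * real n powr (2 * e) / real n"
        by (rule divide_right_mono) simp
      also have "\<dots> = K * real n powr (2 * e - 1)" using n by (simp add: powr_diff)
      also have "\<dots> \<le> K * real n powr (- 1 + \<epsilon>)" using n e K by (intro mult_left_mono powr_mono) auto
      finally have "(LINT \<omega>|M. ?E \<omega> / real n) \<le> K * real n powr (- 1 + \<epsilon>)" by simp
      moreover have "integrable M (\<lambda>\<omega>. ?E \<omega> / real n)" using intE by simp
      ultimately show ?thesis unfolding err by blast
    qed
    have "(\<lambda>n. LINT \<omega>|M. ?err n \<omega>) \<in> O(\<lambda>n. real n powr (- 1 + \<epsilon>))"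
    proof (rule bigoI)
      show "eventually (\<lambda>n. norm (LINT \<omega>|M. ?err n \<omega>) \<le> K * norm (real n powr (- 1 + \<epsilon>))) at_top"
        using eventually_ge_at_top[of 1]
      proof eventually_elim
        case (elim n)
        have "0 \<le> (LINT \<omega>|M. ?err n \<omega>)" by (rule integral_nonneg_AE) simp
        then show ?case using bound[OF elim] by simp
      qed
    qed
    then show ?thesis using bound by blast
  qed
qed

section \<open>Smoothing by integration\<close>

lemma has_partial_add: "has_partial k g g' \<Longrightarrow> has_partial k h h' \<Longrightarrow> has_partial k (\<lambda>z. g z + h z) (\<lambda>z. g' z + h' z)"
  unfolding has_partial_def by (auto intro!: DERIV_add)

lemma has_partial_mult:
  "has_partial k g g' \<Longrightarrow> has_partial k h h' \<Longrightarrow> has_partial k (\<lambda>z. g z * h z) (\<lambda>z. g' z * h z + g z * h' z)"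
  unfolding has_partial_def
proof (intro allI)
  fix z
  assume "\<forall>z. ((\<lambda>s. g (z(k := s))) has_real_derivative g' z) (at (z k))"
    and "\<forall>z. ((\<lambda>s. h (z(k := s))) has_real_derivative h' z) (at (z k))"
  then have "((\<lambda>s. g (z(k := s)) * h (z(k := s))) has_real_derivative g' z * h (z(k := z k)) + h' z * g (z(k := z k))) (at (z k))"
    by (intro DERIV_mult) auto
  then show "((\<lambda>s. g (z(k := s)) * h (z(k := s))) has_real_derivative g' z * h z + g z * h' z) (at (z k))"
    by (simp add: mult.commute)
qed

lemma tame_bounded:
  assumes "continuous_on UNIV h" "\<And>z. \<bar>h z\<bar> \<le> C"
  shows "tame D h"
proof -
  have "0 \<le> C" using assms(2) abs_ge_zero order_trans by blast
  then show ?thesis unfolding tame_def using assms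
    by (intro conjI exI[of _ C] exI[of _ 0]) auto
qed

lemma tame_const: "tame D (\<lambda>_. c)"
  by (rule tame_bounded[where C = "\<bar>c\<bar>"]) auto

lemma tame_coord:
  assumes "finite D" "k \<in> D"
  shows "tame D (\<lambda>z. z k)"
  unfolding tame_def
proof (intro conjI exI[of _ 1] allI)
  fix z :: "nat \<Rightarrow> real"
  have "\<bar>z k\<bar> \<le> abs_sum D z" using assms by (intro member_le_sum) auto
  also have "\<dots> \<le> 1 * exp (1 * abs_sum D z)"
    by (simp, rule order_trans[OF _ exp_ge_add_one_self]) simp
  finally show "\<bar>z k\<bar> \<le> 1 * exp (1 * abs_sum D z)" .
qed auto

lemma tame_mult:
  assumes "tame D g" "tame D h"
  shows "tame D (\<lambda>z. g z * h z)"
proof -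
  obtain C1 c1 where 1: "0 \<le> C1" "0 \<le> c1" "\<And>z. \<bar>g z\<bar> \<le> C1 * exp (c1 * abs_sum D z)"
    using assms(1) by (auto simp: tame_def)
  obtain C2 c2 where 2: "0 \<le> C2" "0 \<le> c2" "\<And>z. \<bar>h z\<bar> \<le> C2 * exp (c2 * abs_sum D z)"
    using assms(2) by (auto simp: tame_def)
  have "\<bar>g z * h z\<bar> \<le> C1 * C2 * exp ((c1 + c2) * abs_sum D z)" for z
  proof -
    have "\<bar>g z * h z\<bar> \<le> (C1 * exp (c1 * abs_sum D z)) * (C2 * exp (c2 * abs_sum D z))"
      unfolding abs_mult using 1 2 by (intro mult_mono) auto
    then show ?thesis by (simp add: ring_distribs exp_add mult_ac)
  qed
  moreover have "0 \<le> C1 * C2" "0 \<le> c1 + c2" using 1 2 by auto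
  ultimately show ?thesis
    using assms unfolding tame_def by (blast intro: continuous_on_mult)
qed

lemma tame_add:
  assumes "tame D g" "tame D h"
  shows "tame D (\<lambda>z. g z + h z)"
proof -
  obtain C1 c1 where 1: "0 \<le> C1" "0 \<le> c1" "\<And>z. \<bar>g z\<bar> \<le> C1 * exp (c1 * abs_sum D z)"
    using assms(1) by (auto simp: tame_def)
  obtain C2 c2 where 2: "0 \<le> C2" "0 \<le> c2" "\<And>z. \<bar>h z\<bar> \<le> C2 * exp (c2 * abs_sum D z)"
    using assms(2) by (auto simp: tame_def)
  have "\<bar>g z + h z\<bar> \<le> (C1 + C2) * exp (max c1 c2 * abs_sum D z)" for z
  proof -
    have s: "0 \<le> abs_sum D z" by (intro sum_nonneg) auto
    have "\<bar>g z + h z\<bar> \<le> C1 * exp (c1 * abs_sum D z) + C2 * exp (c2 * abs_sum D z)"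
      using 1(3)[of z] 2(3)[of z] by linarith
    also have "\<dots> \<le> C1 * exp (max c1 c2 * abs_sum D z) + C2 * exp (max c1 c2 * abs_sum D z)"
      using 1 2 s by (intro add_mono exp_bound_mono) auto
    finally show ?thesis by (simp add: ring_distribs)
  qed
  moreover have "0 \<le> C1 + C2" "0 \<le> max c1 c2" using 1 2 by auto
  ultimately show ?thesis
    using assms unfolding tame_def by (blast intro: continuous_on_add)
qed

lemma measurable_override:
  fixes h :: "(nat \<Rightarrow> real) \<Rightarrow> real"
  assumes h: "continuous_on UNIV h"
  shows "(\<lambda>x. h (override y v x)) \<in> borel_measurable (gauss_measure v)"
proof (rule measurable_continuous_fun[OF h])
  fix k
  show "(\<lambda>x. override y v x k) \<in> borel_measurable (gauss_measure v)"
    using measurable_component_singleton[of k v "\<lambda>_. std_normal"] by (cases "k \<in> v") (auto simp: override_def)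
qed

text \<open>The bound is uniform over base points with \<open>abs_sum D y <= L\<close>, so it serves
  as a majorant when a limit or an integral over the base point is exchanged with the Gaussian
  integral.\<close>

lemma tame_override_bound:
  assumes D: "finite D" "v \<subseteq> D" and "0 \<le> C" "0 \<le> c"
    and h: "\<And>z. \<bar>h z\<bar> \<le> C * exp (c * abs_sum D z)" and y: "abs_sum D y \<le> L"
  shows "\<bar>h (override y v x)\<bar> \<le> C * exp (c * L) * (\<Prod>k\<in>v. weight c (x k))"
proof -
  have v: "finite v" using D finite_subset by auto
  have "abs_sum D (override y v x) \<le> L + abs_sum v x"
    using sum_abs_override[OF D(1) v order_refl, of y x] y by linarith
  then have "c * abs_sum D (override y v x) \<le> c * (L + abs_sum v x)"
    using assms(4) by (rule mult_left_mono)
  have "\<bar>h (override y v x)\<bar> \<le> C * exp (c * (L + abs_sum v x))"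
    by (rule order_trans[OF h]) (use assms \<open>c * _ \<le> _\<close> in \<open>auto intro!: mult_left_mono\<close>)
  also have "\<dots> = C * exp (c * L) * exp (c * abs_sum v x)" by (simp add: ring_distribs exp_add)
  also have "\<dots> \<le> C * exp (c * L) * (\<Prod>k\<in>v. weight c (x k))"
    using assms by (intro mult_left_mono exp_sum_abs_le_prod_weight v) auto
  finally show ?thesis .
qed

lemma integrable_tame_override:
  assumes D: "finite D" "v \<subseteq> D" and h: "tame D h"
  shows "integrable (gauss_measure v) (\<lambda>x. h (override y v x))"
proof -
  obtain C c where C: "0 \<le> C" "0 \<le> c" "\<And>z. \<bar>h z\<bar> \<le> C * exp (c * abs_sum D z)"
    using h by (auto simp: tame_def)
  have v: "finite v" using D finite_subset by auto
  show ?thesis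
  proof (rule Bochner_Integration.integrable_bound)
    show "integrable (gauss_measure v) (\<lambda>x. C * exp (c * abs_sum D y) * (\<Prod>k\<in>v. weight c (x k)))"
      by (intro integrable_mult_right integrable_prod_weight v C)
    show "AE x in gauss_measure v. norm (h (override y v x)) \<le> norm (C * exp (c * abs_sum D y) * (\<Prod>k\<in>v. weight c (x k)))"
      using tame_override_bound[OF D C(1,2) C(3) order_refl]
      by (intro AE_I2) (metis abs_ge_self order_trans real_norm_def)
  qed (use h measurable_override in \<open>auto simp: tame_def\<close>)
qed

text \<open>Stein's identity: the standard normal density satisfies \<open>\<rho>'(x) = - x \<rho>(x)\<close>.\<close>

lemma stein_identity:
  fixes u u' :: "real \<Rightarrow> real"
  assumes u: "\<And>x. (u has_real_derivative u' x) (at x)" and cont: "continuous_on UNIV u'"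
    and c: "0 \<le> c" and bu: "\<And>x. \<bar>u x\<bar> \<le> C * exp (c * \<bar>x\<bar>)" and bu': "\<And>x. \<bar>u' x\<bar> \<le> C * exp (c * \<bar>x\<bar>)"
  shows "(LINT x|std_normal. u' x - x * u x) = 0"
proof -
  have contu: "continuous_on UNIV u" using u by (meson DERIV_continuous_on continuous_on_subset has_field_derivative_at_within)
  have C: "0 \<le> C" using bu[of 0] by simp
  define F where "F x = std_normal_density x * u x" for x
  define f where "f x = std_normal_density x * (u' x - x * u x)" for x
  have F: "(F has_real_derivative f x) (at x)" for x
  proof -
    have "(std_normal_density has_real_derivative - x * std_normal_density x) (at x)"
    proof -
      have "((\<lambda>x. exp (- x\<^sup>2 / 2)) has_real_derivative exp (- x\<^sup>2 / 2) * (- x)) (at x)"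
        by (auto intro!: derivative_eq_intros)
      from DERIV_cmult[OF this, of "1 / sqrt (2 * pi)"] show ?thesis
        unfolding std_normal_density_def by (simp add: mult_ac)
    qed
    then show ?thesis unfolding F_def[abs_def] f_def by (auto intro!: derivative_eq_intros u simp: algebra_simps)
  qed
  have contf: "continuous_on UNIV f"
    unfolding f_def std_normal_density_def by (intro continuous_intros cont contu) auto
  have um: "(\<lambda>x. u' x - x * u x) \<in> borel_measurable borel"
    by (intro borel_measurable_continuous_onI continuous_intros cont contu)
  have int: "integrable std_normal (\<lambda>x. u' x - x * u x)"
  proof (rule Bochner_Integration.integrable_bound)
    show "integrable std_normal (\<lambda>x. (C + C) * weight (c + 1) x)"
      by (intro integrable_mult_right integrable_weight) (use c in auto)
    show "AE x in std_normal. norm (u' x - x * u x) \<le> norm ((C + C) * weight (c + 1) x)"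
    proof (rule AE_I2)
      fix x :: real
      have x: "\<bar>x\<bar> \<le> exp \<bar>x\<bar>" using exp_ge_add_one_self[of "\<bar>x\<bar>"] by linarith
      have "\<bar>u' x - x * u x\<bar> \<le> C * exp (c * \<bar>x\<bar>) + exp \<bar>x\<bar> * (C * exp (c * \<bar>x\<bar>))"
        by (rule order_trans[OF abs_triangle_ineq4], rule add_mono[OF bu'], unfold abs_mult, rule mult_mono[OF x bu]) auto
      also have "\<dots> \<le> exp \<bar>x\<bar> * (C * exp (c * \<bar>x\<bar>)) + exp \<bar>x\<bar> * (C * exp (c * \<bar>x\<bar>))"
        using mult_right_mono[of 1 "exp \<bar>x\<bar>" "C * exp (c * \<bar>x\<bar>)"] C by (simp add: mult.left_commute)
      also have "\<dots> = (C + C) * exp ((c + 1) * \<bar>x\<bar>)" by (simp add: ring_distribs exp_add mult_ac)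
      also have "\<dots> \<le> (C + C) * weight (c + 1) x" using C by (intro mult_left_mono weight_ge_exp) auto
      finally show "norm (u' x - x * u x) \<le> norm ((C + C) * weight (c + 1) x)" by simp
    qed
  qed (use um in simp)
  have fint: "integrable lborel f" using int um by (simp add: integrable_std_normal_iff f_def[abs_def])
  \<comment> \<open>\<open>f\<close> is the derivative of \<open>F\<close>, so the integral over
    \<open>[-n, n]\<close> is a boundary term, which vanishes in the limit by the decay of the
    density.\<close>
  have "(\<lambda>n. LINT x|lborel. indicator {- real n..real n} x * f x) \<longlonglongrightarrow> (LINT x|lborel. f x)"
  proof (rule integral_dominated_convergence)
    show "integrable lborel (\<lambda>x. norm (f x))" using fint by simp
    show "AE x in lborel. (\<lambda>n. indicator {- real n..real n} x * f x) \<longlonglongrightarrow> f x"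
    proof (rule AE_I2)
      fix x :: real
      obtain N where N: "\<bar>x\<bar> \<le> real N" using real_arch_simple by auto
      have "eventually (\<lambda>n. indicator {- real n..real n} x * f x = f x) sequentially"
        using eventually_ge_at_top[of N] by eventually_elim (use N in \<open>auto simp: indicator_def\<close>)
      then show "(\<lambda>n. indicator {- real n..real n} x * f x) \<longlonglongrightarrow> f x" by (rule tendsto_eventually)
    qed
  qed (use fint in \<open>auto simp: indicator_def\<close>)
  moreover have "(LINT x|lborel. indicator {- real n..real n} x * f x) = F (real n) - F (- real n)" for n
    using integral_FTC_atLeastAtMost[of "- real n" "real n" F f] F contf
    by (auto simp: has_real_derivative_iff_has_vector_derivative intro: has_vector_derivative_at_within continuous_on_subset)
  moreover have "(\<lambda>n. F (real n) - F (- real n)) \<longlonglongrightarrow> 0"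
  proof (rule Lim_null_comparison)
    \<comment> \<open>By \<open>0 <= (c - |x| / 2)^2\<close>, the exponential growth costs half of
      the exponent of the density and a constant \<open>exp (c^2)\<close>.\<close>
    have Fb: "\<bar>F x\<bar> \<le> C * exp (c\<^sup>2) * exp (- (x\<^sup>2 / 4))" for x
    proof -
      have "\<bar>F x\<bar> \<le> exp (- x\<^sup>2 / 2) * (C * exp (c * \<bar>x\<bar>))"
        unfolding F_def abs_mult
      proof (intro mult_mono bu)
        have "1 \<le> sqrt (2 * pi)" using pi_gt3 by (simp add: real_le_rsqrt)
        then show "\<bar>std_normal_density x\<bar> \<le> exp (- x\<^sup>2 / 2)"
          by (simp add: std_normal_density_def divide_le_eq)
      qed auto
      also have "\<dots> = C * exp (c * \<bar>x\<bar> - x\<^sup>2 / 2)" by (simp add: mult_exp_exp mult.left_commute)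
      also have "\<dots> \<le> C * exp (c\<^sup>2 - x\<^sup>2 / 4)"
      proof -
        have "0 \<le> (c - \<bar>x\<bar> / 2)\<^sup>2" by simp
        also have "\<dots> = c\<^sup>2 - c * \<bar>x\<bar> + x\<^sup>2 / 4" by (simp add: power2_eq_square field_simps)
        finally show ?thesis using C by (intro mult_left_mono) auto
      qed
      also have "\<dots> = C * exp (c\<^sup>2) * exp (- (x\<^sup>2 / 4))" by (simp add: mult_exp_exp mult.assoc)
      finally show ?thesis .
    qed
    show "eventually (\<lambda>n. norm (F (real n) - F (- real n)) \<le> 2 * (C * exp (c\<^sup>2)) * exp (- (1 / 4)) ^ n) sequentially"
      using eventually_ge_at_top[of 1]
    proof eventually_elim
      case (elim n)
      have "real n \<le> (real n)\<^sup>2" using elim by (simp add: power2_eq_square)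
      then have "exp (- ((real n)\<^sup>2 / 4)) \<le> exp (real n * (- (1 / 4)))" by simp
      also have "\<dots> = exp (- (1 / 4)) ^ n" by (rule exp_of_nat_mult)
      finally have "C * exp (c\<^sup>2) * exp (- ((real n)\<^sup>2 / 4)) \<le> C * exp (c\<^sup>2) * exp (- (1 / 4)) ^ n"
        using C by (intro mult_left_mono) auto
      then show ?case using Fb[of "real n"] Fb[of "- real n"] by simp
    qed
    have "(\<lambda>n. exp (- (1 / 4)) ^ n) \<longlonglongrightarrow> (0::real)" by (rule LIMSEQ_power_zero) simp
    then show "(\<lambda>n. 2 * (C * exp (c\<^sup>2)) * exp (- (1 / 4)) ^ n) \<longlonglongrightarrow> 0"
      using tendsto_mult_right_zero by blast
  qed
  ultimately have "(LINT x|lborel. f x) = 0" using LIMSEQ_unique by fastforce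
  then show ?thesis using um by (simp add: integral_std_normal f_def)
qed

text \<open>Since \<open>j\<close> is an integrated coordinate, Fubini's theorem with
  \<open>j\<close> innermost reduces this to the one-dimensional identity along each line in
  direction \<open>j\<close>.\<close>

lemma stein_identity_coordinate:
  assumes D: "finite D" "v \<subseteq> D" and j: "j \<in> v" and U: "tame D U" "tame D U'" "has_partial j U U'"
  shows "(LINT x|gauss_measure v. U' (override y v x) - override y v x j * U (override y v x)) = 0"
proof -
  let ?E = "\<lambda>z. U' z + (-1) * (z j * U z)"
  have tE: "tame D ?E" using D j U by (intro tame_add tame_mult tame_const tame_coord) auto
  obtain C1 c1 where 1: "0 \<le> C1" "0 \<le> c1" "\<And>z. \<bar>U z\<bar> \<le> C1 * exp (c1 * abs_sum D z)"
    using U(1) by (auto simp: tame_def)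
  obtain C2 c2 where 2: "0 \<le> C2" "0 \<le> c2" "\<And>z. \<bar>U' z\<bar> \<le> C2 * exp (c2 * abs_sum D z)"
    using U(2) by (auto simp: tame_def)
  have v: "finite (v - {j})" "j \<notin> v - {j}" "insert j (v - {j}) = v" using D j finite_subset by auto
  have inner: "(LINT t|std_normal. ?E (z(j := t))) = 0" for z
  proof -
    define L where "L = abs_sum D z"
    have updL: "abs_sum D (z(j := t)) \<le> L + \<bar>t\<bar>" for t
      unfolding L_def by (rule sum_abs_fun_upd[OF D(1)])
    have b: "\<bar>h (z(j := t))\<bar> \<le> (C1 * exp (max c1 c2 * L) + C2 * exp (max c1 c2 * L)) * exp (max c1 c2 * \<bar>t\<bar>)"
      if "\<And>z. \<bar>h z\<bar> \<le> C' * exp (c' * abs_sum D z)" "C' = C1 \<and> c' = c1 \<or> C' = C2 \<and> c' = c2" for h t C' c'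
    proof -
      have "\<bar>h (z(j := t))\<bar> \<le> C' * exp (c' * abs_sum D (z(j := t)))" by (rule that(1))
      also have "\<dots> \<le> C' * exp (max c1 c2 * abs_sum D (z(j := t)))"
        using that(2) 1 2 by (intro exp_bound_mono sum_nonneg) auto
      also have "\<dots> \<le> C' * exp (max c1 c2 * (L + \<bar>t\<bar>))"
        using that(2) 1 2 updL[of t] by (intro mult_left_mono) (auto intro!: mult_left_mono)
      also have "\<dots> = C' * exp (max c1 c2 * L) * exp (max c1 c2 * \<bar>t\<bar>)" by (simp add: ring_distribs exp_add)
      also have "\<dots> \<le> (C1 * exp (max c1 c2 * L) + C2 * exp (max c1 c2 * L)) * exp (max c1 c2 * \<bar>t\<bar>)"
        using that(2) 1 2 by (intro mult_right_mono) auto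
      finally show ?thesis .
    qed
    have "(LINT t|std_normal. U' (z(j := t)) - t * U (z(j := t))) = 0"
    proof (rule stein_identity[where c = "max c1 c2" and C = "C1 * exp (max c1 c2 * L) + C2 * exp (max c1 c2 * L)"])
      show "((\<lambda>t. U (z(j := t))) has_real_derivative U' (z(j := t))) (at t)" for t
        by (rule has_partialD[OF U(3)])
      have "continuous_on UNIV U'" using U(2) by (simp add: tame_def)
      then show "continuous_on UNIV (\<lambda>t. U' (z(j := t)))"
        by (rule continuous_on_compose2[OF _ continuous_on_fun_upd]) auto
      show "\<bar>U (z(j := t))\<bar> \<le> (C1 * exp (max c1 c2 * L) + C2 * exp (max c1 c2 * L)) * exp (max c1 c2 * \<bar>t\<bar>)" for t
        by (rule b[OF 1(3)]) simp
      show "\<bar>U' (z(j := t))\<bar> \<le> (C1 * exp (max c1 c2 * L) + C2 * exp (max c1 c2 * L)) * exp (max c1 c2 * \<bar>t\<bar>)" for t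
        by (rule b[OF 2(3)]) simp
    qed (use 1 2 in auto)
    then show ?thesis by simp
  qed
  have "(LINT x|gauss_measure v. ?E (override y v x)) = 0"
  proof -
    have "(LINT x|gauss_measure (insert j (v - {j})). ?E (override y v x)) =
        (LINT x|gauss_measure (v - {j}). LINT t|std_normal. ?E (override y v (x(j := t))))"
      by (rule gauss.product_integral_insert[OF v(1,2)]) (use integrable_tame_override[OF D tE] v in simp)
    also have "\<dots> = (LINT x|gauss_measure (v - {j}). LINT t|std_normal. ?E ((override y v x)(j := t)))"
    proof -
      have "override y v (x(j := t)) = (override y v x)(j := t)" for x t
        using j by (auto simp: override_def fun_eq_iff)
      then show ?thesis by (simp only:)
    qed
    finally show ?thesis unfolding inner v(3) by simp
  qed
  then show ?thesis by simp
qed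

text \<open>An identity between increments survives pointwise limits under domination, while
  derivatives need not; the derivative is recovered at the end from the continuity of the limit
  integrand.\<close>

lemma derivative_from_increments:
  fixes f g :: "real \<Rightarrow> real"
  assumes g: "continuous_on UNIV g"
    and inc: "\<And>a b. a \<le> b \<Longrightarrow> f b - f a = (LINT s|lborel. indicator {a..b} s * g s)"
  shows "(f has_real_derivative g t) (at t)"
proof -
  have cont: "continuous_on {a..b} g" for a b using g continuous_on_subset by blast
  have f: "f x = f (t - 1) + integral {t - 1..x} g" if "t - 1 \<le> x" for x
  proof -
    have "set_integrable lborel {t - 1..x} g" by (rule borel_integrable_atLeastAtMost'[OF cont])
    then have "(LINT s|lborel. indicator {t - 1..x} s * g s) = integral {t - 1..x} g"
      using set_borel_integral_eq_integral(2)[of "{t - 1..x}" g] by (simp add: set_lebesgue_integral_def)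
    then show ?thesis using inc[OF that] by simp
  qed
  have "((\<lambda>x. integral {t - 1..x} g) has_real_derivative g t) (at t within {t - 1..t + 1})"
    by (rule integral_has_real_derivative[OF cont]) auto
  then have "((\<lambda>x. integral {t - 1..x} g) has_real_derivative g t) (at t)"
    by (simp add: at_within_Icc_at)
  then have "((\<lambda>x. f (t - 1) + integral {t - 1..x} g) has_real_derivative g t) (at t)"
    using DERIV_add[OF DERIV_const] by fastforce
  then show ?thesis
  proof (rule has_field_derivative_transform_within_open[where S = "{t - 1<..<t + 1}"])
    show "f (t - 1) + integral {t - 1..x} g = f x" if "x \<in> {t - 1<..<t + 1}" for x
      by (rule f[symmetric]) (use that in simp)
  qed auto
qed

lemma continuous_on_override: "continuous_on UNIV (\<lambda>y. override y v x)"
proof (rule continuous_on_coordinatewise_then_product)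
  show "continuous_on UNIV (\<lambda>y. override y v x i)" for i
    by (cases "i \<in> v") (auto simp: override_def)
qed

text \<open>Connects \<open>projection\<close>, which integrates a density against Lebesgue measure,
  with integrals over \<open>gauss_measure\<close>; both measures agree on boxes.\<close>

lemma gauss_measure_density:
  assumes "finite v"
  shows "gauss_measure v = density (PiM v (\<lambda>_. lborel)) (\<lambda>x. ennreal (\<Prod>i\<in>v. std_normal_density (x i)))"
proof (rule gauss.PiM_eqI[symmetric, OF assms])
  interpret L: product_sigma_finite "\<lambda>_::nat. lborel :: real measure" by standard
  let ?P = "PiM v (\<lambda>_. lborel :: real measure)"
  have meas: "(\<lambda>x. ennreal (\<Prod>i\<in>v. std_normal_density (x i))) \<in> borel_measurable ?P"
    by measurable
  show "sets (density ?P (\<lambda>x. ennreal (\<Prod>i\<in>v. std_normal_density (x i)))) = sets (gauss_measure v)"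
    by (auto intro!: sets_PiM_cong)
  fix B :: "nat \<Rightarrow> real set" assume B: "\<And>i. i \<in> v \<Longrightarrow> B i \<in> sets std_normal"
  have "emeasure (density ?P (\<lambda>x. ennreal (\<Prod>i\<in>v. std_normal_density (x i)))) (Pi\<^sub>E v B) =
      (\<integral>\<^sup>+x. ennreal (\<Prod>i\<in>v. std_normal_density (x i)) * indicator (Pi\<^sub>E v B) x \<partial>?P)"
    using meas B assms by (intro emeasure_density sets_PiM_I_finite) auto
  also have "\<dots> = (\<integral>\<^sup>+x. (\<Prod>i\<in>v. ennreal (std_normal_density (x i)) * indicator (B i) (x i)) \<partial>?P)"
  proof (rule nn_integral_cong)
    fix x assume x: "x \<in> space ?P"
    have "indicator (Pi\<^sub>E v B) x = (\<Prod>i\<in>v. indicator (B i) (x i) :: ennreal)"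
    proof (cases "\<forall>i\<in>v. x i \<in> B i")
      case True
      then show ?thesis using x by (auto simp: space_PiM PiE_iff)
    next
      case False
      then obtain i where i: "i \<in> v" "x i \<notin> B i" by blast
      then have "x \<notin> Pi\<^sub>E v B" by auto
      moreover have "(\<Prod>i\<in>v. indicator (B i) (x i) :: ennreal) = 0"
        by (rule prod_zero[OF assms], rule bexI[of _ i]) (use i in auto)
      ultimately show ?thesis by simp
    qed
    then show "ennreal (\<Prod>i\<in>v. std_normal_density (x i)) * indicator (Pi\<^sub>E v B) x =
        (\<Prod>i\<in>v. ennreal (std_normal_density (x i)) * indicator (B i) (x i))"
      by (simp add: prod.distrib prod_ennreal)
  qed
  also have "\<dots> = (\<Prod>i\<in>v. \<integral>\<^sup>+x. ennreal (std_normal_density x) * indicator (B i) x \<partial>lborel)"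
    using B assms by (intro L.product_nn_integral_prod) auto
  also have "\<dots> = (\<Prod>i\<in>v. emeasure std_normal (B i))"
    using B by (intro prod.cong refl) (subst emeasure_density, auto)
  finally show "emeasure (density ?P (\<lambda>x. ennreal (\<Prod>i\<in>v. std_normal_density (x i)))) (Pi\<^sub>E v B) =
      (\<Prod>i\<in>v. emeasure std_normal (B i))" .
qed

text \<open>On the carrier of the product topology over \<open>J\<close> every coordinate outside
  \<open>J\<close> is the constant \<open>undefined\<close>, so the inclusion into the full product
  is continuous.\<close>

lemma continuous_map_product_of_continuous_on:
  fixes h :: "(nat \<Rightarrow> real) \<Rightarrow> real"
  assumes "continuous_on UNIV h"
  shows "continuous_map (product_topology (\<lambda>_. euclideanreal) J) euclideanreal h"
proof -
  have "continuous_map (product_topology (\<lambda>_. euclideanreal) J) (product_topology (\<lambda>_. euclideanreal) UNIV) (\<lambda>x. x)"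
  proof (subst continuous_map_componentwise_UNIV, rule allI)
    fix k
    show "continuous_map (product_topology (\<lambda>_. euclideanreal) J) euclideanreal (\<lambda>x. x k)"
    proof (cases "k \<in> J")
      case False
      show ?thesis
        by (rule continuous_map_eq[where f = "\<lambda>_. undefined"])
          (use False in \<open>auto simp: PiE_def extensional_def\<close>)
    qed (use continuous_map_product_projection[of k J "\<lambda>_. euclideanreal"] in simp)
  qed
  moreover have "continuous_map euclidean euclideanreal h" using assms by simp
  ultimately have "continuous_map (product_topology (\<lambda>_. euclideanreal) J) euclideanreal (h \<circ> (\<lambda>x. x))"
    by (intro continuous_map_compose) (auto simp: euclidean_product_topology)
  then show ?thesis by (simp add: o_def)
qed

lemma smooth_class_smooth_on_coords:
  assumes P: "smooth_class D P" and "h \<in> P"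
  shows "smooth_on_coords J h"
  unfolding smooth_on_coords_def
proof
  fix n
  show "Ck_on_coords n J h"
    using \<open>h \<in> P\<close>
  proof (induction n arbitrary: h)
    case 0
    then show ?case using P by (auto simp: smooth_class_def tame_def intro: continuous_map_product_of_continuous_on)
  next
    case (Suc n)
    have "\<exists>h'\<in>P. \<forall>z. ((\<lambda>s. h (z(k := s))) has_real_derivative h' z) (at (z k))" for k
      using P Suc.prems by (simp add: smooth_class_def has_partial_def)
    then have "\<exists>h'. (\<forall>x\<in>PiE J (\<lambda>_. UNIV). ((\<lambda>s. h (x(k := s))) has_real_derivative h' x) (at (x k))) \<and> Ck_on_coords n J h'" for k
      using Suc.IH by blast
    moreover have "continuous_on UNIV h" using P Suc.prems by (simp add: smooth_class_def tame_def)
    ultimately show ?case by (auto intro: continuous_map_product_of_continuous_on)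
  qed
qed

text \<open>By Bessel's inequality the columns have norm at most 1, and equality follows by comparing the
  sums of all squared entries.\<close>

lemma orthonormal_rows_column:
  fixes B :: "nat \<Rightarrow> nat \<Rightarrow> real"
  assumes fin: "finite I" and orth: "\<And>i k. i \<in> I \<Longrightarrow> k \<in> I \<Longrightarrow> (\<Sum>l\<in>I. B i l * B k l) = of_bool (i = k)"
    and j: "j \<in> I"
  shows "(\<Sum>i\<in>I. (B i j)\<^sup>2) = 1"
proof -
  have bessel: "(\<Sum>i\<in>I. (B i j)\<^sup>2) \<le> 1" if j: "j \<in> I" for j
  proof -
    \<comment> \<open>The orthogonal projection of unit vector number \<open>j\<close> onto the span
      of the rows; the squared norm of the difference is nonnegative.\<close>
    define c where "c l = (\<Sum>i\<in>I. B i j * B i l)" for l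
    have cross: "c j = (\<Sum>i\<in>I. (B i j)\<^sup>2)" by (simp add: c_def power2_eq_square)
    have "(\<Sum>l\<in>I. (c l)\<^sup>2) = (\<Sum>l\<in>I. \<Sum>i\<in>I. \<Sum>k\<in>I. B i j * B k j * (B i l * B k l))"
      by (simp add: c_def power2_eq_square sum_product mult_ac)
    also have "\<dots> = (\<Sum>i\<in>I. \<Sum>k\<in>I. \<Sum>l\<in>I. B i j * B k j * (B i l * B k l))"
      by (subst sum.swap, rule sum.cong[OF refl], subst sum.swap, rule refl)
    also have "\<dots> = (\<Sum>i\<in>I. \<Sum>k\<in>I. B i j * B k j * of_bool (i = k))"
      by (intro sum.cong refl) (simp add: sum_distrib_left[symmetric] orth)
    also have "\<dots> = (\<Sum>i\<in>I. (B i j)\<^sup>2)"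
      using fin by (simp add: power2_eq_square of_bool_def if_distrib cong: if_cong)
    finally have sq: "(\<Sum>l\<in>I. (c l)\<^sup>2) = (\<Sum>i\<in>I. (B i j)\<^sup>2)" .
    have "0 \<le> (\<Sum>l\<in>I. (of_bool (l = j) - c l)\<^sup>2)" by (intro sum_nonneg) simp
    also have "\<dots> = (\<Sum>l\<in>I. of_bool (l = j) - 2 * (of_bool (l = j) * c l) + (c l)\<^sup>2)"
      by (intro sum.cong refl) (auto simp: of_bool_def power2_eq_square algebra_simps)
    also have "\<dots> = (\<Sum>l\<in>I. of_bool (l = j)) - 2 * (\<Sum>l\<in>I. of_bool (l = j) * c l) + (\<Sum>l\<in>I. (c l)\<^sup>2)"
      by (simp only: sum.distrib sum_subtractf sum_distrib_left)
    also have "(\<Sum>l\<in>I. of_bool (l = j) :: real) = 1" using fin j by (simp add: of_bool_def)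
    also have "(\<Sum>l\<in>I. of_bool (l = j) * c l) = (\<Sum>l\<in>I. if l = j then c l else 0)"
      by (rule sum.cong) auto
    also have "\<dots> = c j" using fin j by simp
    finally show ?thesis using sq cross by simp
  qed
  have "(\<Sum>j\<in>I. \<Sum>i\<in>I. (B i j)\<^sup>2) = (\<Sum>i\<in>I. \<Sum>j\<in>I. (B i j)\<^sup>2)" by (rule sum.swap)
  also have "\<dots> = (\<Sum>i\<in>I. 1)" using orth by (intro sum.cong) (auto simp: power2_eq_square)
  finally have "(\<Sum>j\<in>I. 1 - (\<Sum>i\<in>I. (B i j)\<^sup>2)) = 0" by (simp add: sum_subtractf)
  then have "1 - (\<Sum>i\<in>I. (B i j)\<^sup>2) = 0"
    using bessel fin j by (subst (asm) sum_nonneg_eq_0_iff) auto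
  then show ?thesis by simp
qed

text \<open>The increments of consecutive rows of the generating matrix are orthogonal with squared norm
  \<open>T / d\<close>.\<close>

lemma generating_matrix_column_nonzero:
  assumes gm: "generating_matrix d T A" and T: "0 < T" and j: "j \<in> {1..d}"
  shows "\<exists>i\<in>{1..d}. A i j \<noteq> 0"
proof (rule ccontr)
  assume "\<not> ?thesis"
  then have zero: "\<And>i. i \<in> {1..d} \<Longrightarrow> A i j = 0" by blast
  have d: "0 < d" using j by auto
  \<comment> \<open>A row 0 of zeros is added, corresponding to time 0, so that the first row is an
    increment too.\<close>
  define A' where "A' i l = (if i = 0 then 0 else A i l)" for i l
  define \<delta> where "\<delta> = T / real d"
  have \<delta>: "0 < \<delta>" using T d by (simp add: \<delta>_def)
  have A': "(\<Sum>l=1..d. A' i l * A' k l) = \<delta> * real (min i k)" if "i \<le> d" "k \<le> d" for i k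
    using gm that by (cases "i = 0 \<or> k = 0") (auto simp: A'_def generating_matrix_def \<delta>_def)
  \<comment> \<open>Normalised increments of the rows, which are orthonormal. A zero column of
    \<open>A\<close> would give a zero column of \<open>B\<close>, against the column norm
    1.\<close>
  define B where "B i l = (A' i l - A' (i - 1) l) / sqrt \<delta>" for i l
  have "(\<Sum>l\<in>{1..d}. B i l * B k l) = of_bool (i = k)" if i: "i \<in> {1..d}" "k \<in> {1..d}" for i k
  proof -
    have "(\<Sum>l\<in>{1..d}. B i l * B k l) = ((\<Sum>l=1..d. A' i l * A' k l) - (\<Sum>l=1..d. A' i l * A' (k - 1) l)
        - (\<Sum>l=1..d. A' (i - 1) l * A' k l) + (\<Sum>l=1..d. A' (i - 1) l * A' (k - 1) l)) / \<delta>"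
      unfolding sum_subtractf[symmetric] sum.distrib[symmetric] sum_divide_distrib
    proof (rule sum.cong[OF refl])
      fix l
      have "sqrt \<delta> * sqrt \<delta> = \<delta>" using \<delta> by simp
      then show "B i l * B k l = (A' i l * A' k l - A' i l * A' (k - 1) l - A' (i - 1) l * A' k l + A' (i - 1) l * A' (k - 1) l) / \<delta>"
        by (simp add: B_def algebra_simps)
    qed
    also have "\<dots> = real (min i k) - real (min i (k - 1)) - real (min (i - 1) k) + real (min (i - 1) (k - 1))"
    proof -
      have idx: "i \<le> d" "k \<le> d" "i - 1 \<le> d" "k - 1 \<le> d" using i by auto
      show ?thesis
        unfolding A'[OF idx(1,2)] A'[OF idx(1,4)] A'[OF idx(3,2)] A'[OF idx(3,4)]
        using \<delta> by (simp add: field_simps)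
    qed
    also have "\<dots> = of_bool (i = k)"
    proof -
      obtain i' k' where "i = Suc i'" "k = Suc k'" using i by (cases i; cases k) auto
      then show ?thesis by (cases i' k' rule: linorder_cases) (auto simp: min_def)
    qed
    finally show ?thesis .
  qed
  then have "(\<Sum>i\<in>{1..d}. (B i j)\<^sup>2) = 1" by (intro orthonormal_rows_column j) auto
  moreover have B0: "B i j = 0" if "i \<in> {1..d}" for i
  proof -
    have "i - 1 = 0 \<or> i - 1 \<in> {1..d}" using that by auto
    then have "A' (i - 1) j = 0" using zero by (auto simp only: A'_def split: if_splits)
    moreover have "A' i j = 0" using zero[OF that] by (simp add: A'_def)
    ultimately show ?thesis by (simp add: B_def)
  qed
  have "(\<Sum>i\<in>{1..d}. (B i j)\<^sup>2) = 0" by (rule sum.neutral) (simp add: B0)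
  ultimately show False by linarith
qed

section \<open>Derivatives of smoothed Asian payoffs\<close>

locale asian =
  fixes S0 K T \<sigma> \<mu> :: real and d :: nat and A :: "nat \<Rightarrow> nat \<Rightarrow> real" and j :: nat
  assumes pos: "0 < S0" "0 < \<sigma>" "0 < T" and gm: "generating_matrix d T A"
    and j: "j \<in> {1..d}" and sgn: "one_signed_column d A j"
begin

declare One_nat_def [simp del]

abbreviation S where "S \<equiv> asset_price S0 T \<sigma> \<mu> d A"
abbreviation SA where "SA \<equiv> average_price S0 T \<sigma> \<mu> d A"
abbreviation D where "D \<equiv> {1..d}"

text \<open>Zero for \<open>k\<close> outside \<open>D\<close>, so that partial derivatives exist
  with respect to every natural number, as \<open>smooth_class\<close> demands.\<close>

definition dSA :: "nat \<Rightarrow> (nat \<Rightarrow> real) \<Rightarrow> real" where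
  "dSA k z = (1 / real d) * (\<Sum>i=1..d. (\<sigma> * (if k \<in> D then A i k else 0)) * S i z)"

text \<open>Contains everything that differentiation and integration by parts produce. Only the
  reciprocal of the derivative in direction \<open>j\<close> is adjoined; its partial derivatives
  are its square times linear combinations of prices.\<close>

inductive_set smooth_alg :: "((nat \<Rightarrow> real) \<Rightarrow> real) set" where
  const: "(\<lambda>_. c) \<in> smooth_alg"
| coord: "k \<in> D \<Longrightarrow> (\<lambda>z. z k) \<in> smooth_alg"
| price: "S i \<in> smooth_alg"
| recip: "(\<lambda>z. inverse (dSA j z)) \<in> smooth_alg"
| add: "g \<in> smooth_alg \<Longrightarrow> h \<in> smooth_alg \<Longrightarrow> (\<lambda>z. g z + h z) \<in> smooth_alg"
| mult: "g \<in> smooth_alg \<Longrightarrow> h \<in> smooth_alg \<Longrightarrow> (\<lambda>z. g z * h z) \<in> smooth_alg"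

lemma alg_sum: "finite I \<Longrightarrow> (\<And>i. i \<in> I \<Longrightarrow> g i \<in> smooth_alg) \<Longrightarrow> (\<lambda>z. \<Sum>i\<in>I. g i z) \<in> smooth_alg"
  by (induction I rule: finite_induct) (auto intro: smooth_alg.intros)

lemma alg_cmult: "g \<in> smooth_alg \<Longrightarrow> (\<lambda>z. c * g z) \<in> smooth_alg"
  by (intro smooth_alg.mult smooth_alg.const)

lemma alg_diff: "g \<in> smooth_alg \<Longrightarrow> h \<in> smooth_alg \<Longrightarrow> (\<lambda>z. g z - h z) \<in> smooth_alg"
  using smooth_alg.add[OF _ alg_cmult[of h "-1"], of g] by simp

lemma alg_dSA: "dSA k \<in> smooth_alg"
  unfolding dSA_def by (intro alg_cmult alg_sum smooth_alg.price) simp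

lemma alg_SA: "SA \<in> smooth_alg"
  unfolding average_price_def by (intro alg_cmult alg_sum smooth_alg.price) simp

lemma S_pos: "0 < S i z"
  using pos by (simp add: asset_price_def)

lemma S_local: "(\<And>k. k \<in> D \<Longrightarrow> z k = z' k) \<Longrightarrow> S i z = S i z'"
  by (simp add: asset_price_def)

text \<open>Used where \<open>merge\<close> and \<open>override\<close> disagree, namely outside
  \<open>D\<close>.\<close>

lemma alg_local:
  assumes "g \<in> smooth_alg" "\<And>k. k \<in> D \<Longrightarrow> z k = z' k"
  shows "g z = g z'"
  using assms(1)
proof induction
  case recip
  have "S i z = S i z'" for i by (rule S_local[OF assms(2)])
  then show ?case by (simp add: dSA_def)
next
  case (price i)
  show ?case by (rule S_local[OF assms(2)])
qed (simp_all add: assms(2))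

lemma S_partial: "has_partial k (S i) (\<lambda>z. (\<sigma> * (if k \<in> D then A i k else 0)) * S i z)"
  unfolding has_partial_def
proof
  fix z :: "nat \<Rightarrow> real"
  define rest where "rest = (\<Sum>l\<in>D - {k}. A i l * z l)"
  define m where "m = (if k \<in> D then A i k else 0)"
  have lin: "(\<Sum>l=1..d. A i l * (z(k := s)) l) = m * s + rest" for s
  proof (cases "k \<in> D")
    case True
    then have "(\<Sum>l=1..d. A i l * (z(k := s)) l) = A i k * s + (\<Sum>l\<in>D - {k}. A i l * (z(k := s)) l)"
      by (simp add: sum.remove[of D k])
    also have "(\<Sum>l\<in>D - {k}. A i l * (z(k := s)) l) = rest"
      unfolding rest_def by (rule sum.cong) auto
    finally show ?thesis using True by (simp add: m_def)
  next
    case False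
    then have "(\<Sum>l=1..d. A i l * (z(k := s)) l) = (\<Sum>l\<in>D. A i l * z l)"
      by (intro sum.cong) auto
    moreover have "D - {k} = D" "m = 0" using False by (auto simp only: m_def if_False)
    ultimately show ?thesis by (simp add: rest_def)
  qed
  have S_eq: "S i (z(k := s)) = S0 * exp ((\<mu> - \<sigma>\<^sup>2 / 2) * real i * (T / real d) + \<sigma> * (m * s + rest))" for s
    unfolding asset_price_def lin ..
  have "S i z = S i (z(k := z k))" by simp
  then have S_eq': "S i z = S0 * exp ((\<mu> - \<sigma>\<^sup>2 / 2) * real i * (T / real d) + \<sigma> * (m * z k + rest))"
    by (simp only: S_eq)
  show "((\<lambda>s. S i (z(k := s))) has_real_derivative (\<sigma> * (if k \<in> D then A i k else 0)) * S i z) (at (z k))"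
    unfolding S_eq S_eq' m_def[symmetric] by (auto intro!: derivative_eq_intros)
qed

lemma SA_partial: "has_partial k SA (dSA k)"
  unfolding has_partial_def average_price_def dSA_def
  using S_partial[unfolded has_partial_def] by (intro allI DERIV_cmult DERIV_sum) auto

text \<open>All terms of the sum for \<open>dSA j\<close> have the same sign, so it dominates any one of them.\<close>

lemma dSA_lower: "\<exists>i\<in>D. \<exists>m>0. \<forall>z. m * S i z \<le> \<bar>dSA j z\<bar>"
proof -
  obtain i where i: "i \<in> D" "A i j \<noteq> 0" using generating_matrix_column_nonzero[OF gm pos(3) j] by auto
  have d: "0 < real d" using j by auto
  have "\<bar>dSA j z\<bar> \<ge> (\<sigma> * \<bar>A i j\<bar> / real d) * S i z" for z
  proof -
    have "\<bar>\<Sum>i=1..d. (\<sigma> * A i j) * S i z\<bar> = (\<Sum>i=1..d. (\<sigma> * \<bar>A i j\<bar>) * S i z)"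
    proof -
      have "(\<Sum>i=1..d. (\<sigma> * \<bar>A i j\<bar>) * S i z) = (\<Sum>i=1..d. (\<sigma> * A i j) * S i z) \<or>
          (\<Sum>i=1..d. (\<sigma> * \<bar>A i j\<bar>) * S i z) = - (\<Sum>i=1..d. (\<sigma> * A i j) * S i z)"
        using sgn unfolding one_signed_column_def sum_negf[symmetric]
        by (elim disjE) (auto intro!: disjI1 disjI2 sum.cong)
      moreover have "0 \<le> (\<Sum>i=1..d. (\<sigma> * \<bar>A i j\<bar>) * S i z)"
        using pos S_pos by (intro sum_nonneg mult_nonneg_nonneg) (auto intro: less_imp_le)
      ultimately show ?thesis by auto
    qed
    moreover have "(\<sigma> * \<bar>A i j\<bar>) * S i z \<le> (\<Sum>i=1..d. (\<sigma> * \<bar>A i j\<bar>) * S i z)"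
      using i pos S_pos by (intro member_le_sum mult_nonneg_nonneg) (auto intro: less_imp_le)
    ultimately show ?thesis using j d by (simp add: dSA_def abs_mult divide_right_mono)
  qed
  moreover have "0 < \<sigma> * \<bar>A i j\<bar> / real d" using pos i d by simp
  ultimately show ?thesis using i(1) by blast
qed

lemma dSA_nonzero: "dSA j z \<noteq> 0"
proof -
  obtain i m where "0 < m" "m * S i z \<le> \<bar>dSA j z\<bar>" using dSA_lower by blast
  then show ?thesis using S_pos[of i z] by (metis abs_zero mult_pos_pos not_le)
qed

lemma S_continuous: "continuous_on UNIV (S i)"
  unfolding asset_price_def by (intro continuous_intros) auto

lemma S_exponent_bound: "\<bar>\<sigma> * (\<Sum>k=1..d. A i k * z k)\<bar> \<le> (\<sigma> * (\<Sum>k=1..d. \<bar>A i k\<bar>)) * abs_sum D z"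
proof -
  have "\<bar>\<Sum>k=1..d. A i k * z k\<bar> \<le> (\<Sum>k=1..d. \<bar>A i k\<bar> * \<bar>z k\<bar>)"
    by (rule order_trans[OF sum_abs]) (simp add: abs_mult)
  also have "\<dots> \<le> (\<Sum>k=1..d. (\<Sum>k=1..d. \<bar>A i k\<bar>) * \<bar>z k\<bar>)"
    by (intro sum_mono mult_right_mono member_le_sum) auto
  also have "\<dots> = (\<Sum>k=1..d. \<bar>A i k\<bar>) * abs_sum D z" by (simp add: sum_distrib_left)
  finally show ?thesis using pos by (simp add: abs_mult mult.assoc)
qed

lemma tame_S: "tame D (S i)"
  unfolding tame_def
proof (intro conjI exI allI)
  show "\<bar>S i z\<bar> \<le> (S0 * exp ((\<mu> - \<sigma>\<^sup>2 / 2) * real i * (T / real d))) * exp ((\<sigma> * (\<Sum>k=1..d. \<bar>A i k\<bar>)) * abs_sum D z)" for z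
    using S_exponent_bound[of i z] pos by (simp add: asset_price_def abs_mult exp_add mult.assoc)
qed (use pos S_continuous in \<open>auto intro!: mult_nonneg_nonneg sum_nonneg\<close>)

text \<open>A multiple of a single price bounds \<open>|dSA j|\<close> from below, and a price is
  the exponential of an affine function, so its reciprocal grows at most exponentially too.\<close>

lemma tame_recip: "tame D (\<lambda>z. inverse (dSA j z))"
proof -
  obtain i m where m: "0 < m" "\<And>z. m * S i z \<le> \<bar>dSA j z\<bar>" using dSA_lower by blast
  define q where "q = S0 * exp ((\<mu> - \<sigma>\<^sup>2 / 2) * real i * (T / real d))"
  have q: "0 < q" using pos by (simp add: q_def)
  have cont: "continuous_on UNIV (\<lambda>z. inverse (dSA j z))"
    unfolding dSA_def by (intro continuous_intros S_continuous) (use dSA_nonzero in \<open>auto simp: dSA_def\<close>)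
  show ?thesis
    unfolding tame_def
  proof (intro conjI exI allI)
    fix z
    let ?r = "(\<sigma> * (\<Sum>k=1..d. \<bar>A i k\<bar>)) * abs_sum D z"
    have "q * exp (- ?r) \<le> q * exp (\<sigma> * (\<Sum>k=1..d. A i k * z k))"
      using S_exponent_bound[of i z] q by (intro mult_left_mono) auto
    also have "\<dots> = S i z" by (simp add: asset_price_def q_def exp_add)
    finally have "m * (q * exp (- ?r)) \<le> \<bar>dSA j z\<bar>" using m(2)[of z] m(1) by (meson less_imp_le mult_left_mono order_trans)
    then have "inverse \<bar>dSA j z\<bar> \<le> inverse (m * (q * exp (- ?r)))"
      using m q by (intro le_imp_inverse_le) auto
    then show "\<bar>inverse (dSA j z)\<bar> \<le> inverse (m * q) * exp ?r"
      using m q by (simp add: exp_minus mult.assoc)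
  qed (use pos m q cont in \<open>auto intro!: mult_nonneg_nonneg sum_nonneg\<close>)
qed

lemma alg_tame: "g \<in> smooth_alg \<Longrightarrow> tame D g"
  by (induction rule: smooth_alg.induct)
    (auto intro: tame_const tame_coord tame_S tame_recip tame_add tame_mult)

lemma alg_partial: "g \<in> smooth_alg \<Longrightarrow> \<exists>g'\<in>smooth_alg. has_partial k g g'"
proof (induction rule: smooth_alg.induct)
  case (const c)
  show ?case by (rule bexI[OF _ smooth_alg.const[of 0]]) (simp add: has_partial_def)
next
  case (coord k')
  show ?case
    by (rule bexI[OF _ smooth_alg.const[of "of_bool (k = k')"]]) (auto simp: has_partial_def)
next
  case (price i)
  show ?case
  proof (rule bexI)
    show "has_partial k (S i) (\<lambda>z. (\<sigma> * (if k \<in> D then A i k else 0)) * S i z)" by (rule S_partial)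
  qed (intro alg_cmult smooth_alg.price)
next
  case recip
  \<comment> \<open>The derivative of \<open>dSA j\<close> in direction \<open>k\<close>, that is, a
    mixed second derivative of \<open>SA\<close>.\<close>
  define E where "E z = (1 / real d) * (\<Sum>i=1..d. (\<sigma> * (if j \<in> D then A i j else 0)) * ((\<sigma> * (if k \<in> D then A i k else 0)) * S i z))" for z
  have E: "E \<in> smooth_alg" unfolding E_def by (intro alg_cmult alg_sum smooth_alg.price) simp
  have dE: "has_partial k (dSA j) E"
    unfolding has_partial_def dSA_def E_def
    using S_partial[unfolded has_partial_def] by (intro allI DERIV_cmult DERIV_sum) auto
  have res: "has_partial k (\<lambda>z. inverse (dSA j z)) (\<lambda>z. (-1) * (inverse (dSA j z) * (E z * inverse (dSA j z))))"
    unfolding has_partial_def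
  proof
    fix z
    have "((\<lambda>s. inverse (dSA j (z(k := s)))) has_real_derivative
        - (inverse (dSA j (z(k := z k))) * E z * inverse (dSA j (z(k := z k))))) (at (z k))"
      by (rule DERIV_inverse') (use dE dSA_nonzero in \<open>auto simp: has_partial_def\<close>)
    then show "((\<lambda>s. inverse (dSA j (z(k := s)))) has_real_derivative
        (-1) * (inverse (dSA j z) * (E z * inverse (dSA j z)))) (at (z k))" by (simp add: mult.assoc)
  qed
  show ?case
    by (rule bexI, rule res) (intro alg_cmult smooth_alg.mult smooth_alg.recip E)
next
  case (add g h)
  then obtain g' h' where gh: "g' \<in> smooth_alg" "has_partial k g g'" "h' \<in> smooth_alg" "has_partial k h h'" by blast
  show ?case by (rule bexI, rule has_partial_add[OF gh(2,4)]) (intro smooth_alg.add gh)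
next
  case (mult g h)
  then obtain g' h' where gh: "g' \<in> smooth_alg" "has_partial k g g'" "h' \<in> smooth_alg" "has_partial k h h'" by blast
  show ?case by (rule bexI, rule has_partial_mult[OF gh(2,4)]) (intro smooth_alg.add smooth_alg.mult gh mult.hyps)
qed

text \<open>The projection of the integrand as an integral over \<open>gauss_measure\<close>, with a
  total argument \<open>y\<close> whose values in \<open>v\<close> are overridden.\<close>

definition smoothed :: "nat set \<Rightarrow> ((nat \<Rightarrow> real) \<Rightarrow> real) \<Rightarrow> (nat \<Rightarrow> real) \<Rightarrow> real" where
  "smoothed v G y = (LINT x|gauss_measure v. of_bool (K \<le> SA (override y v x)) * G (override y v x))"

lemma SA_continuous: "continuous_on UNIV SA"
  using alg_tame[OF alg_SA] by (simp add: tame_def)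

text \<open>By the mean value theorem, equal values at two points would give a zero of
  \<open>dSA j\<close> in between.\<close>

lemma SA_inj: "inj (\<lambda>t. SA (z(j := t)))"
proof -
  have "\<not> SA (z(j := t1)) = SA (z(j := t2))" if "t1 < t2" for t1 t2
  proof -
    have "\<exists>x>t1. x < t2 \<and> SA (z(j := t2)) - SA (z(j := t1)) = (t2 - t1) * dSA j (z(j := x))"
      by (rule MVT2[OF that]) (rule has_partialD[OF SA_partial])
    then show ?thesis using that dSA_nonzero by auto
  qed
  then show ?thesis unfolding inj_def by (metis linorder_neqE)
qed

text \<open>Every line in direction \<open>j\<close> meets the level set in at most one point, which
  has Gaussian measure 0; integrating over \<open>j\<close> first makes the whole level set
  null.\<close>

lemma AE_SA_neq:
  assumes v: "finite v" "j \<in> v"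
  shows "AE x in gauss_measure v. SA (override y v x) \<noteq> K"
proof -
  let ?u = "\<lambda>x. indicator {z. SA z = K} (override y v x) :: ennreal"
  have meas: "?u \<in> borel_measurable (gauss_measure v)"
  proof -
    have "{x \<in> space (gauss_measure v). SA (override y v x) = K} \<in> sets (gauss_measure v)"
      using measurable_override[OF SA_continuous, of y v] by measurable
    then have "indicator {x \<in> space (gauss_measure v). SA (override y v x) = K} \<in> borel_measurable (gauss_measure v)"
      by (rule borel_measurable_indicator)
    then show ?thesis by (subst measurable_cong) (auto simp: indicator_def)
  qed
  have v': "finite (v - {j})" "j \<notin> v - {j}" "insert j (v - {j}) = v" using v by auto
  have inner: "(\<integral>\<^sup>+t. ?u (x(j := t)) \<partial>std_normal) = 0" for x
  proof -
    have upd: "override y v (x(j := t)) = (override y v x)(j := t)" for t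
      using v by (auto simp: override_def fun_eq_iff)
    let ?E = "{t. SA ((override y v x)(j := t)) = K}"
    have null: "?E \<in> null_sets std_normal"
    proof (cases "?E = {}")
      case False
      then obtain t0 where "t0 \<in> ?E" by auto
      then have "?E = {t0}" using SA_inj[of "override y v x"] by (auto dest: injD)
      then show ?thesis by (simp add: null_sets_def std_normal.emeasure_eq_measure std_normal_prob_singleton)
    qed auto
    have "(\<integral>\<^sup>+t. ?u (x(j := t)) \<partial>std_normal) = (\<integral>\<^sup>+t. indicator ?E t \<partial>std_normal)"
      unfolding upd by (rule nn_integral_cong) (simp add: indicator_def)
    also have "\<dots> = emeasure std_normal ?E" using null by (intro nn_integral_indicator) auto
    finally show ?thesis using null by (simp only: null_setsD1)
  qed
  have "(\<integral>\<^sup>+x. ?u x \<partial>gauss_measure v) = (\<integral>\<^sup>+x. ?u x \<partial>gauss_measure (insert j (v - {j})))"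
    by (simp only: v'(3))
  also have "\<dots> = (\<integral>\<^sup>+x. \<integral>\<^sup>+t. ?u (x(j := t)) \<partial>std_normal \<partial>gauss_measure (v - {j}))"
    by (rule gauss.product_nn_integral_insert[OF v'(1,2)]) (use meas in \<open>simp only: v'(3)\<close>)
  also have "\<dots> = 0" by (simp only: inner nn_integral_const) simp
  finally have "AE x in gauss_measure v. ?u x = 0" using meas by (simp add: nn_integral_0_iff_AE)
  then show ?thesis by eventually_elim (auto simp: indicator_def split: if_splits)
qed

lemma indicator_meas: "continuous_on UNIV G \<Longrightarrow>
  (\<lambda>x. of_bool (K \<le> SA (override y v x)) * (G (override y v x) :: real)) \<in> borel_measurable (gauss_measure v)"
  using measurable_override[OF SA_continuous, of y v] measurable_override[of G y v] by measurable

lemma smoothed_bound: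
  assumes G: "tame D G" and v: "v \<subseteq> D"
  shows "\<exists>C\<ge>0. \<exists>c\<ge>0. \<forall>y. \<bar>smoothed v G y\<bar> \<le> C * exp (c * abs_sum D y)"
proof -
  obtain C c where C: "0 \<le> C" "0 \<le> c" "\<And>z. \<bar>G z\<bar> \<le> C * exp (c * abs_sum D z)" and cont: "continuous_on UNIV G"
    using G by (auto simp: tame_def)
  have fv: "finite v" using v finite_subset by auto
  let ?I = "LINT x|gauss_measure v. (\<Prod>k\<in>v. weight c (x k))"
  have I0: "0 \<le> ?I" by (intro integral_nonneg_AE AE_I2 prod_nonneg) (auto simp: weight_def)
  have "\<bar>smoothed v G y\<bar> \<le> (C * ?I) * exp (c * abs_sum D y)" for y
  proof -
    have int: "integrable (gauss_measure v) (\<lambda>x. C * exp (c * abs_sum D y) * (\<Prod>k\<in>v. weight c (x k)))"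
      by (intro integrable_mult_right integrable_prod_weight fv C)
    have intF: "integrable (gauss_measure v) (\<lambda>x. of_bool (K \<le> SA (override y v x)) * G (override y v x))"
    proof (rule Bochner_Integration.integrable_bound)
      show "integrable (gauss_measure v) (\<lambda>x. G (override y v x))"
        by (rule integrable_tame_override[OF _ v G]) simp
    qed (auto intro: indicator_meas[OF cont])
    have "norm (smoothed v G y) \<le> (LINT x|gauss_measure v. norm (of_bool (K \<le> SA (override y v x)) * G (override y v x)))"
      unfolding smoothed_def by (rule integral_norm_bound)
    also have "\<dots> \<le> (LINT x|gauss_measure v. C * exp (c * abs_sum D y) * (\<Prod>k\<in>v. weight c (x k)))"
    proof (rule integral_mono)
      show "norm (of_bool (K \<le> SA (override y v x)) * G (override y v x)) \<le>
          C * exp (c * abs_sum D y) * (\<Prod>k\<in>v. weight c (x k))" for x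
      proof -
        have "norm (of_bool (K \<le> SA (override y v x)) * G (override y v x)) \<le> \<bar>G (override y v x)\<bar>" by auto
        also have "\<dots> \<le> C * exp (c * abs_sum D y) * (\<Prod>k\<in>v. weight c (x k))"
          by (rule tame_override_bound[OF _ v C order_refl]) simp
        finally show ?thesis .
      qed
    qed (use int intF in auto)
    also have "\<dots> = (C * ?I) * exp (c * abs_sum D y)" by (simp add: mult_ac)
    finally show ?thesis by simp
  qed
  moreover have "0 \<le> C * ?I" using C I0 by simp
  ultimately show ?thesis using C(2) by blast
qed

text \<open>For almost every \<open>x\<close> the indicator is locally constant at the limit point,
  since \<open>SA\<close> is continuous and differs from \<open>K\<close> there. A convergent
  sequence of base points is bounded on \<open>D\<close>, which gives a common majorant.\<close>

lemma smoothed_continuous: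
  assumes G: "tame D G" and v: "v \<subseteq> D" "j \<in> v"
  shows "continuous_on UNIV (smoothed v G)"
proof (rule continuous_on_sequentiallyI)
  fix u :: "nat \<Rightarrow> nat \<Rightarrow> real" and y
  assume lim: "u \<longlonglongrightarrow> y"
  obtain C c where C: "0 \<le> C" "0 \<le> c" "\<And>z. \<bar>G z\<bar> \<le> C * exp (c * abs_sum D z)" and cont: "continuous_on UNIV G"
    using G by (auto simp: tame_def)
  have fv: "finite v" using v finite_subset by auto
  have "(\<lambda>n. \<Sum>k\<in>D. \<bar>u n k\<bar>) \<longlonglongrightarrow> abs_sum D y"
  proof (intro tendsto_sum tendsto_rabs)
    show "(\<lambda>n. u n k) \<longlonglongrightarrow> y k" for k
      by (rule continuous_on_tendsto_compose[OF continuous_on_product_coordinates[of k] lim]) auto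
  qed
  then have "Bseq (\<lambda>n. \<Sum>k\<in>D. \<bar>u n k\<bar>)" by (intro convergent_imp_Bseq) (auto simp: convergent_def)
  then obtain L where L: "\<And>n. (\<Sum>k\<in>D. \<bar>u n k\<bar>) \<le> L" unfolding Bseq_def by (auto simp: abs_le_iff)
  have ov: "(\<lambda>n. override (u n) v x) \<longlonglongrightarrow> override y v x" for x
    by (rule continuous_on_tendsto_compose[OF continuous_on_override lim]) auto
  show "(\<lambda>n. smoothed v G (u n)) \<longlonglongrightarrow> smoothed v G y"
    unfolding smoothed_def
  proof (rule integral_dominated_convergence)
    show "integrable (gauss_measure v) (\<lambda>x. C * exp (c * L) * (\<Prod>k\<in>v. weight c (x k)))"
      by (intro integrable_mult_right integrable_prod_weight fv C)
    show "AE x in gauss_measure v. (\<lambda>n. of_bool (K \<le> SA (override (u n) v x)) * G (override (u n) v x)) \<longlonglongrightarrow>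
        of_bool (K \<le> SA (override y v x)) * G (override y v x)"
      using AE_SA_neq[OF fv v(2), of y]
    proof eventually_elim
      case (elim x)
      have SAlim: "(\<lambda>n. SA (override (u n) v x)) \<longlonglongrightarrow> SA (override y v x)"
        by (rule continuous_on_tendsto_compose[OF SA_continuous ov]) auto
      have "eventually (\<lambda>n. of_bool (K \<le> SA (override (u n) v x)) = (of_bool (K \<le> SA (override y v x)) :: real)) sequentially"
      proof (cases "K < SA (override y v x)")
        case True
        then show ?thesis using order_tendstoD(1)[OF SAlim True] by (auto elim!: eventually_mono)
      next
        case False
        then have "SA (override y v x) < K" using elim by simp
        from order_tendstoD(2)[OF SAlim this] show ?thesis
          by eventually_elim (use \<open>SA (override y v x) < K\<close> in auto)
      qed
      then have "(\<lambda>n. of_bool (K \<le> SA (override (u n) v x)) :: real) \<longlonglongrightarrow> of_bool (K \<le> SA (override y v x))"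
        by (rule tendsto_eventually)
      moreover have "(\<lambda>n. G (override (u n) v x)) \<longlonglongrightarrow> G (override y v x)"
        by (rule continuous_on_tendsto_compose[OF cont ov]) auto
      ultimately show ?case by (rule tendsto_mult)
    qed
    show "AE x in gauss_measure v. norm (of_bool (K \<le> SA (override (u n) v x)) * G (override (u n) v x)) \<le>
        C * exp (c * L) * (\<Prod>k\<in>v. weight c (x k))" for n
    proof (rule AE_I2)
      fix x
      have "norm (of_bool (K \<le> SA (override (u n) v x)) * G (override (u n) v x)) \<le> \<bar>G (override (u n) v x)\<bar>" by auto
      also have "\<dots> \<le> C * exp (c * L) * (\<Prod>k\<in>v. weight c (x k))"
        by (rule tame_override_bound[OF _ v(1) C L]) simp
      finally show "norm (of_bool (K \<le> SA (override (u n) v x)) * G (override (u n) v x)) \<le>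
        C * exp (c * L) * (\<Prod>k\<in>v. weight c (x k))" .
    qed
  qed (auto intro: indicator_meas[OF cont])
qed

text \<open>Replacing the indicator of \<open>{s. K \<le> s}\<close> by \<open>chi n\<close> makes the integrand differentiable.\<close>

definition chi :: "nat \<Rightarrow> real \<Rightarrow> real" where
  "chi n s = 1 / 2 + arctan (real n * (s - K)) / pi"

definition chi' :: "nat \<Rightarrow> real \<Rightarrow> real" where
  "chi' n s = real n / (pi * (1 + (real n * (s - K))\<^sup>2))"

lemma one_plus_square_neq: "1 + (x::real)\<^sup>2 \<noteq> 0"
  using zero_le_power2[of x] by linarith

lemma chi_deriv: "(chi n has_real_derivative chi' n s) (at s)"
proof -
  have "((\<lambda>s. real n * (s - K)) has_real_derivative real n) (at s)" by (auto intro!: derivative_eq_intros)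
  from DERIV_add[OF DERIV_const[of "1 / 2"] DERIV_cdivide[OF DERIV_chain2[OF DERIV_arctan this], of pi]]
  have "((\<lambda>s. 1 / 2 + arctan (real n * (s - K)) / pi) has_real_derivative
      0 + inverse (1 + (real n * (s - K))\<^sup>2) * real n / pi) (at s)" .
  moreover have "0 + inverse (1 + (real n * (s - K))\<^sup>2) * real n / pi = chi' n s"
    unfolding chi'_def by (simp only: divide_inverse inverse_mult_distrib add_0_left mult_ac)
  ultimately show ?thesis unfolding chi_def[abs_def] by simp
qed

lemma chi_bounds: "\<bar>chi n s\<bar> \<le> 1"
proof -
  have "- 1 / 2 \<le> arctan (real n * (s - K)) / pi" "arctan (real n * (s - K)) / pi \<le> 1 / 2"
    using arctan_lbound[of "real n * (s - K)"] arctan_ubound[of "real n * (s - K)"] pi_gt_zero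
    by (auto simp: field_simps)
  then show ?thesis unfolding chi_def abs_le_iff by linarith
qed

lemma chi'_bounds: "\<bar>chi' n s\<bar> \<le> real n"
proof -
  have "1 * 1 \<le> pi * (1 + (real n * (s - K))\<^sup>2)" using pi_gt3 by (intro mult_mono) auto
  then have "chi' n s \<le> real n / 1" unfolding chi'_def by (intro divide_left_mono) auto
  moreover have "0 \<le> chi' n s" by (simp add: chi'_def)
  ultimately show ?thesis by simp
qed

lemma chi_continuous: "continuous_on UNIV (chi n)" "continuous_on UNIV (chi' n)"
  unfolding chi_def[abs_def] chi'_def[abs_def] using one_plus_square_neq
  by (auto intro!: continuous_intros)

text \<open>The bound for the derivative grows with \<open>n\<close>, so it serves only at fixed
  \<open>n\<close>; the passages to the limit rely on \<open>chi_bounds\<close>.\<close>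

lemma tame_chi: "tame D (\<lambda>z. chi n (SA z))" "tame D (\<lambda>z. chi' n (SA z))"
proof -
  show "tame D (\<lambda>z. chi n (SA z))"
    by (rule tame_bounded[OF continuous_on_compose2[OF chi_continuous(1) SA_continuous]]) (auto intro: chi_bounds)
  show "tame D (\<lambda>z. chi' n (SA z))"
    by (rule tame_bounded[OF continuous_on_compose2[OF chi_continuous(2) SA_continuous]]) (auto intro: chi'_bounds)
qed

lemma chi_tendsto: "s \<noteq> K \<Longrightarrow> (\<lambda>n. chi n s) \<longlonglongrightarrow> of_bool (K \<le> s)"
proof -
  assume "s \<noteq> K"
  then consider "K < s" | "s < K" by linarith
  then show ?thesis
  proof cases
    case 1
    have "filterlim (\<lambda>n. (s - K) * real n) at_top sequentially"
      by (rule filterlim_tendsto_pos_mult_at_top[OF tendsto_const _ filterlim_real_sequentially]) (use 1 in simp)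
    then have "(\<lambda>n. arctan ((s - K) * real n)) \<longlonglongrightarrow> pi / 2" by (rule filterlim_compose[OF tendsto_arctan_at_top])
    then have "(\<lambda>n. 1 / 2 + arctan ((s - K) * real n) / pi) \<longlonglongrightarrow> 1 / 2 + (pi / 2) / pi" by (intro tendsto_intros) auto
    then show ?thesis using 1 by (simp add: chi_def mult.commute)
  next
    case 2
    have "filterlim (\<lambda>n. (s - K) * real n) at_bot sequentially"
      by (rule filterlim_tendsto_neg_mult_at_bot[OF tendsto_const _ filterlim_real_sequentially]) (use 2 in simp)
    then have "(\<lambda>n. arctan ((s - K) * real n)) \<longlonglongrightarrow> - (pi / 2)" by (rule filterlim_compose[OF tendsto_arctan_at_bot])
    then have "(\<lambda>n. 1 / 2 + arctan ((s - K) * real n) / pi) \<longlonglongrightarrow> 1 / 2 + (- (pi / 2)) / pi" by (intro tendsto_intros) auto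
    then show ?thesis using 2 by (simp add: chi_def mult.commute)
  qed
qed

lemma chi_SA_partial: "has_partial k (\<lambda>z. chi n (SA z)) (\<lambda>z. chi' n (SA z) * dSA k z)"
  unfolding has_partial_def
proof
  fix z
  have "((\<lambda>s. SA (z(k := s))) has_real_derivative dSA k z) (at (z k))"
    using SA_partial by (simp add: has_partial_def)
  moreover have "(chi n has_real_derivative chi' n (SA z)) (at (SA (z(k := z k))))"
    using chi_deriv[of n "SA z"] by simp
  ultimately show "((\<lambda>s. chi n (SA (z(k := s)))) has_real_derivative chi' n (SA z) * dSA k z) (at (z k))"
    by (rule DERIV_chain2[rotated])
qed

definition mollified :: "nat \<Rightarrow> nat set \<Rightarrow> ((nat \<Rightarrow> real) \<Rightarrow> real) \<Rightarrow> (nat \<Rightarrow> real) \<Rightarrow> real" where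
  "mollified n v G y = (LINT x|gauss_measure v. chi n (SA (override y v x)) * G (override y v x))"

text \<open>By the chain rule, the partial derivative of \<open>chi n (SA z)\<close> in coordinate \<open>k\<close> is
  \<open>dSA k z / dSA j z\<close> times the one in coordinate \<open>j\<close>, and the latter is removed by integration by
  parts; what remains no longer involves \<open>chi'\<close>, so that \<open>n\<close> can tend to infinity.\<close>

lemma stein_mollified:
  assumes v: "v \<subseteq> D" "j \<in> v" and alg: "G \<in> smooth_alg" "G1 \<in> smooth_alg" "W' \<in> smooth_alg"
    and W: "has_partial j (\<lambda>z. dSA k z * inverse (dSA j z) * G z) W'"
  shows "(LINT x|gauss_measure v. chi' n (SA (override y v x)) * dSA k (override y v x) * G (override y v x) +
      chi n (SA (override y v x)) * G1 (override y v x)) =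
    mollified n v (\<lambda>z. G1 z - (W' z - z j * (dSA k z * inverse (dSA j z) * G z))) y"
proof -
  \<comment> \<open>Chosen so that the derivative of \<open>chi n (SA z)\<close> in direction
    \<open>j\<close>, multiplied by \<open>?W z\<close>, is
    \<open>chi' n (SA z) * dSA k z * G z\<close>: the factor \<open>dSA j z\<close> cancels its
    reciprocal.\<close>
  let ?W = "\<lambda>z. dSA k z * inverse (dSA j z) * G z"
  let ?U = "\<lambda>z. chi n (SA z) * ?W z"
  let ?U' = "\<lambda>z. chi' n (SA z) * dSA j z * ?W z + chi n (SA z) * W' z"
  let ?G = "\<lambda>z. G1 z - (W' z - z j * ?W z)"
  let ?E = "\<lambda>z. chi' n (SA z) * dSA k z * G z + chi n (SA z) * G1 z"
  have Walg: "?W \<in> smooth_alg" by (intro smooth_alg.mult alg_dSA smooth_alg.recip alg)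
  have Galg: "?G \<in> smooth_alg" by (intro alg_diff smooth_alg.mult smooth_alg.coord j alg Walg)
  have tU: "tame D ?U" "tame D ?U'"
    by (intro tame_add tame_mult tame_chi alg_tame alg_dSA Walg alg)+
  have tE: "tame D ?E" "tame D (\<lambda>z. chi n (SA z) * ?G z)"
    by (intro tame_add tame_mult tame_chi alg_tame[OF Galg] alg_tame alg_dSA alg)+
  have dU: "has_partial j ?U ?U'" by (rule has_partial_mult[OF chi_SA_partial W])
  have eq: "?U' z - z j * ?U z = ?E z - chi n (SA z) * ?G z" for z
  proof -
    have "chi' n (SA z) * dSA j z * ?W z = chi' n (SA z) * dSA k z * G z * (dSA j z * inverse (dSA j z))"
      by (simp only: mult_ac)
    also have "\<dots> = chi' n (SA z) * dSA k z * G z" using dSA_nonzero by simp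
    finally show ?thesis by (simp add: algebra_simps)
  qed
  have "(LINT x|gauss_measure v. ?U' (override y v x) - override y v x j * ?U (override y v x)) = 0"
    by (rule stein_identity_coordinate[OF _ v tU dU]) simp
  then have "(LINT x|gauss_measure v. ?E (override y v x) - chi n (SA (override y v x)) * ?G (override y v x)) = 0"
    by (simp only: eq)
  moreover have "integrable (gauss_measure v) (\<lambda>x. ?E (override y v x))"
    "integrable (gauss_measure v) (\<lambda>x. chi n (SA (override y v x)) * ?G (override y v x))"
    using integrable_tame_override[OF _ v(1) tE(1), of y] integrable_tame_override[OF _ v(1) tE(2), of y] by simp_all
  ultimately show ?thesis unfolding mollified_def by (simp only: Bochner_Integration.integral_diff)
qed

text \<open>For each fixed \<open>x\<close> the fundamental theorem of calculus applies in
  coordinate \<open>k\<close>, which is not integrated. Fubini's theorem moves the Gaussian integral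
  inside, where \<open>stein_mollified\<close> removes \<open>chi'\<close>.\<close>

lemma mollified_increment:
  assumes v: "v \<subseteq> D" "j \<in> v" and k: "k \<notin> v" and ab: "a \<le> b"
    and alg: "G \<in> smooth_alg" "G1 \<in> smooth_alg" "W' \<in> smooth_alg"
    and G1: "has_partial k G G1" and W: "has_partial j (\<lambda>z. dSA k z * inverse (dSA j z) * G z) W'"
  defines "H \<equiv> \<lambda>z. G1 z - (W' z - z j * (dSA k z * inverse (dSA j z) * G z))"
  shows "mollified n v G (y(k := b)) - mollified n v G (y(k := a)) = (LINT s|lborel. indicator {a..b} s * mollified n v H (y(k := s)))"
proof -
  let ?E = "\<lambda>z. chi' n (SA z) * dSA k z * G z + chi n (SA z) * G1 z"
  have tE: "tame D ?E" by (intro tame_add tame_mult tame_chi alg_tame alg_dSA alg)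
  have tG: "tame D (\<lambda>z. chi n (SA z) * G z)" by (intro tame_mult tame_chi alg_tame alg)
  have contE: "continuous_on UNIV ?E" using tE by (simp add: tame_def)
  have dE: "has_partial k (\<lambda>z. chi n (SA z) * G z) ?E" by (rule has_partial_mult[OF chi_SA_partial G1])
  have fv: "finite v" using v finite_subset by auto
  obtain C c where C: "0 \<le> C" "0 \<le> c" "\<And>z. \<bar>?E z\<bar> \<le> C * exp (c * abs_sum D z)"
    using tE unfolding tame_def by blast
  define L where "L = abs_sum D y + max \<bar>a\<bar> \<bar>b\<bar>"
  have L: "abs_sum D (y(k := s)) \<le> L" if "s \<in> {a..b}" for s
  proof -
    have "\<bar>s\<bar> \<le> max \<bar>a\<bar> \<bar>b\<bar>" using that by (auto simp: abs_le_iff le_max_iff_disj)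
    then show ?thesis using sum_abs_fun_upd[where D = D and y = y and k = k and s = s] by (simp add: L_def)
  qed
  have upd: "override (y(k := s)) v x = (override y v x)(k := s)" for s x by (rule override_upd[OF k])
  define g where "g x = C * exp (c * L) * (\<Prod>l\<in>v. weight c (x l))" for x
  define \<Psi> where "\<Psi> x s = indicator {a..b} s * ?E (override (y(k := s)) v x)" for x s
  have bound: "norm (\<Psi> x s) \<le> g x * indicator {a..b} s" for x s
  proof (cases "s \<in> {a..b}")
    case True
    then show ?thesis using tame_override_bound[where y = "y(k := s)" and x = x, OF _ v(1) C L[OF True]] by (simp add: \<Psi>_def g_def)
  qed (simp add: \<Psi>_def)
  interpret G: prob_space "gauss_measure v" by (rule prob_space_gauss_measure)
  interpret GL: pair_sigma_finite "gauss_measure v" lborel ..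
  have int: "integrable (gauss_measure v \<Otimes>\<^sub>M lborel) (case_prod \<Psi>)"
  proof (rule Bochner_Integration.integrable_bound)
    have "integrable (gauss_measure v) g" unfolding g_def by (intro integrable_mult_right integrable_prod_weight fv C)
    moreover have "integrable lborel (indicator {a..b} :: real \<Rightarrow> real)"
      by (rule integrable_real_indicator) (auto simp: emeasure_lborel_Icc_eq)
    ultimately show "integrable (gauss_measure v \<Otimes>\<^sub>M lborel) (\<lambda>p. g (fst p) * indicator {a..b} (snd p))"
      by (intro integrable_pair_mult) (auto intro: G.sigma_finite_measure_axioms sigma_finite_lborel)
    have ov: "(\<lambda>p. override (y(k := snd p)) v (fst p) l) \<in> borel_measurable (gauss_measure v \<Otimes>\<^sub>M lborel)" for l
    proof (cases "l \<in> v")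
      case True
      then have "(\<lambda>x. x l) \<in> borel_measurable (gauss_measure v)"
        using measurable_component_singleton[of l v "\<lambda>_. std_normal"] by simp
      from measurable_compose[OF measurable_fst this] show ?thesis using True by (simp add: override_def)
    next
      case False
      then show ?thesis by (cases "l = k") (simp_all add: override_def)
    qed
    have "(\<lambda>p. ?E (override (y(k := snd p)) v (fst p))) \<in> borel_measurable (gauss_measure v \<Otimes>\<^sub>M lborel)"
      by (rule measurable_continuous_fun[OF contE ov])
    then show "case_prod \<Psi> \<in> borel_measurable (gauss_measure v \<Otimes>\<^sub>M lborel)"
      unfolding \<Psi>_def case_prod_beta' by measurable
    show "AE p in gauss_measure v \<Otimes>\<^sub>M lborel. norm (case_prod \<Psi> p) \<le> norm (g (fst p) * indicator {a..b} (snd p))"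
      unfolding case_prod_beta' by (rule AE_I2, rule order_trans[OF bound]) simp
  qed
  have inner: "(LINT s|lborel. \<Psi> x s) = chi n (SA (override (y(k := b)) v x)) * G (override (y(k := b)) v x) -
      chi n (SA (override (y(k := a)) v x)) * G (override (y(k := a)) v x)" for x
  proof -
    let ?z = "override y v x"
    have "(LINT s|lborel. indicator {a..b} s *\<^sub>R ?E (?z(k := s))) =
        chi n (SA (?z(k := b))) * G (?z(k := b)) - chi n (SA (?z(k := a))) * G (?z(k := a))"
    proof (rule integral_FTC_atLeastAtMost[OF ab, of "\<lambda>s. chi n (SA (?z(k := s))) * G (?z(k := s))"])
      show "((\<lambda>s. chi n (SA (?z(k := s))) * G (?z(k := s))) has_vector_derivative ?E (?z(k := s))) (at s within {a..b})" for s
        using has_partialD[OF dE, of ?z s]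
        unfolding has_real_derivative_iff_has_vector_derivative by (rule has_vector_derivative_at_within)
      show "continuous_on {a..b} (\<lambda>s. ?E (?z(k := s)))"
        by (rule continuous_on_subset[OF continuous_on_compose2[OF contE continuous_on_fun_upd]]) auto
    qed
    then show ?thesis unfolding \<Psi>_def upd by simp
  qed
  have "mollified n v G (y(k := b)) - mollified n v G (y(k := a)) = (LINT x|gauss_measure v. LINT s|lborel. \<Psi> x s)"
    unfolding inner mollified_def
    using integrable_tame_override[OF _ v(1) tG, of "y(k := b)"] integrable_tame_override[OF _ v(1) tG, of "y(k := a)"]
    by (intro Bochner_Integration.integral_diff[symmetric]) simp_all
  also have "\<dots> = (LINT s|lborel. LINT x|gauss_measure v. \<Psi> x s)"
    by (rule GL.Fubini_integral[OF int, symmetric])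
  also have "\<dots> = (LINT s|lborel. indicator {a..b} s * mollified n v H (y(k := s)))"
  proof (rule Bochner_Integration.integral_cong[OF refl])
    fix s
    have "(LINT x|gauss_measure v. \<Psi> x s) = indicator {a..b} s * (LINT x|gauss_measure v. ?E (override (y(k := s)) v x))"
      unfolding \<Psi>_def by (rule integral_mult_right_zero)
    also have "(LINT x|gauss_measure v. ?E (override (y(k := s)) v x)) = mollified n v H (y(k := s))"
      unfolding H_def by (rule stein_mollified[OF v alg W])
    finally show "(LINT x|gauss_measure v. \<Psi> x s) = indicator {a..b} s * mollified n v H (y(k := s))" .
  qed
  finally show ?thesis .
qed

lemma mollified_tendsto:
  assumes v: "v \<subseteq> D" "j \<in> v" and G: "tame D G"
  shows "(\<lambda>n. mollified n v G y) \<longlonglongrightarrow> smoothed v G y"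
  unfolding mollified_def smoothed_def
proof (rule integral_dominated_convergence)
  have fv: "finite v" using v finite_subset by auto
  have contG: "continuous_on UNIV G" using G by (simp add: tame_def)
  show "integrable (gauss_measure v) (\<lambda>x. \<bar>G (override y v x)\<bar>)"
    using integrable_tame_override[OF _ v(1) G, of y] by simp
  show "AE x in gauss_measure v. (\<lambda>n. chi n (SA (override y v x)) * G (override y v x)) \<longlonglongrightarrow>
      of_bool (K \<le> SA (override y v x)) * G (override y v x)"
    using AE_SA_neq[OF fv v(2), of y] by eventually_elim (intro tendsto_mult chi_tendsto tendsto_const)
  show "AE x in gauss_measure v. norm (chi n (SA (override y v x)) * G (override y v x)) \<le> \<bar>G (override y v x)\<bar>" for n
    using chi_bounds by (intro AE_I2) (simp add: abs_mult mult_left_le_one_le)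
  show "(\<lambda>x. of_bool (K \<le> SA (override y v x)) * G (override y v x)) \<in> borel_measurable (gauss_measure v)"
    by (rule indicator_meas[OF contG])
  have "continuous_on UNIV (\<lambda>z. chi n (SA z) * G z)" for n
    using tame_mult[OF tame_chi(1) G] by (simp add: tame_def)
  from measurable_override[OF this] show "(\<lambda>x. chi n (SA (override y v x)) * G (override y v x)) \<in> borel_measurable (gauss_measure v)" for n
    by simp
qed

lemma mollified_bound:
  assumes v: "v \<subseteq> D" and G: "tame D G"
  shows "\<exists>B. \<forall>n y. abs_sum D y \<le> L \<longrightarrow> \<bar>mollified n v G y\<bar> \<le> B"
proof -
  obtain C c where C: "0 \<le> C" "0 \<le> c" "\<And>z. \<bar>G z\<bar> \<le> C * exp (c * abs_sum D z)"
    using G by (auto simp: tame_def)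
  have fv: "finite v" using v finite_subset by auto
  have "\<bar>mollified n v G y\<bar> \<le> (LINT x|gauss_measure v. C * exp (c * L) * (\<Prod>k\<in>v. weight c (x k)))"
    if y: "abs_sum D y \<le> L" for n y
  proof -
    have "\<bar>mollified n v G y\<bar> \<le> (LINT x|gauss_measure v. norm (chi n (SA (override y v x)) * G (override y v x)))"
      unfolding mollified_def real_norm_def[symmetric] by (rule integral_norm_bound)
    also have "\<dots> \<le> (LINT x|gauss_measure v. C * exp (c * L) * (\<Prod>k\<in>v. weight c (x k)))"
    proof (rule integral_mono)
      show "integrable (gauss_measure v) (\<lambda>x. norm (chi n (SA (override y v x)) * G (override y v x)))"
        using integrable_tame_override[where y = y, OF _ v tame_mult[OF tame_chi(1) G]] by (intro integrable_norm) simp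
      show "integrable (gauss_measure v) (\<lambda>x. C * exp (c * L) * (\<Prod>k\<in>v. weight c (x k)))"
        by (intro integrable_mult_right integrable_prod_weight fv C)
      show "norm (chi n (SA (override y v x)) * G (override y v x)) \<le> C * exp (c * L) * (\<Prod>k\<in>v. weight c (x k))" for x
      proof -
        have "norm (chi n (SA (override y v x)) * G (override y v x)) \<le> \<bar>G (override y v x)\<bar>"
          using chi_bounds by (simp add: abs_mult mult_left_le_one_le)
        also have "\<dots> \<le> C * exp (c * L) * (\<Prod>k\<in>v. weight c (x k))"
          by (rule tame_override_bound[OF _ v C y]) simp
        finally show ?thesis .
      qed
    qed
    finally show ?thesis .
  qed
  then show ?thesis by blast
qed

text \<open>The witness \<open>H\<close> does not depend on \<open>n\<close>, so both sides of
  \<open>mollified_increment\<close> have limits. The increments of \<open>smoothed v G\<close>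
  become integrals of the continuous function \<open>smoothed v H\<close>, which is therefore the
  derivative.\<close>

lemma smoothed_partial:
  assumes v: "v \<subseteq> D" "j \<in> v" and k: "k \<notin> v" and G: "G \<in> smooth_alg"
  shows "\<exists>H\<in>smooth_alg. has_partial k (smoothed v G) (smoothed v H)"
proof -
  obtain G1 where G1: "G1 \<in> smooth_alg" "has_partial k G G1" using alg_partial[OF G] by blast
  have Walg: "(\<lambda>z. dSA k z * inverse (dSA j z) * G z) \<in> smooth_alg"
    by (intro smooth_alg.mult alg_dSA smooth_alg.recip G)
  obtain W' where W': "W' \<in> smooth_alg" "has_partial j (\<lambda>z. dSA k z * inverse (dSA j z) * G z) W'"
    using alg_partial[OF Walg] by blast
  \<comment> \<open>\<open>G1\<close> comes from differentiating \<open>G\<close>; the bracket is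
    what integration by parts in direction \<open>j\<close> makes of the derivative of the
    indicator.\<close>
  define H where "H z = G1 z - (W' z - z j * (dSA k z * inverse (dSA j z) * G z))" for z
  have H: "H \<in> smooth_alg"
    unfolding H_def by (intro alg_diff smooth_alg.mult[OF smooth_alg.coord[OF j]] G1 W' Walg)
  have cont: "continuous_on UNIV (smoothed v H)" by (rule smoothed_continuous[OF alg_tame[OF H] v])
  have contu: "continuous_on UNIV (\<lambda>s. smoothed v H (y(k := s)))" for y
    by (rule continuous_on_compose2[OF cont continuous_on_fun_upd]) auto
  have inc: "smoothed v G (y(k := b)) - smoothed v G (y(k := a)) = (LINT s|lborel. indicator {a..b} s * smoothed v H (y(k := s)))"
    if ab: "a \<le> b" for y a b
  proof -
    define L where "L = abs_sum D y + max \<bar>a\<bar> \<bar>b\<bar>"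
    have L: "abs_sum D (y(k := s)) \<le> L" if "s \<in> {a..b}" for s
    proof -
      have "\<bar>s\<bar> \<le> max \<bar>a\<bar> \<bar>b\<bar>" using that by (auto simp: abs_le_iff le_max_iff_disj)
      then show ?thesis using sum_abs_fun_upd[where D = D and y = y and k = k and s = s] by (simp add: L_def)
    qed
    obtain B where B: "\<And>n y. abs_sum D y \<le> L \<Longrightarrow> \<bar>mollified n v H y\<bar> \<le> B"
      using mollified_bound[OF v(1) alg_tame[OF H]] by blast
    have tG: "tame D (\<lambda>z. chi n (SA z) * H z)" for n by (intro tame_mult tame_chi alg_tame H)
    have contG\<chi>: "(\<lambda>s. mollified n v H (y(k := s))) \<in> borel_measurable borel" for n
    proof -
      interpret G: prob_space "gauss_measure v" by (rule prob_space_gauss_measure)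
      have "(\<lambda>p. chi n (SA (override (y(k := fst p)) v (snd p))) * H (override (y(k := fst p)) v (snd p)))
          \<in> borel_measurable (borel \<Otimes>\<^sub>M gauss_measure v)"
      proof (rule measurable_continuous_fun[where h = "\<lambda>z. chi n (SA z) * H z"])
        show "continuous_on UNIV (\<lambda>z. chi n (SA z) * H z)" using tG by (simp add: tame_def)
        show "(\<lambda>p. override (y(k := fst p)) v (snd p) l) \<in> borel_measurable (borel \<Otimes>\<^sub>M gauss_measure v)" for l
        proof (cases "l \<in> v")
          case True
          then have "(\<lambda>x. x l) \<in> borel_measurable (gauss_measure v)"
            using measurable_component_singleton[of l v "\<lambda>_. std_normal"] by simp
          from measurable_compose[OF measurable_snd this] show ?thesis using True by (simp add: override_def)
        next
          case False
          then show ?thesis by (cases "l = k") (simp_all add: override_def)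
        qed
      qed
      then show ?thesis unfolding mollified_def
        by (intro G.borel_measurable_lebesgue_integral) (simp add: case_prod_beta')
    qed
    have "(\<lambda>n. LINT s|lborel. indicator {a..b} s * mollified n v H (y(k := s))) \<longlonglongrightarrow>
        (LINT s|lborel. indicator {a..b} s * smoothed v H (y(k := s)))"
    proof (rule integral_dominated_convergence)
      show "integrable lborel (\<lambda>s. B * indicator {a..b} s :: real)"
        by (intro integrable_mult_right integrable_real_indicator) (auto simp: emeasure_lborel_Icc_eq)
      show "AE s in lborel. (\<lambda>n. indicator {a..b} s * mollified n v H (y(k := s))) \<longlonglongrightarrow> indicator {a..b} s * smoothed v H (y(k := s))"
        by (intro AE_I2 tendsto_mult tendsto_const mollified_tendsto v alg_tame H)
      show "AE s in lborel. norm (indicator {a..b} s * mollified n v H (y(k := s))) \<le> B * indicator {a..b} s" for n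
      proof (rule AE_I2)
        fix s
        have "\<bar>mollified n v H (y(k := s))\<bar> \<le> B" if "s \<in> {a..b}" by (rule B[OF L[OF that]])
        then show "norm (indicator {a..b} s * mollified n v H (y(k := s))) \<le> B * indicator {a..b} s"
          by (cases "s \<in> {a..b}") simp_all
      qed
      show "(\<lambda>s. indicator {a..b} s * smoothed v H (y(k := s))) \<in> borel_measurable lborel"
        using borel_measurable_continuous_onI[OF contu[of y]] by simp
      show "(\<lambda>s. indicator {a..b} s * mollified n v H (y(k := s))) \<in> borel_measurable lborel" for n
        using contG\<chi>[of n] by simp
    qed
    moreover have "(LINT s|lborel. indicator {a..b} s * mollified n v H (y(k := s))) = mollified n v G (y(k := b)) - mollified n v G (y(k := a))" for n
      unfolding H_def by (rule mollified_increment[OF v k ab G G1(1) W'(1) G1(2) W'(2), symmetric])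
    moreover have "(\<lambda>n. mollified n v G (y(k := b)) - mollified n v G (y(k := a))) \<longlonglongrightarrow> smoothed v G (y(k := b)) - smoothed v G (y(k := a))"
      by (intro tendsto_diff mollified_tendsto v alg_tame G)
    ultimately show ?thesis using LIMSEQ_unique by fastforce
  qed
  have "has_partial k (smoothed v G) (smoothed v H)"
    unfolding has_partial_def
  proof
    fix y
    show "((\<lambda>s. smoothed v G (y(k := s))) has_real_derivative smoothed v H y) (at (y k))"
      using derivative_from_increments[OF contu[of y], of "\<lambda>s. smoothed v G (y(k := s))" "y k"] inc[of _ _ y] by simp
  qed
  then show ?thesis using H by blast
qed

text \<open>Sums are included because an ANOVA term combines projections over different sets
  \<open>v\<close>, all containing \<open>j\<close>; signs are absorbed into
  \<open>G\<close>.\<close>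

inductive_set proj_class :: "((nat \<Rightarrow> real) \<Rightarrow> real) set" where
  proj: "v \<subseteq> D \<Longrightarrow> j \<in> v \<Longrightarrow> G \<in> smooth_alg \<Longrightarrow> smoothed v G \<in> proj_class"
| plus: "g \<in> proj_class \<Longrightarrow> h \<in> proj_class \<Longrightarrow> (\<lambda>z. g z + h z) \<in> proj_class"

lemma proj_class_tame: "h \<in> proj_class \<Longrightarrow> tame D h"
proof (induction rule: proj_class.induct)
  case (proj v G)
  then show ?case using smoothed_continuous smoothed_bound alg_tame unfolding tame_def[of D "smoothed v G"] by blast
qed (rule tame_add)

lemma smoothed_upd_v: "k \<in> v \<Longrightarrow> smoothed v G (y(k := s)) = smoothed v G y"
proof -
  assume "k \<in> v"
  then have "override (y(k := s)) v x = override y v x" for x by (auto simp: override_def fun_eq_iff)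
  then show ?thesis by (simp add: smoothed_def)
qed

lemma proj_class_partial: "h \<in> proj_class \<Longrightarrow> \<exists>h'\<in>proj_class. has_partial k h h'"
proof (induction rule: proj_class.induct)
  case (proj v G)
  show ?case
  proof (cases "k \<in> v")
    case True
    \<comment> \<open>An integrated coordinate of \<open>y\<close> has no influence, and the zero
      function is again of the required form.\<close>
    have "has_partial k (smoothed v G) (smoothed v (\<lambda>_. 0))"
      unfolding has_partial_def by (simp add: smoothed_upd_v[OF True]) (simp add: smoothed_def)
    then show ?thesis using proj_class.proj[OF proj(1,2) smooth_alg.const] by blast
  next
    case False
    then show ?thesis using smoothed_partial[OF proj(1,2) False proj(3)] proj_class.proj[OF proj(1,2)] by blast
  qed
next
  case (plus g h)
  then obtain g' h' where gh: "g' \<in> proj_class" "has_partial k g g'" "h' \<in> proj_class" "has_partial k h h'" by blast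
  show ?case by (rule bexI, rule has_partial_add[OF gh(2,4)]) (intro proj_class.plus gh)
qed

lemma smooth_class_proj_class: "smooth_class D proj_class"
  using proj_class_tame proj_class_partial unfolding smooth_class_def by blast

lemma proj_class_sum:
  assumes "finite I" "\<And>i. i \<in> I \<Longrightarrow> h i \<in> proj_class"
  shows "(\<lambda>z. \<Sum>i\<in>I. h i z) \<in> proj_class"
  using assms
proof (induction I rule: finite_induct)
  case empty
  have "smoothed D (\<lambda>_. 0) \<in> proj_class" by (intro proj_class.proj smooth_alg.const j) simp
  then show ?case by (simp add: smoothed_def[abs_def])
next
  case (insert i I)
  then show ?case by (simp add: proj_class.plus)
qed

lemma smoothed_cmult: "smoothed v (\<lambda>z. c * G z) y = c * smoothed v G y"
  unfolding smoothed_def by (subst integral_mult_right_zero[symmetric]) (simp add: mult.left_commute)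

section \<open>Projections and ANOVA terms of the integrand\<close>

context
  fixes f g
  assumes g: "g \<in> smooth_alg" and f: "f = (\<lambda>x. g x * indicator {x. SA x - K \<ge> 0} x)"
begin

lemma f_eq: "f z = of_bool (K \<le> SA z) * g z"
  by (simp add: f indicator_def)

lemma f_local: "(\<And>k. k \<in> D \<Longrightarrow> z k = z' k) \<Longrightarrow> f z = f z'"
  unfolding f_eq using alg_local[OF g] alg_local[OF alg_SA] by metis

lemma projection_eq: "v \<subseteq> D \<Longrightarrow> projection d v f y = smoothed v g y"
proof -
  assume v: "v \<subseteq> D"
  then have fv: "finite v" using finite_subset by auto
  have eq: "f (merge v (D - v) (x, y)) = of_bool (K \<le> SA (override y v x)) * g (override y v x)" for x
    unfolding f_eq[symmetric] by (rule f_local) (auto simp: merge_def override_def)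
  let ?P = "PiM v (\<lambda>_. lborel :: real measure)"
  let ?h = "\<lambda>x. of_bool (K \<le> SA (override y v x)) * g (override y v x)"
  have "?h \<in> borel_measurable (gauss_measure v)"
    using alg_tame[OF g] by (intro indicator_meas) (simp add: tame_def)
  moreover have "sets (gauss_measure v) = sets ?P" by (rule sets_PiM_cong) auto
  ultimately have m: "?h \<in> borel_measurable ?P" using measurable_cong_sets by blast
  have "smoothed v g y = (LINT x|density ?P (\<lambda>x. ennreal (\<Prod>i\<in>v. std_normal_density (x i))). ?h x)"
    unfolding smoothed_def gauss_measure_density[OF fv] ..
  also have "\<dots> = (LINT x|?P. (\<Prod>i\<in>v. std_normal_density (x i)) *\<^sub>R ?h x)"
    by (rule integral_density[OF m]) (auto intro!: prod_nonneg)
  finally show ?thesis by (simp add: projection_def eq mult.commute)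
qed

lemma projection_in_proj_class:
  assumes "v \<subseteq> D" "j \<in> v"
  shows "projection d v f \<in> proj_class"
proof -
  have "projection d v f = smoothed v g" using projection_eq[OF assms(1)] by auto
  then show ?thesis using proj_class.proj[OF assms g] by simp
qed

text \<open>A subset \<open>u\<close> of \<open>w\<close> misses \<open>j\<close>, so
  \<open>j\<close> is among the integrated coordinates \<open>D - u\<close> of every
  summand.\<close>

lemma anova_term_in_proj_class:
  assumes w: "w \<subseteq> D" "j \<notin> w"
  shows "anova_term d w f \<in> proj_class"
proof -
  have "anova_term d w f = (\<lambda>y. \<Sum>u\<in>Pow w. smoothed (D - u) (\<lambda>z. (-1) ^ (card w - card u) * g z) y)"
    by (simp add: anova_term_def[abs_def] smoothed_cmult projection_eq)
  also have "\<dots> \<in> proj_class"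
    using w j finite_subset[OF w(1)]
    by (intro proj_class_sum proj_class.proj alg_cmult g) auto
  finally show ?thesis .
qed

lemma f_integrable: "integrable (gauss_measure D) f"
proof -
  have cont: "continuous_on UNIV g" using alg_tame[OF g] by (simp add: tame_def)
  have "integrable (gauss_measure D) (\<lambda>x. of_bool (K \<le> SA (override undefined D x)) * g (override undefined D x))"
  proof (rule Bochner_Integration.integrable_bound)
    show "integrable (gauss_measure D) (\<lambda>x. g (override undefined D x))"
      by (rule integrable_tame_override[OF _ order_refl alg_tame[OF g]]) simp
  qed (auto intro: indicator_meas[OF cont])
  moreover have "of_bool (K \<le> SA (override undefined D x)) * g (override undefined D x) = f x" for x
    unfolding f_eq[symmetric] by (rule f_local) (simp add: override_def)
  ultimately show ?thesis by simp
qed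

lemma gauss_expectation_projection:
  assumes v: "v \<subseteq> D"
  shows "gauss_expectation d f = (LINT x|gauss_measure (D - v). projection d v f x)"
proof -
  have fin: "finite (D - v)" "finite v" using v finite_subset by auto
  have un: "(D - v) \<union> v = D" "(D - v) \<inter> v = {}" using v by auto
  have "gauss_expectation d f = (LINT x|gauss_measure ((D - v) \<union> v). f x)" by (simp only: gauss_expectation_def un)
  also have "\<dots> = (LINT x|gauss_measure (D - v). LINT y|gauss_measure v. f (merge (D - v) v (x, y)))"
    by (rule gauss.product_integral_fold[OF un(2) fin]) (simp only: un f_integrable)
  also have "\<dots> = (LINT x|gauss_measure (D - v). smoothed v g x)"
  proof -
    have "f (merge (D - v) v (x, y)) = of_bool (K \<le> SA (override x v y)) * g (override x v y)" for x y
      unfolding f_eq[symmetric] by (rule f_local) (auto simp: merge_def override_def)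
    then show ?thesis by (simp add: smoothed_def)
  qed
  finally show ?thesis using projection_eq[OF v] by simp
qed

lemma smoothed_local:
  assumes "u \<subseteq> D" "\<And>k. k \<in> u \<Longrightarrow> y k = y' k"
  shows "smoothed (D - u) g y = smoothed (D - u) g y'"
proof -
  have "f (override y (D - u) x) = f (override y' (D - u) x)" for x
    by (rule f_local) (use assms in \<open>auto simp: override_def\<close>)
  then show ?thesis by (simp add: smoothed_def f_eq)
qed

text \<open>The term depends only on the coordinates in \<open>w\<close>, and the others integrate
  to 1. This matches the expectation over all of \<open>D\<close> with the one over the domain of
  the quadrature.\<close>

lemma gauss_expectation_anova_term:
  assumes w: "w \<subseteq> D" "j \<notin> w"
  shows "gauss_expectation d (anova_term d w f) = (LINT x|gauss_measure w. anova_term d w f x)"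
proof -
  let ?h = "anova_term d w f"
  have loc: "?h y = ?h y'" if "\<And>k. k \<in> w \<Longrightarrow> y k = y' k" for y y'
    unfolding anova_term_def
  proof (rule sum.cong[OF refl])
    fix u assume "u \<in> Pow w"
    then have u: "u \<subseteq> D" "\<And>k. k \<in> u \<Longrightarrow> y k = y' k" using w that by auto
    show "(-1) ^ (card w - card u) * projection d (D - u) f y = (-1) ^ (card w - card u) * projection d (D - u) f y'"
      using smoothed_local[OF u] by (simp add: projection_eq)
  qed
  have tame: "tame D ?h" by (rule proj_class_tame[OF anova_term_in_proj_class[OF w]])
  have fin: "finite w" "finite (D - w)" using w finite_subset by auto
  have un: "w \<union> (D - w) = D" "w \<inter> (D - w) = {}" using w by auto
  have int: "integrable (gauss_measure D) ?h"
  proof -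
    have "integrable (gauss_measure D) (\<lambda>x. ?h (override undefined D x))"
      by (rule integrable_tame_override[OF _ order_refl tame]) simp
    moreover have "?h (override undefined D x) = ?h x" for x
      by (rule loc) (use w in \<open>auto simp: override_def\<close>)
    ultimately show ?thesis by simp
  qed
  interpret P: prob_space "gauss_measure (D - w)" by (rule prob_space_gauss_measure)
  have "gauss_expectation d ?h = (LINT x|gauss_measure (w \<union> (D - w)). ?h x)" by (simp only: gauss_expectation_def un)
  also have "\<dots> = (LINT x|gauss_measure w. LINT y|gauss_measure (D - w). ?h (merge w (D - w) (x, y)))"
    by (rule gauss.product_integral_fold[OF un(2) fin]) (simp only: un int)
  also have "\<dots> = (LINT x|gauss_measure w. LINT y|gauss_measure (D - w). ?h x)"
  proof -
    have "?h (merge w (D - w) (x, y)) = ?h x" for x y by (rule loc) (simp add: merge_def)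
    then show ?thesis by simp
  qed
  finally show ?thesis by (simp add: P.prob_space)
qed

theorem smoothing_and_rate:
  assumes "v \<subseteq> D" "w \<subseteq> D" "j \<in> v" "j \<notin> w" and b: "b \<ge> 2"
  shows "smooth_on_coords (D - v) (projection d v f)"
    and "smooth_on_coords w (anova_term d w f)"
    and "\<epsilon> > 0 \<Longrightarrow> scrambled_L1_rate M b (D - v) (projection d v f) (gauss_expectation d f) \<epsilon>"
    and "\<epsilon> > 0 \<Longrightarrow> scrambled_L1_rate M b w (anova_term d w f) (gauss_expectation d (anova_term d w f)) \<epsilon>"
proof -
  have p: "projection d v f \<in> proj_class" using projection_in_proj_class assms by simp
  have a: "anova_term d w f \<in> proj_class" using anova_term_in_proj_class assms by simp
  show "smooth_on_coords (D - v) (projection d v f)" "smooth_on_coords w (anova_term d w f)"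
    using smooth_class_smooth_on_coords[OF smooth_class_proj_class] p a by auto
  show "scrambled_L1_rate M b (D - v) (projection d v f) (gauss_expectation d f) \<epsilon>" if "\<epsilon> > 0"
    unfolding gauss_expectation_projection[OF assms(1)]
    by (rule smooth_class_scrambled_L1_rate[OF smooth_class_proj_class p _ _ b that]) auto
  show "scrambled_L1_rate M b w (anova_term d w f) (gauss_expectation d (anova_term d w f)) \<epsilon>" if "\<epsilon> > 0"
    unfolding gauss_expectation_anova_term[OF assms(2,4)]
    by (rule smooth_class_scrambled_L1_rate[OF smooth_class_proj_class a _ _ b that]) (use assms in auto)
qed

end

lemma ln_S: "ln (S i x / S0) = (\<mu> - \<sigma>\<^sup>2 / 2) * real i * (T / real d) + \<sigma> * (\<Sum>k=1..d. A i k * x k)"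
  using pos by (simp add: asset_price_def)

text \<open>The logarithm of a price is affine in the coordinates, so the logarithmic factors of the
  estimators already lie in the algebra.\<close>

lemma alg_ln_S: "(\<lambda>x. ln (S i x / S0)) \<in> smooth_alg"
  unfolding ln_S by (intro smooth_alg.add smooth_alg.const alg_cmult alg_sum smooth_alg.coord) auto

lemma alg_divide: "g \<in> smooth_alg \<Longrightarrow> (\<lambda>x. g x / c) \<in> smooth_alg"
  using smooth_alg.mult[OF _ smooth_alg.const[of "1 / c"], of g] by simp

lemma asian_factors_in_alg:
  assumes "g \<in> asian_factors S0 K T \<sigma> \<mu> d A"
  shows "g \<in> smooth_alg"
proof -
  note intros = smooth_alg.add smooth_alg.mult smooth_alg.const smooth_alg.price alg_SA alg_ln_S
    alg_cmult alg_diff alg_divide alg_sum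
  show ?thesis
    using assms unfolding asian_factors_def Let_def insert_iff empty_iff
    by (elim disjE; (erule FalseE)?; simp only:; intro intros; simp?)
qed

end

theorem theorem6p8:
  fixes S0 K T \<sigma> \<mu> :: real
    and d b :: nat
    and A :: "nat \<Rightarrow> nat \<Rightarrow> real"
    and f g \<phi> :: "(nat \<Rightarrow> real) \<Rightarrow> real"
    and M :: "'w measure"
  assumes "S0 > 0" and "K > 0" and "T > 0" and "\<sigma> > 0"
    and "generating_matrix d T A"
    and "b \<ge> 2"
    and "\<phi> = (\<lambda>x. average_price S0 T \<sigma> \<mu> d A x - K)"
    and "g \<in> asian_factors S0 K T \<sigma> \<mu> d A"
    and "f = (\<lambda>x. g x * indicator {x. \<phi> x \<ge> 0} x)"
  shows
    "(\<forall>j\<in>{1..d}. one_signed_column d A j \<longrightarrow>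
       (\<forall>v w. v \<subseteq> {1..d} \<and> w \<subseteq> {1..d} \<and> j \<in> v \<and> j \<notin> w \<longrightarrow>
          smooth_on_coords ({1..d} - v) (projection d v f) \<and>
          smooth_on_coords w (anova_term d w f) \<and>
          (\<forall>\<epsilon>>0.
             scrambled_L1_rate M b ({1..d} - v) (projection d v f) (gauss_expectation d f) \<epsilon> \<and>
             scrambled_L1_rate M b w (anova_term d w f)
               (gauss_expectation d (anova_term d w f)) \<epsilon>))) \<and>
     ((\<forall>j\<in>{1..d}. one_signed_column d A j) \<longrightarrow>
       (\<forall>v w. v \<subseteq> {1..d} \<and> w \<subseteq> {1..d} \<and> v \<noteq> {} \<and> w \<noteq> {1..d} \<longrightarrow>
          smooth_on_coords ({1..d} - v) (projection d v f) \<and>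
          smooth_on_coords w (anova_term d w f) \<and>
          (\<forall>\<epsilon>>0.
             scrambled_L1_rate M b ({1..d} - v) (projection d v f) (gauss_expectation d f) \<epsilon> \<and>
             scrambled_L1_rate M b w (anova_term d w f)
               (gauss_expectation d (anova_term d w f)) \<epsilon>)))"
proof -
  \<comment> \<open>The statements about \<open>v\<close> and about \<open>w\<close> are proved
    separately, since in the second part of the claim they may require different indices
    \<open>j\<close>.\<close>
  have proj: "smooth_on_coords ({1..d} - v) (projection d v f) \<and>
      (\<forall>\<epsilon>>0. scrambled_L1_rate M b ({1..d} - v) (projection d v f) (gauss_expectation d f) \<epsilon>)"
    if "j \<in> {1..d}" "one_signed_column d A j" "v \<subseteq> {1..d}" "j \<in> v" for j v
  proof -
    interpret asian S0 K T \<sigma> \<mu> d A j by unfold_locales (use assms that in auto)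
    have f: "f = (\<lambda>x. g x * indicator {x. average_price S0 T \<sigma> \<mu> d A x - K \<ge> 0} x)"
      using assms by simp
    \<comment> \<open>The statement about \<open>v\<close> does not involve \<open>w\<close>, so the
      empty set is taken for it.\<close>
    have "j \<notin> {}" by simp
    note res = smoothing_and_rate[OF asian_factors_in_alg[OF assms(8)] f that(3) empty_subsetI that(4) this assms(6)]
    show ?thesis by (intro conjI allI impI res(1,3))
  qed
  have anova: "smooth_on_coords w (anova_term d w f) \<and>
      (\<forall>\<epsilon>>0. scrambled_L1_rate M b w (anova_term d w f) (gauss_expectation d (anova_term d w f)) \<epsilon>)"
    if "j \<in> {1..d}" "one_signed_column d A j" "w \<subseteq> {1..d}" "j \<notin> w" for j w
  proof -
    interpret asian S0 K T \<sigma> \<mu> d A j by unfold_locales (use assms that in auto)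
    have f: "f = (\<lambda>x. g x * indicator {x. average_price S0 T \<sigma> \<mu> d A x - K \<ge> 0} x)"
      using assms by simp
    \<comment> \<open>Conversely, \<open>{j}\<close> is taken for \<open>v\<close> in the statement
      about \<open>w\<close>.\<close>
    have "{j} \<subseteq> {1..d}" "j \<in> {j}" using that by auto
    note res = smoothing_and_rate[OF asian_factors_in_alg[OF assms(8)] f this(1) that(3) this(2) that(4) assms(6)]
    show ?thesis by (intro conjI allI impI res(2,4))
  qed
  have both: "smooth_on_coords ({1..d} - v) (projection d v f) \<and> smooth_on_coords w (anova_term d w f) \<and>
      (\<forall>\<epsilon>>0. scrambled_L1_rate M b ({1..d} - v) (projection d v f) (gauss_expectation d f) \<epsilon> \<and>
        scrambled_L1_rate M b w (anova_term d w f) (gauss_expectation d (anova_term d w f)) \<epsilon>)"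
    if "v \<subseteq> {1..d}" "w \<subseteq> {1..d}" "j \<in> {1..d}" "one_signed_column d A j" "j \<in> v"
      "j' \<in> {1..d}" "one_signed_column d A j'" "j' \<notin> w" for v w j j'
    using proj[OF that(3,4,1,5)] anova[OF that(6,7,2,8)] by simp
  show ?thesis
  proof (rule conjI; intro ballI impI allI; elim conjE)
    fix v w j assume "j \<in> {1..d}" "one_signed_column d A j"
      and "v \<subseteq> {1..d}" "w \<subseteq> {1..d}" "j \<in> v" "j \<notin> w"
    then show "smooth_on_coords ({1..d} - v) (projection d v f) \<and> smooth_on_coords w (anova_term d w f) \<and>
      (\<forall>\<epsilon>>0. scrambled_L1_rate M b ({1..d} - v) (projection d v f) (gauss_expectation d f) \<epsilon> \<and>
        scrambled_L1_rate M b w (anova_term d w f) (gauss_expectation d (anova_term d w f)) \<epsilon>)"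
      by (intro both)
  next
    fix v w assume all: "\<forall>j\<in>{1..d}. one_signed_column d A j"
      and vw: "v \<subseteq> {1..d}" "w \<subseteq> {1..d}" "v \<noteq> {}" "w \<noteq> {1..d}"
    obtain j where j: "j \<in> v" using vw by auto
    obtain j' where j': "j' \<in> {1..d}" "j' \<notin> w" using vw by blast
    have "j \<in> {1..d}" using j vw by auto
    then show "smooth_on_coords ({1..d} - v) (projection d v f) \<and> smooth_on_coords w (anova_term d w f) \<and>
      (\<forall>\<epsilon>>0. scrambled_L1_rate M b ({1..d} - v) (projection d v f) (gauss_expectation d f) \<epsilon> \<and>
        scrambled_L1_rate M b w (anova_term d w f) (gauss_expectation d (anova_term d w f)) \<epsilon>)"
      using all j j' vw by (intro both[of v w j j']) auto
  qed
qed

end
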